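(* Let $V\ge 0$ be a Borel measure on $\mathbb{R}^d$ with $V(\{0\})=0$ and $\int_{\mathbb{R}^d}\min(|z|^2,1)\,V(dz)<\infty$. Let $\mu\ge 0$ be a finite Borel measure on the unit sphere $\mathbb{S}\subset\mathbb{R}^d$. Let $\phi:\mathbb{R}^d\to\mathbb{C}$ and $\varphi:\mathbb{S}\to\mathbb{C}$ be Borel measurable with $\sup_{z\in\mathbb{R}^d}|\phi(z)|\le 1$ and $\sup_{\theta\in\mathbb{S}}|\varphi(\theta)|\le 1$. For $\xi\in\mathbb{R}^d$ define $$M(\xi)=\frac{\int_{\mathbb{R}^d}[1-\cos(\xi,z)]\,\phi(z)\,V(dz)+\frac12\int_{\mathbb{S}}(\xi,\theta)^2\varphi(\theta)\,\mu(d\theta)}{\int_{\mathbb{R}^d}[1-\cos(\xi,z)]\,V(dz)+\frac12\int_{\mathbb{S}}(\xi,\theta)^2\,\mu(d\theta)},$$ with $M(\xi)=0$ if the denominator equals zero. Let $\mathcal{M}$ be the bounded linear operator on $L^2(\mathbb{R}^d)$ defined by $\widehat{\mathcal{M}g}=M\hat g$. Then for every $1<p<\infty$, $$\|\mathcal{M}g\|_p\le (p^*-1)\|g\|_p\quad\text{for all } g\in L^p(\mathbb{R}^d),$$ that is, the inequality holds for $g\in L^2(\mathbb{R}^d)\cap L^p(\mathbb{R}^d)$, and hence $\mathcal{M}$ extends uniquely from $L^2(\mathbb{R}^d)\cap L^p(\mathbb{R}^d)$ to a bounded linear operator on $L^p(\mathbb{R}^d)$ satisfying the same inequality.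
   Context: For $1<p<\infty$, the number $p^*-1$ denotes $\max\{p-1,\frac{1}{p-1}\}$. The pairing is $(\xi,\eta)=\sum_{n=1}^d\xi_n\eta_n$. $L^p(\mathbb{R}^d)$ consists of complex-valued functions, with norm $\|g\|_p=\left(\int_{\mathbb{R}^d}|g(x)|^p\,dx\right)^{1/p}$. The Fourier transform is $\hat f(\xi)=\int_{\mathbb{R}^d}e^{i(\xi,x)}f(x)\,dx$ (extended to $L^2(\mathbb{R}^d)$ in the usual way). Note that $|M|\le 1$, so $\mathcal{M}$ is well defined on $L^2(\mathbb{R}^d)$. *)

theory Defs
  imports "HOL-Analysis.Analysis"
begin

text \<open>
  Elements of \<open>L\<^sup>p(\<real>\<^sup>d)\<close> are represented by Borel measurable functions (every class has a
  Borel representative); equality in \<open>L\<^sup>p\<close> is rendered as equality almost everywhere.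
  \<open>Lp_norm\<close> is meaningful on \<open>Lp p\<close> only: off \<open>Lp p\<close> the Bochner integral is \<open>0\<close> by convention.
\<close>

definition Lp :: "real \<Rightarrow> (real ^ 'd \<Rightarrow> complex) set" where
  "Lp p = {g \<in> borel_measurable lborel. integrable lborel (\<lambda>x. norm (g x) powr p)}"

definition Lp_norm :: "real \<Rightarrow> (real ^ 'd \<Rightarrow> complex) \<Rightarrow> real" where
  "Lp_norm p g = (LINT x|lborel. norm (g x) powr p) powr (1 / p)"

definition Lp_tendsto ::
    "real \<Rightarrow> (nat \<Rightarrow> real ^ 'd \<Rightarrow> complex) \<Rightarrow> (real ^ 'd \<Rightarrow> complex) \<Rightarrow> bool" where
  "Lp_tendsto p u f \<longleftrightarrow> (\<forall>n. u n \<in> Lp p) \<and> f \<in> Lp p \<and>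
     (\<lambda>n. Lp_norm p (\<lambda>x. u n x - f x)) \<longlonglongrightarrow> 0"

definition bounded_linear_Lp ::
    "real \<Rightarrow> ((real ^ 'd \<Rightarrow> complex) \<Rightarrow> (real ^ 'd \<Rightarrow> complex)) \<Rightarrow> bool" where
  "bounded_linear_Lp p T \<longleftrightarrow>
     (\<forall>g\<in>Lp p. T g \<in> Lp p) \<and>
     (\<forall>f\<in>Lp p. \<forall>g\<in>Lp p. \<forall>a b.
        AE x in lborel. T (\<lambda>y. a * f y + b * g y) x = a * T f x + b * T g x) \<and>
     (\<exists>C. \<forall>g\<in>Lp p. Lp_norm p (T g) \<le> C * Lp_norm p g)"

definition fourier :: "(real ^ 'd \<Rightarrow> complex) \<Rightarrow> real ^ 'd \<Rightarrow> complex" where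
  "fourier f \<xi> = (LINT x|lborel. exp (\<i> * complex_of_real (\<xi> \<bullet> x)) * f x)"

text \<open>
  The extension of the Fourier transform by continuity from \<open>L\<^sup>1 \<inter> L\<^sup>2\<close> to \<open>L\<^sup>2\<close>.
  The value is determined up to a null set, and \<open>SOME\<close> picks a representative.
\<close>

definition fourier_L2 :: "(real ^ 'd \<Rightarrow> complex) \<Rightarrow> real ^ 'd \<Rightarrow> complex" where
  "fourier_L2 f = (SOME h. h \<in> Lp 2 \<and>
     (\<forall>u. (\<forall>n. u n \<in> Lp 1) \<and> Lp_tendsto 2 u f \<longrightarrow> Lp_tendsto 2 (\<lambda>n. fourier (u n)) h))"

text \<open>
  The operator on \<open>L\<^sup>2\<close> with a given bounded Fourier multiplier; again \<open>SOME\<close> picks a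
  representative of a function determined up to a null set.
\<close>

definition multiplier_op ::
    "(real ^ 'd \<Rightarrow> complex) \<Rightarrow> (real ^ 'd \<Rightarrow> complex) \<Rightarrow> real ^ 'd \<Rightarrow> complex" where
  "multiplier_op M g = (SOME h. h \<in> Lp 2 \<and>
     (AE \<xi> in lborel. fourier_L2 h \<xi> = M \<xi> * fourier_L2 g \<xi>))"

definition levy_multiplier ::
    "(real ^ 'd) measure \<Rightarrow> (real ^ 'd) measure \<Rightarrow> (real ^ 'd \<Rightarrow> complex) \<Rightarrow> (real ^ 'd \<Rightarrow> complex)
      \<Rightarrow> real ^ 'd \<Rightarrow> complex" where
  "levy_multiplier V \<mu> \<phi> \<psi> \<xi> =
     (let num = (LINT z|V. complex_of_real (1 - cos (\<xi> \<bullet> z)) * \<phi> z)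
                + 1 / 2 * (LINT \<theta>|\<mu>. complex_of_real ((\<xi> \<bullet> \<theta>)\<^sup>2) * \<psi> \<theta>);
          den = (LINT z|V. 1 - cos (\<xi> \<bullet> z)) + 1 / 2 * (LINT \<theta>|\<mu>. (\<xi> \<bullet> \<theta>)\<^sup>2)
      in if den = 0 then 0 else num / complex_of_real den)"

definition pstar_minus_1 :: "real \<Rightarrow> real" where
  "pstar_minus_1 p = max (p - 1) (1 / (p - 1))"

end

theory Submission
  imports Defs "HOL-Probability.Probability"
begin

text \<open>
  Burkholder's function \<open>U(x, y) = (|y| - (p\<^sup>* - 1)|x|)(|x| + |y|)\<^bsup>p-1\<^esup>\<close> majorizes a multiple of
  \<open>|y|\<^sup>p - (p\<^sup>* - 1)\<^sup>p|x|\<^sup>p\<close>, is nonpositive for \<open>y = 0\<close> and is concave along every line whose direction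
  \<open>(h, k)\<close> satisfies \<open>|k| \<le> |h|\<close>. Take finitely many independent two-valued steps, the jump \<open>z\<close>
  having probability \<open>c\<close>. Starting this random walk from Lebesgue measure turns
  \<open>f\<close> into a martingale, which is transformed by coefficients \<open>|w| \<le> 1\<close> depending only on the step.
  Concavity of \<open>U\<close> step by step bounds the \<open>L\<^sup>p\<close> norm of the transform by \<open>(p\<^sup>* - 1)\<parallel>f\<parallel>\<^sub>p\<close>,
  and projecting onto the final position only decreases the norm.

  The projected transform is a Fourier multiplier. A step contributes the energy
  \<open>1 - |1 - c + c exp(-i(\<xi>, z))|\<^sup>2 = 2c(1 - c)(1 - cos (\<xi>, z))\<close>, weighted by the coefficient \<open>w\<close> and
  discounted by the later steps. Repeating a fixed cycle of steps indefinitely and then letting the jump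
  probabilities tend to \<open>0\<close> gives the multiplier of the theorem for a measure \<open>V\<close> with finitely many
  atoms. Bounds with a fixed constant survive bounded pointwise limits of multipliers, by Plancherel and
  Fatou, and every pair \<open>V\<close>, \<open>\<mu>\<close> is such a limit; the spherical part comes from atoms
  at \<open>\<theta> / n\<close> of weight \<open>n\<^sup>2\<close>.
\<close>


section \<open>Burkholder's function\<close>

text \<open>Two-valued steps stand in for a Levy process and its stochastic integrals, so that
  Burkholder's argument needs nothing beyond concavity between two points. Lebesgue measure as
  initial law is not a probability, which is why the walk is a recursion on a list and not a process
  on a probability space. Conditioning on the final position is the adjoint of averaging along the
  walk. The symbol of the later steps therefore meets its own conjugate, and only squared moduli,
  that is 1 - cos, survive next to the coefficients. One cycle of steps supplies only a numerator.
  Repetition sums a geometric series and divides by 1 minus the energy of the cycle, the discrete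
  form of integrating exp(-2 t den) over t > 0. This quotient is insensitive to a common scaling of
  its two parts, so vanishing jump probabilities leave exactly numerator over denominator. The main
  obstacle is the zero set of the denominator, where quotients of approximants need not tend to the
  prescribed value 0. The coefficients are complex, so the transform is controlled by |k| <= |h| in
  the plane, not by real signs.\<close>

lemma sqrt_quadratic_derivs:
  fixes a h :: "'a::real_inner"
  assumes "a + t *\<^sub>R h \<noteq> 0"
  shows "((\<lambda>t. norm (a + t *\<^sub>R h)) has_real_derivative ((a + t *\<^sub>R h) \<bullet> h) / norm (a + t *\<^sub>R h)) (at t)"
    and "((\<lambda>t. ((a + t *\<^sub>R h) \<bullet> h) / norm (a + t *\<^sub>R h)) has_real_derivative
       ((norm h)\<^sup>2 - (((a + t *\<^sub>R h) \<bullet> h) / norm (a + t *\<^sub>R h))\<^sup>2) / norm (a + t *\<^sub>R h)) (at t)"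
proof -
  have eq: "norm (a + t *\<^sub>R h) = sqrt (a \<bullet> a + 2 * t * (a \<bullet> h) + t\<^sup>2 * (h \<bullet> h))" for t
    by (simp add: norm_eq_sqrt_inner inner_add algebra_simps inner_commute power2_eq_square)
  have pos: "a \<bullet> a + 2 * t * (a \<bullet> h) + t\<^sup>2 * (h \<bullet> h) > 0"
    using assms eq[of t] by (metis norm_eq_zero norm_ge_zero real_sqrt_gt_0_iff order_less_le)
  show 1: "((\<lambda>t. norm (a + t *\<^sub>R h)) has_real_derivative ((a + t *\<^sub>R h) \<bullet> h) / norm (a + t *\<^sub>R h)) (at t)"
    unfolding eq using pos
    by (auto intro!: derivative_eq_intros simp: inner_add field_simps inner_commute)
  have nz: "norm (a + t *\<^sub>R h) \<noteq> 0" using assms by simp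
  have hh: "h \<bullet> h = norm h * norm h" by (metis power2_norm_eq_inner power2_eq_square)
  show "((\<lambda>t. ((a + t *\<^sub>R h) \<bullet> h) / norm (a + t *\<^sub>R h)) has_real_derivative
       ((norm h)\<^sup>2 - (((a + t *\<^sub>R h) \<bullet> h) / norm (a + t *\<^sub>R h))\<^sup>2) / norm (a + t *\<^sub>R h)) (at t)"
    apply (rule DERIV_cong)
     apply (rule DERIV_divide[OF _ 1 nz])
     apply (simp add: inner_add)
     apply (auto intro!: derivative_eq_intros)[1]
    using nz hh by (simp add: field_simps power2_eq_square inner_commute)
qed

text \<open>Burkholder's positive factor p (1 - 1/r)^(p-1), with r the larger of p and its conjugate
  exponent, is left out here; it returns as the \<alpha> of the majorization.\<close>

definition burk :: "real \<Rightarrow> complex \<Rightarrow> complex \<Rightarrow> real" where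
  "burk p x y = (norm y - pstar_minus_1 p * norm x) * (norm x + norm y) powr (p - 1)"

lemma pstar_ge2: "2 \<le> p \<Longrightarrow> pstar_minus_1 p = p - 1"
  unfolding pstar_minus_1_def by (auto simp: max_def divide_simps) (smt (verit) mult_le_cancel_left1)

lemma pstar_le2: "1 < p \<Longrightarrow> p \<le> 2 \<Longrightarrow> pstar_minus_1 p = 1 / (p - 1)"
  unfolding pstar_minus_1_def by (auto simp: max_def divide_simps) (smt (verit) mult_le_cancel_left1 mult_left_le)

lemma pstar_pos: "1 < p \<Longrightarrow> 0 < pstar_minus_1 p"
  unfolding pstar_minus_1_def by (auto simp: max_def)

text \<open>Up to the factor p these are the second derivatives along a line of (s - (p-1) r)
  w^(p-1) and, for p <= 2, of (r - (p-1) s) w^(p-1); r and s are the moduli of the two points, H and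
  K the speeds |h| and |k|. Eliminating r r2 = H^2 - r'^2 and s s2 = K^2 - s'^2 leaves terms of one
  sign only, and |K| <= H enters through H^2 - K^2 >= 0.\<close>

lemma burk_second_derivative_core:
  fixes r s r' s' H K p :: real
  assumes "r > 0" "s > 0" "\<bar>K\<bar> \<le> H" "\<bar>r'\<bar> \<le> H" "\<bar>s'\<bar> \<le> \<bar>K\<bar>"
  defines "r2 \<equiv> (H\<^sup>2 - r'\<^sup>2) / r" and "s2 \<equiv> (K\<^sup>2 - s'\<^sup>2) / s" and "w \<equiv> r + s" and "w' \<equiv> r' + s'"
  shows "2 \<le> p \<Longrightarrow> s2 * w powr (p-1) + (p-1) * s' * w powr (p-2) * w' - (p-1) * r' * w powr (p-2) * w'
           - (p-1) * (p-2) * r * w powr (p-3) * w'\<^sup>2 - (p-1) * r * w powr (p-2) * (r2 + s2) \<le> 0" (is "_ \<Longrightarrow> ?G r s r' s' r2 s2 \<le> 0")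
    and "1 < p \<Longrightarrow> p \<le> 2 \<Longrightarrow> r2 * w powr (p-1) + (p-1) * r' * w powr (p-2) * w' - (p-1) * s' * w powr (p-2) * w'
           - (p-1) * (p-2) * s * w powr (p-3) * w'\<^sup>2 - (p-1) * s * w powr (p-2) * (r2 + s2) \<ge> 0"
proof -
  have id: "s2 * (w powr (p-1)) + (p-1) * s' * (w powr (p-2)) * w' - (p-1) * r' * (w powr (p-2)) * w'
           - (p-1) * (p-2) * r * (w powr (p-3)) * w'\<^sup>2 - (p-1) * r * (w powr (p-2)) * (r2 + s2)
        = - (w powr (p-2)) * ((p-2) * w * s2 + (p-1) * (H\<^sup>2 - K\<^sup>2)) - (p-1) * (p-2) * r * (w powr (p-3)) * w'\<^sup>2"
    if "r > 0" "s > 0" "w = r + s" "w' = r' + s'" "r * r2 = H\<^sup>2 - r'\<^sup>2" "s * s2 = K\<^sup>2 - s'\<^sup>2"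
    for r s r' s' r2 s2 w w' H K p :: real
  proof -
    have e: "w powr (p-1) = w * w powr (p-2)" using that powr_add[of w 1 "p-2"] by (simp)
    have "s2 * (r + s) + (p-1) * s' * (r'+s') - (p-1) * r' * (r'+s') - (p-1) * r * (r2 + s2)
      = - ((p-2) * (r+s) * s2 + (p-1) * (H\<^sup>2 - K\<^sup>2))"
      using that(5,6) by algebra
    hence "w powr (p-2) * (s2 * (r + s) + (p-1) * s' * (r'+s') - (p-1) * r' * (r'+s') - (p-1) * r * (r2 + s2))
      = w powr (p-2) * (- ((p-2) * (r+s) * s2 + (p-1) * (H\<^sup>2 - K\<^sup>2)))" by simp
    thus ?thesis unfolding e using that(3,4) by (simp add: algebra_simps)
  qed
  have r2: "r * r2 = H\<^sup>2 - r'\<^sup>2" and s2: "s * s2 = K\<^sup>2 - s'\<^sup>2" using assms(1,2) by (auto simp: r2_def s2_def)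
  have "r'\<^sup>2 \<le> H\<^sup>2" "s'\<^sup>2 \<le> K\<^sup>2" "K\<^sup>2 \<le> H\<^sup>2" using assms(3,4,5) by (auto simp: abs_le_square_iff[symmetric])
  hence nn: "r2 \<ge> 0" "s2 \<ge> 0" "H\<^sup>2 - K\<^sup>2 \<ge> 0" using assms(1,2) by (auto simp: r2_def s2_def)
  have w: "w > 0" using assms by simp
  show "2 \<le> p \<Longrightarrow> s2 * w powr (p-1) + (p-1) * s' * w powr (p-2) * w' - (p-1) * r' * w powr (p-2) * w'
           - (p-1) * (p-2) * r * w powr (p-3) * w'\<^sup>2 - (p-1) * r * w powr (p-2) * (r2 + s2) \<le> 0"
    unfolding id[OF assms(1,2) w_def[THEN meta_eq_to_obj_eq] w'_def[THEN meta_eq_to_obj_eq] r2 s2]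
  proof -
    assume "2 \<le> p"
    hence "0 \<le> w powr (p-2) * ((p-2) * w * s2 + (p-1) * (H\<^sup>2 - K\<^sup>2))" "0 \<le> (p-1) * (p-2) * r * w powr (p-3) * w'\<^sup>2"
      using nn w assms(1,2) by (auto intro!: mult_nonneg_nonneg add_nonneg_nonneg)
    thus "- (w powr (p-2)) * ((p-2) * w * s2 + (p-1) * (H\<^sup>2 - K\<^sup>2)) - (p-1) * (p-2) * r * w powr (p-3) * w'\<^sup>2 \<le> 0" by simp
  qed
  \<comment> \<open>For p <= 2 the two moduli and the two speeds exchange roles; the opposite signs
    of p - 2 and of K^2 - H^2 reverse the conclusion.\<close>
  have w2: "w = s + r" and w2': "w' = s' + r'" by (auto simp: w_def w'_def)
  show "1 < p \<Longrightarrow> p \<le> 2 \<Longrightarrow> r2 * w powr (p-1) + (p-1) * r' * w powr (p-2) * w' - (p-1) * s' * w powr (p-2) * w'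
           - (p-1) * (p-2) * s * w powr (p-3) * w'\<^sup>2 - (p-1) * s * w powr (p-2) * (r2 + s2) \<ge> 0"
    unfolding add.commute[of r2 s2] id[OF assms(2,1) w2 w2' s2 r2]
  proof -
    assume "1 < p" "p \<le> 2"
    hence "0 \<le> w powr (p-2) * ((2-p) * w * r2 + (p-1) * (H\<^sup>2 - K\<^sup>2))" "0 \<le> (p-1) * (2-p) * s * w powr (p-3) * w'\<^sup>2"
      using nn w assms(1,2) by (auto intro!: mult_nonneg_nonneg add_nonneg_nonneg)
    thus "- (w powr (p-2)) * ((p-2) * w * r2 + (p-1) * (K\<^sup>2 - H\<^sup>2)) - (p-1) * (p-2) * s * w powr (p-3) * w'\<^sup>2 \<ge> 0" 
      by (simp add: algebra_simps)
  qed
qed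

text \<open>While neither point passes through 0 both moduli are smooth along the line, and
  concavity is the sign of a second derivative.\<close>

lemma burk_concave_generic:
  fixes a h b k :: complex
  assumes p: "1 < p" and hk: "norm k \<le> norm h"
    and nz: "\<And>t. a + t *\<^sub>R h \<noteq> 0" "\<And>t. b + t *\<^sub>R k \<noteq> 0"
  shows "convex_on UNIV (\<lambda>t. - burk p (a + t *\<^sub>R h) (b + t *\<^sub>R k))"
proof -
  define r where "r t = norm (a + t *\<^sub>R h)" for t
  define s where "s t = norm (b + t *\<^sub>R k)" for t
  define r1 where "r1 t = ((a + t *\<^sub>R h) \<bullet> h) / norm (a + t *\<^sub>R h)" for t
  define s1 where "s1 t = ((b + t *\<^sub>R k) \<bullet> k) / norm (b + t *\<^sub>R k)" for t
  define r2 where "r2 t = ((norm h)\<^sup>2 - (r1 t)\<^sup>2) / r t" for t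
  define s2 where "s2 t = ((norm k)\<^sup>2 - (s1 t)\<^sup>2) / s t" for t
  have pos: "r t > 0" "s t > 0" for t using nz by (auto simp: r_def s_def)
  have D: "(r has_real_derivative r1 t) (at t)" "(r1 has_real_derivative r2 t) (at t)"
     "(s has_real_derivative s1 t) (at t)" "(s1 has_real_derivative s2 t) (at t)" for t
    using sqrt_quadratic_derivs[OF nz(1), of t] sqrt_quadratic_derivs[OF nz(2), of t]
    unfolding r_def[abs_def] r1_def[abs_def] r2_def s_def[abs_def] s1_def[abs_def] s2_def by blast+
  have b: "\<bar>r1 t\<bar> \<le> norm h" "\<bar>s1 t\<bar> \<le> \<bar>norm k\<bar>" for t
    using Cauchy_Schwarz_ineq2[of "a + t *\<^sub>R h" h] Cauchy_Schwarz_ineq2[of "b + t *\<^sub>R k" k] nz[of t]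
    by (auto simp: r1_def s1_def divide_simps mult.commute)
  note core = burk_second_derivative_core[OF pos _ b, of t for t]
  have K: "\<bar>norm k\<bar> \<le> norm h" using hk by simp
  define w where "w t = r t + s t" for t
  define w1 where "w1 t = r1 t + s1 t" for t
  have w: "w t > 0" for t using pos[of t] by (simp add: w_def)
  have Dw: "(w has_real_derivative w1 t) (at t)" "(w1 has_real_derivative (r2 t + s2 t)) (at t)" for t
    unfolding w_def[abs_def] w1_def[abs_def] using D by (auto intro!: derivative_eq_intros)
  have pw: "((\<lambda>t. w t powr q) has_real_derivative (q * w t powr (q - 1) * w1 t)) (at t)" for q t
    using w[of t] by (intro DERIV_cong[OF DERIV_powr[OF Dw(1) w DERIV_const]]) (simp add: powr_diff)
  have sc: "w t powr (p - 1) = w t * w t powr (p-2)" "w t powr p = w t * w t powr (p-1)" for t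
    using w[of t] powr_add[of "w t" 1 "p-2"] powr_add[of "w t" 1 "p-1"] by simp_all
  have burk: "burk p (a + t *\<^sub>R h) (b + t *\<^sub>R k) = (s t - pstar_minus_1 p * r t) * w t powr (p - 1)" for t
    by (simp add: burk_def r_def s_def w_def)
  show ?thesis
  proof (cases "2 \<le> p")
    case True
    have C: "pstar_minus_1 p = p - 1" using True by (rule pstar_ge2)
    \<comment> \<open>Since s - (p-1) r = w - p r, the terms with \<open>r1\<close> cancel in the
      derivative and a common factor p comes out.\<close>
    let ?f1 = "\<lambda>t. p * (s1 t * w t powr (p - 1) - (p-1) * (r t * (w t powr (p-2) * w1 t)))"
    let ?f2 = "\<lambda>t. p * (s2 t * w t powr (p-1) + (p-1) * s1 t * w t powr (p-2) * w1 t - (p-1) * r1 t * w t powr (p-2) * w1 t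
           - (p-1) * (p-2) * r t * w t powr (p-3) * (w1 t)\<^sup>2 - (p-1) * r t * w t powr (p-2) * (r2 t + s2 t))"
    have le: "?f2 t \<le> 0" for t
      using core(1)[OF K True, of t] p unfolding w_def w1_def r2_def s2_def
      by (intro mult_nonneg_nonpos) auto
    have f1: "((\<lambda>t. - ((s t - (p - 1) * r t) * w t powr (p - 1))) has_real_derivative - ?f1 t) (at t)" for t
      apply (rule DERIV_cong, rule DERIV_minus, rule DERIV_mult[OF DERIV_diff[OF D(3) DERIV_cmult[OF D(1)]] pw])
      unfolding sc using w_def[of t] w1_def[of t] by (simp add: algebra_simps)
    have f2: "((\<lambda>t. - ?f1 t) has_real_derivative - ?f2 t) (at t)" for t
      apply (rule DERIV_cong, rule DERIV_minus, rule DERIV_cmult, rule DERIV_diff[OF DERIV_mult[OF D(4) pw]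
           DERIV_cmult[OF DERIV_mult[OF D(1) DERIV_mult[OF pw Dw(2)]]]])
      by (simp add: algebra_simps power2_eq_square)
    show ?thesis unfolding burk C
      by (rule f''_ge0_imp_convex[of _ _ "\<lambda>t. - ?f1 t" "\<lambda>t. - ?f2 t"]) (use f1 f2 le in auto)
  next
    case False
    hence p2: "p \<le> 2" by simp
    have C: "pstar_minus_1 p = 1 / (p - 1)" using p p2 by (rule pstar_le2)
    \<comment> \<open>The same cancellation with r and s exchanged: r - (p-1) s = w - p s.\<close>
    let ?f1 = "\<lambda>t. p/(p-1) * (r1 t * w t powr (p - 1) - (p-1) * (s t * (w t powr (p-2) * w1 t)))"
    let ?f2 = "\<lambda>t. p/(p-1) * (r2 t * w t powr (p-1) + (p-1) * r1 t * w t powr (p-2) * w1 t - (p-1) * s1 t * w t powr (p-2) * w1 t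
           - (p-1) * (p-2) * s t * w t powr (p-3) * (w1 t)\<^sup>2 - (p-1) * s t * w t powr (p-2) * (r2 t + s2 t))"
    have le: "?f2 t \<ge> 0" for t
      using core(2)[OF K p p2, of t] p unfolding w_def w1_def r2_def s2_def
      by (intro mult_nonneg_nonneg) auto
    have f1: "((\<lambda>t. 1 / (p-1) * ((r t - (p - 1) * s t) * w t powr (p - 1))) has_real_derivative ?f1 t) (at t)" for t
      apply (rule DERIV_cong, rule DERIV_cmult, rule DERIV_mult[OF DERIV_diff[OF D(1) DERIV_cmult[OF D(3)]] pw])
      unfolding sc using w_def[of t] w1_def[of t] p by (simp add: field_simps)
    have f2: "(?f1 has_real_derivative ?f2 t) (at t)" for t
      apply (rule DERIV_cong, rule DERIV_cmult, rule DERIV_diff[OF DERIV_mult[OF D(2) pw]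
           DERIV_cmult[OF DERIV_mult[OF D(3) DERIV_mult[OF pw Dw(2)]]]])
      by (simp add: algebra_simps power2_eq_square)
    have q': "- ((s t - 1 / (p - 1) * r t) * w t powr (p - 1)) = 1 / (p-1) * ((r t - (p - 1) * s t) * w t powr (p - 1))" for t
      using p by (simp add: field_simps)
    show ?thesis unfolding burk C q'
      by (rule f''_ge0_imp_convex[of _ _ ?f1 ?f2]) (use f1 f2 le in auto)
  qed
qed


lemma burk_tendsto:
  assumes "1 < p" "(f \<longlongrightarrow> a) F" "(g \<longlongrightarrow> b) F"
  shows "((\<lambda>e. burk p (f e) (g e)) \<longlongrightarrow> burk p a b) F"
  unfolding burk_def using assms
  by (intro tendsto_intros tendsto_powr') auto

text \<open>A displacement along i k is perpendicular to the line, so a single offset e brings it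
  through 0. For k = 0 the line is a point, and a real displacement has the same property.\<close>

lemma line_avoids_zero:
  fixes b k :: complex
  obtains v c where "\<And>e t. e \<noteq> c \<Longrightarrow> b + of_real e * v + t *\<^sub>R k \<noteq> 0"
proof (cases "k = 0")
  case True
  have "e = - Re b" if "b + of_real e * 1 + t *\<^sub>R k = 0" for e t
    using arg_cong[OF that, of Re] True by simp
  thus ?thesis using that[of "- Re b" 1] by blast
next
  case False
  have "e = - Im (b / k)" if "b + of_real e * (\<i> * k) + t *\<^sub>R k = 0" for e t
  proof -
    have "b / k + of_real e * \<i> + of_real t = (b + of_real e * (\<i> * k) + t *\<^sub>R k) / k"
      using False by (simp add: field_simps scaleR_conv_of_real)
    hence "b / k + of_real e * \<i> + of_real t = 0" using that by simp
    from arg_cong[OF this, of Im] show ?thesis by simp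
  qed
  thus ?thesis using that[of "- Im (b/k)" "\<i> * k"] by blast
qed

text \<open>
  A generic small translation of the segment avoids the two singular sets \<open>x = 0\<close> and \<open>y = 0\<close>, so
  no one-sided derivatives have to be examined there.
\<close>

lemma burk_concave:
  assumes p: "1 < p" and hk: "norm (b2 - b1) \<le> norm (a2 - a1)" and c: "0 \<le> c" "c \<le> 1"
  shows "(1 - c) * burk p a1 b1 + c * burk p a2 b2
    \<le> burk p ((1 - of_real c) * a1 + of_real c * a2) ((1 - of_real c) * b1 + of_real c * b2)"
proof -
  obtain va ca where a: "\<And>e t. e \<noteq> ca \<Longrightarrow> a1 + of_real e * va + t *\<^sub>R (a2 - a1) \<noteq> 0"
    by (rule line_avoids_zero[of a1 "a2 - a1"]) blast
  obtain vb cb where b: "\<And>e t. e \<noteq> cb \<Longrightarrow> b1 + of_real e * vb + t *\<^sub>R (b2 - b1) \<noteq> 0"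
    by (rule line_avoids_zero[of b1 "b2 - b1"]) blast
  define A where "A e t = a1 + of_real e * va + t *\<^sub>R (a2 - a1)" for e t
  define B where "B e t = b1 + of_real e * vb + t *\<^sub>R (b2 - b1)" for e t
  have lim: "((\<lambda>e. burk p (A e t) (B e t)) \<longlongrightarrow> burk p (a1 + t *\<^sub>R (a2 - a1)) (b1 + t *\<^sub>R (b2 - b1))) (at_right 0)" for t
    unfolding A_def B_def by (rule burk_tendsto[OF p]) (auto intro!: tendsto_eq_intros)
  \<comment> \<open>Each line excludes one offset, possibly 0 itself, and neither is met eventually
    along \<open>at_right 0\<close>.\<close>
  have ev: "\<forall>\<^sub>F e in at_right 0. (1 - c) * burk p (A e 0) (B e 0) + c * burk p (A e 1) (B e 1) \<le> burk p (A e c) (B e c)"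
    using eventually_neq_at_within[of ca 0 "{0<..}"] eventually_neq_at_within[of cb 0 "{0<..}"]
  proof eventually_elim
    case (elim e)
    have "convex_on UNIV (\<lambda>t. - burk p (A e t) (B e t))"
      unfolding A_def B_def by (rule burk_concave_generic[OF p hk]) (use a b elim in auto)
    from convex_onD[OF this c, of 0 1] show ?case by simp
  qed
  have eq: "x + c *\<^sub>R (y - x) = (1 - of_real c) * x + of_real c * y" for x y :: complex
    by (simp add: scaleR_conv_of_real algebra_simps)
  have "(1 - c) * burk p (a1 + 0 *\<^sub>R (a2 - a1)) (b1 + 0 *\<^sub>R (b2 - b1)) + c * burk p (a1 + 1 *\<^sub>R (a2 - a1)) (b1 + 1 *\<^sub>R (b2 - b1))
     \<le> burk p (a1 + c *\<^sub>R (a2 - a1)) (b1 + c *\<^sub>R (b2 - b1))"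
    by (rule tendsto_le[OF _ lim[of c] _ ev]) (simp, intro tendsto_intros lim)
  thus ?thesis unfolding eq by simp
qed

section \<open>Majorization of a difference of p-th powers by Burkholder's function\<close>

lemma burk_zero_le: "1 < p \<Longrightarrow> burk p x 0 \<le> 0"
  using pstar_pos[of p] by (simp add: burk_def mult_nonneg_nonneg)

text \<open>The right side minus the left side has derivative \<open>p * E\<close> and vanishes at
  0. As \<open>E\<close> changes sign from negative to positive there, 0 is its minimum on (-1,
  \<infinity>).\<close>

lemma powr_le_tangent_powr:
  fixes p \<rho> x :: real
  defines "E \<equiv> \<lambda>x. (1 + \<rho> * x) powr (p-2) * (1 + \<rho> * p * x) - (1 + x) powr (p-1)"
  assumes \<rho>: "0 < \<rho>" "\<rho> < 1" and p: "1 < p" and x: "-1 < x"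
    and E: "\<And>x. 0 \<le> x \<Longrightarrow> 0 \<le> E x" "\<And>x. x \<le> 0 \<Longrightarrow> -1 < x \<Longrightarrow> E x \<le> 0"
  shows "(1 + x) powr p - 1 \<le> p * x * (1 + \<rho> * x) powr (p-1)"
proof -
  define D where "D x = p * x * (1 + \<rho> * x) powr (p-1) - (1 + x) powr p + 1" for x
  have dD: "(D has_real_derivative p * E x) (at x)" if "x > -1" for x
  proof -
    have "\<rho> * x \<ge> \<rho> * (-1)" using that \<rho> by (intro mult_left_mono) auto
    hence a: "1 + \<rho> * x > 0" using \<rho> by simp
    have e: "(1 + \<rho> * x) powr (p-1) = (1 + \<rho> * x) * (1 + \<rho> * x) powr (p-2)"
      using a powr_add[of "1 + \<rho> * x" 1 "p-2"] by simp
    have i: "((\<lambda>x. 1 + \<rho> * x) has_real_derivative \<rho>) (at x)" "((\<lambda>x. 1 + x) has_real_derivative 1) (at x)"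
      by (auto intro!: derivative_eq_intros)
    have d0: "((\<lambda>x. p * x) has_real_derivative p) (at x)" by (auto intro!: derivative_eq_intros)
    have d1: "((\<lambda>x. (1 + \<rho> * x) powr (p-1)) has_real_derivative (p-1) * (1 + \<rho> * x) powr (p-2) * \<rho>) (at x)"
      by (rule DERIV_cong[OF DERIV_powr[OF i(1) a DERIV_const]]) (use a in \<open>simp add: e\<close>)
    have d2: "((\<lambda>x. (1 + x) powr p) has_real_derivative p * (1 + x) powr (p-1)) (at x)"
      by (rule DERIV_cong[OF DERIV_powr[OF i(2) _ DERIV_const]]) (use that in \<open>auto simp: powr_diff\<close>)
    show ?thesis unfolding D_def
      apply (rule DERIV_cong)
       apply (rule DERIV_add[OF DERIV_diff[OF DERIV_mult[OF d0 d1] d2] DERIV_const])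
      unfolding E_def e by algebra
  qed
  have D0: "D 0 = 0" by (simp add: D_def)
  have "D x \<ge> 0"
  proof (cases "x \<ge> 0")
    case True
    have "\<exists>d. (D has_real_derivative d) (at y) \<and> 0 \<le> d" if "0 \<le> y" for y
      using dD[of y] E(1)[OF that] that p by (intro exI[of _ "p * E y"]) auto
    from DERIV_nonneg_imp_nondecreasing[OF True this] show ?thesis using D0 by simp
  next
    case False
    hence x0: "x \<le> 0" by simp
    have "\<exists>d. (D has_real_derivative d) (at y) \<and> d \<le> 0" if "x \<le> y" "y \<le> 0" for y
      using dD[of y] E(2)[of y] that p x by (intro exI[of _ "p * E y"]) (auto simp: mult_nonneg_nonpos)
    from DERIV_nonpos_imp_nonincreasing[OF x0 this] show ?thesis using D0 by simp
  qed
  thus ?thesis unfolding D_def by simp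
qed

text \<open>For \<rho> = 1/p the factor 1 + \<rho> p x is 1 + x and splits off \<open>E\<close>.
  What remains compares the (p-2)-th powers of 1 + x/p and 1 + x, which decrease in the base because
  p <= 2.\<close>

lemma powr_chord_le2:
  fixes p x :: real
  assumes p: "1 < p" "p \<le> 2" and x: "-1 < x"
  shows "(1 + x) powr p - 1 \<le> p * x * (1 + 1/p * x) powr (p-1)"
proof (rule powr_le_tangent_powr[OF _ _ p(1) x])
  have eq: "(1 + 1/p * x) powr (p-2) * (1 + 1/p * p * x) - (1 + x) powr (p-1)
      = (1 + x) * ((1 + 1/p * x) powr (p-2) - (1 + x) powr (p-2))" if "x > -1" for x
    using that p powr_add[of "1 + x" 1 "p-2"] by (simp add: algebra_simps)
  show "0 \<le> (1 + 1/p * x) powr (p-2) * (1 + 1/p * p * x) - (1 + x) powr (p-1)" if "0 \<le> x" for x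
  proof -
    have "x / p \<le> x / 1" using p that by (intro divide_left_mono) auto
    hence "(1 + x) powr (p-2) \<le> (1 + 1/p * x) powr (p-2)"
      using that p by (intro powr_mono2') (auto intro!: add_pos_nonneg)
    thus ?thesis using that by (subst eq) auto
  qed
  show "(1 + 1/p * x) powr (p-2) * (1 + 1/p * p * x) - (1 + x) powr (p-1) \<le> 0" if "x \<le> 0" "-1 < x" for x
  proof -
    have "x * p \<le> x * 1" using p that by (intro mult_left_mono_neg) auto
    hence "x \<le> x / p" using p by (simp add: field_simps)
    hence "(1 + 1/p * x) powr (p-2) \<le> (1 + x) powr (p-2)"
      using that p by (intro powr_mono2') auto
    thus ?thesis using that by (subst eq) (auto intro!: mult_nonneg_nonpos)
  qed
qed (use p in auto)

text \<open>Where 1 + (p-1) x > 0 and p > 2, the sign of \<open>E\<close> is that of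
  \<open>L\<close>, the difference of the logarithms of its two terms, which is increasing and
  vanishes at 0. Where 1 + (p-1) x <= 0 the first term of \<open>E\<close> is nonpositive, and for p
  = 2 \<open>E\<close> is 0.\<close>

lemma powr_chord_ge2:
  fixes p x :: real
  assumes p: "2 \<le> p" and x: "-1 < x"
  shows "(1 + x) powr p - 1 \<le> p * x * (1 + (p-1)/p * x) powr (p-1)"
proof -
  define \<rho> where "\<rho> = (p-1)/p"
  have \<rho>: "0 < \<rho>" "\<rho> < 1" "p * \<rho> = p - 1" "\<rho> * p = p - 1" using p by (auto simp: \<rho>_def)
  have p1: "1 + \<rho> * x > 0" if "x \<ge> -1" for x
  proof -
    have "\<rho> * x \<ge> \<rho> * (-1)" using that \<rho> by (intro mult_left_mono) auto
    thus ?thesis using \<rho> by simp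
  qed
  define E where "E x = (1 + \<rho> * x) powr (p-2) * (1 + (p-1) * x) - (1 + x) powr (p-1)" for x
  have lnE: "sgn (E x) = sgn x" if "x > -1" "1 + (p-1) * x > 0" "p > 2" for x
  proof -
    define L where "L x = (p-2) * ln (1 + \<rho> * x) + ln (1 + (p-1) * x) - (p-1) * ln (1 + x)" for x
    have pos3: "1 + \<rho> * y > 0" "1 + (p-1) * y > 0" "1 + y > 0" if "y \<ge> min 0 x" for y
    proof -
      have "y \<ge> 0 \<or> y \<ge> x" using that by auto
      hence y: "y > -1" using \<open>x > -1\<close> by auto
      show "1 + \<rho> * y > 0" using p1 y by simp
      show "1 + y > 0" using y by simp
      have "(p-1) * y \<ge> (p-1) * min 0 x" using that p by (intro mult_left_mono) auto
      thus "1 + (p-1) * y > 0" using \<open>1 + (p-1) * x > 0\<close> by (auto simp: min_def split: if_splits)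
    qed
    have dL: "\<exists>d. (L has_real_derivative d) (at y) \<and> d > 0" if "y \<ge> min 0 x" for y
    proof -
      note q = pos3[OF that]
      let ?d = "(p-2) * (\<rho> / (1 + \<rho> * y)) + (p-1) / (1 + (p-1) * y) - (p-1) * (1 / (1 + y))"
      have "(L has_real_derivative ?d) (at y)"
        unfolding L_def using q by (auto intro!: derivative_eq_intros)
      moreover have "?d = \<rho> * (p-2) / ((1 + \<rho> * y) * (1 + (p-1) * y) * (1 + y))"
      proof -
        \<comment> \<open>Over the common denominator every power of y cancels, because p \<rho> = p
          - 1.\<close>
        have "(p-2) * \<rho> * ((1 + (p-1) * y) * (1 + y)) + (p-1) * ((1 + \<rho> * y) * (1 + y)) - (p-1) * ((1 + \<rho> * y) * (1 + (p-1)*y)) = \<rho> * (p-2)"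
          using \<rho>(3) by algebra
        moreover have "?d = ((p-2) * \<rho> * ((1 + (p-1) * y) * (1 + y)) + (p-1) * ((1 + \<rho> * y) * (1 + y)) - (p-1) * ((1 + \<rho> * y) * (1 + (p-1)*y))) / ((1 + \<rho> * y) * (1 + (p-1) * y) * (1 + y))"
        proof -
          have gen: "P * (\<rho> / a) + Q / b - Q * (1 / c) = (P * \<rho> * (b * c) + Q * (a * c) - Q * (a * b)) / (a * b * c)"
            if "a > 0" "b > 0" "c > 0" for a b c P Q :: real
            using that by (simp add: field_simps)
          show ?thesis by (rule gen) (use q in auto)
        qed
        ultimately show ?thesis by simp
      qed
      moreover have "\<rho> * (p-2) / ((1 + \<rho> * y) * (1 + (p-1) * y) * (1 + y)) > 0" using q \<rho> \<open>p > 2\<close> by simp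
      ultimately show ?thesis by metis
    qed
    have L0: "L 0 = 0" by (simp add: L_def)
    have sL: "sgn (L x) = sgn x"
    proof (cases x "0::real" rule: linorder_cases)
      case less
      have "L x < L 0" by (rule DERIV_pos_imp_increasing[OF less]) (use dL less in auto)
      thus ?thesis using L0 less by simp
    next
      case greater
      have "L 0 < L x" by (rule DERIV_pos_imp_increasing[OF greater]) (use dL greater in auto)
      thus ?thesis using L0 greater by simp
    qed (simp add: L0)
    have q: "1 + \<rho> * x > 0" "1 + (p-1) * x > 0" "1 + x > 0" using pos3[of x] by auto
    have "exp ((p-2) * ln (1 + \<rho> * x) + ln (1 + (p-1) * x)) - exp ((p-1) * ln (1 + x)) = E x"
      using q by (simp add: E_def powr_def exp_add)
    moreover have "sgn (exp u - exp v) = sgn (u - v)" for u v :: real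
      by (cases u v rule: linorder_cases) auto
    ultimately have "sgn (E x) = sgn (L x)"
      unfolding L_def by metis
    thus ?thesis using sL by simp
  qed
  have E1: "0 \<le> E x" if "0 \<le> x" for x
  proof (cases "p = 2")
    case True thus ?thesis using that p1[of x] by (simp add: E_def)
  next
    case False
    have "sgn (E x) = sgn x" using that p False by (intro lnE) (auto intro!: add_pos_nonneg)
    thus ?thesis using that by (smt (verit) sgn_neg sgn_pos sgn_0)
  qed
  have E2: "E x \<le> 0" if "x \<le> 0" "-1 < x" for x
  proof (cases "p = 2 \<or> 1 + (p-1) * x \<le> 0")
    case True
    thus ?thesis
    proof
      assume "p = 2" thus ?thesis using that p1[of x] by (simp add: E_def)
    next
      assume "1 + (p-1) * x \<le> 0"
      hence "(1 + \<rho> * x) powr (p-2) * (1 + (p-1) * x) \<le> 0" by (intro mult_nonneg_nonpos) auto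
      thus ?thesis unfolding E_def by (smt (verit) powr_ge_zero)
    qed
  next
    case False
    have "sgn (E x) = sgn x" using that p False by (intro lnE) auto
    thus ?thesis using that by (smt (verit) sgn_neg sgn_pos sgn_0)
  qed
  have "(1 + x) powr p - 1 \<le> p * x * (1 + \<rho> * x) powr (p-1)"
    by (rule powr_le_tangent_powr[OF \<rho>(1,2) _ x])
       (use E1 E2 p in \<open>auto simp: E_def \<rho>(4)\<close>)
  thus ?thesis unfolding \<rho>_def .
qed

text \<open>By homogeneity one variable is left: b = C r and s = b (1 + x). The slope \<rho> is
  chosen so that b + \<rho> (s - b) is a multiple \<kappa> (r + s) for all r and s, which produces
  the power (r + s)^(p-1) of Burkholder's function. This forces \<rho> = \<kappa> = (p-1)/p for p >=
  2 and \<rho> = \<kappa> = 1/p for p <= 2.\<close>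

lemma burk_majorizes_pos:
  fixes r s p :: real
  assumes p: "1 < p"
  obtains \<alpha> where "0 < \<alpha>" "\<And>r s. 0 < r \<Longrightarrow> 0 < s \<Longrightarrow> s powr p - (pstar_minus_1 p * r) powr p
       \<le> \<alpha> * ((s - pstar_minus_1 p * r) * (r + s) powr (p - 1))"
proof -
  define C where "C = pstar_minus_1 p"
  have C: "C > 0" using pstar_pos[OF p] by (simp add: C_def)
  obtain \<rho> \<kappa> where \<kappa>: "\<kappa> > 0" and lin: "\<And>r s. C * r + \<rho> * (s - C * r) = \<kappa> * (r + s)"
    and ch: "\<And>x. -1 < x \<Longrightarrow> (1 + x) powr p - 1 \<le> p * x * (1 + \<rho> * x) powr (p-1)"
  proof (cases "2 \<le> p")
    case True
    show ?thesis
      by (rule that[of "(p-1)/p" "(p-1)/p"], use powr_chord_ge2[OF True] p True in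
        \<open>auto simp: C_def pstar_ge2 field_simps\<close>)
  next
    case False
    hence p2: "p \<le> 2" by simp
    have "C * (1 - 1/p) = 1/p" using p p2 by (simp add: C_def pstar_le2 divide_simps)
    hence "C * r + 1/p * (s - C * r) = 1/p * (r + s)" for r s by algebra
    thus ?thesis using that[of "1/p" "1/p"] powr_chord_le2[OF p p2] p by auto
  qed
  show ?thesis
  proof (rule that)
    \<comment> \<open>This \<alpha> is Burkholder's normalizing constant.\<close>
    show "p * \<kappa> powr (p-1) > 0" using p \<kappa> by simp
    fix r s :: real assume rs: "0 < r" "0 < s"
    define b where "b = C * r"
    have b: "b > 0" using rs C by (simp add: b_def)
    define x where "x = s / b - 1"
    have x: "x > -1" "b * (1 + x) = s" "b * x = s - b" using b rs by (auto simp: x_def field_simps)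
    have k: "b * (1 + \<rho> * x) = \<kappa> * (r + s)" using lin[of r s] x(3) unfolding b_def[symmetric] by algebra
    have e: "b powr p = b * b powr (p-1)" using b powr_add[of b 1 "p-1"] by simp
    have "0 < b * (1 + \<rho> * x)" unfolding k using \<kappa> rs by simp
    hence k0: "1 + \<rho> * x > 0" using b by (simp add: zero_less_mult_iff)
    have "b powr p * ((1 + x) powr p - 1) \<le> b powr p * (p * x * (1 + \<rho> * x) powr (p-1))"
      using ch[OF x(1)] by (intro mult_left_mono) auto
    moreover have "b powr p * ((1 + x) powr p - 1) = s powr p - b powr p"
      using b x rs by (simp add: x(2)[symmetric] powr_mult right_diff_distrib)
    moreover have "b powr p * (p * x * (1 + \<rho> * x) powr (p-1)) = p * (b * x) * (b * (1 + \<rho> * x)) powr (p-1)"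
      unfolding e using b k0 by (simp add: powr_mult)
    ultimately have "s powr p - b powr p \<le> p * (s - b) * (\<kappa> * (r + s)) powr (p-1)"
      unfolding k x(3) by simp
    thus "s powr p - (pstar_minus_1 p * r) powr p
       \<le> p * \<kappa> powr (p-1) * ((s - pstar_minus_1 p * r) * (r + s) powr (p - 1))"
      using \<kappa> rs by (simp add: b_def C_def powr_mult mult_ac)
  qed
qed

lemma burk_majorizes:
  assumes p: "1 < p"
  obtains \<alpha> where "0 < \<alpha>"
    "\<And>x y. norm y powr p - pstar_minus_1 p powr p * norm x powr p \<le> \<alpha> * burk p x y"
proof -
  obtain \<alpha> where \<alpha>: "0 < \<alpha>" and *: "\<And>r s. 0 < r \<Longrightarrow> 0 < s \<Longrightarrow> s powr p - (pstar_minus_1 p * r) powr p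
       \<le> \<alpha> * ((s - pstar_minus_1 p * r) * (r + s) powr (p - 1))"
    using burk_majorizes_pos[OF p] by metis
  show ?thesis
  proof (rule that[OF \<alpha>])
    fix x y :: complex
    \<comment> \<open>Adding e > 0 to both moduli moves them into the open quadrant of the previous
      estimate; both sides are continuous as e decreases to 0.\<close>
    let ?r = "\<lambda>e. norm x + e" and ?s = "\<lambda>e. norm y + e"
    have "?s 0 powr p - (pstar_minus_1 p * ?r 0) powr p
       \<le> \<alpha> * ((?s 0 - pstar_minus_1 p * ?r 0) * (?r 0 + ?s 0) powr (p - 1))"
    proof (rule tendsto_le[of "at_right 0"])
      have ev: "\<forall>\<^sub>F e in at_right 0. (0::real) < e" by (simp add: eventually_at_right_less)
      show "\<forall>\<^sub>F e in at_right 0. ?s e powr p - (pstar_minus_1 p * ?r e) powr p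
       \<le> \<alpha> * ((?s e - pstar_minus_1 p * ?r e) * (?r e + ?s e) powr (p - 1))"
        using ev by eventually_elim (intro *, auto intro!: add_nonneg_pos)
      have ev0: "\<forall>\<^sub>F e in at_right 0. (0::real) \<le> e" using ev by eventually_elim simp
      have e1: "\<forall>\<^sub>F e in at_right 0. 0 \<le> ?s e" using ev0 by eventually_elim simp
      have e2: "\<forall>\<^sub>F e in at_right 0. 0 \<le> pstar_minus_1 p * ?r e" using ev0 by (rule eventually_mono) (use pstar_pos[OF p] in auto)
      have e3: "\<forall>\<^sub>F e in at_right 0. 0 \<le> ?r e + ?s e" using ev0 by eventually_elim simp
      show "((\<lambda>e. ?s e powr p - (pstar_minus_1 p * ?r e) powr p) \<longlongrightarrow> ?s 0 powr p - (pstar_minus_1 p * ?r 0) powr p) (at_right 0)"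
        using p e1 e2 by (intro tendsto_diff tendsto_powr') (auto intro!: tendsto_eq_intros)
      show "((\<lambda>e. \<alpha> * ((?s e - pstar_minus_1 p * ?r e) * (?r e + ?s e) powr (p - 1))) \<longlongrightarrow>
         \<alpha> * ((?s 0 - pstar_minus_1 p * ?r 0) * (?r 0 + ?s 0) powr (p - 1))) (at_right 0)"
        using p e3 by (intro tendsto_mult tendsto_const tendsto_powr') (auto intro!: tendsto_eq_intros)
    qed simp
    thus "norm y powr p - pstar_minus_1 p powr p * norm x powr p \<le> \<alpha> * burk p x y"
      using pstar_pos[OF p] by (simp add: burk_def powr_mult)
  qed
qed

section \<open>Lebesgue spaces\<close>

lemma Lp_measurable: "g \<in> Lp p \<Longrightarrow> g \<in> borel_measurable borel"
  by (simp add: Lp_def)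

lemma Lp_nn_integral:
  assumes "g \<in> Lp p" "0 < p"
  shows "(\<integral>\<^sup>+x. ennreal (norm (g x) powr p) \<partial>lborel) = ennreal (Lp_norm p g powr p)"
  using assms by (subst nn_integral_eq_integral) (auto simp: Lp_def Lp_norm_def powr_powr integral_nonneg_AE)

lemma Lp_norm_nonneg [simp]: "0 \<le> Lp_norm p g"
  by (simp add: Lp_norm_def)

lemma Lp_iff_nn_integral:
  fixes g :: "real ^ 'd \<Rightarrow> complex"
  shows "g \<in> Lp p \<longleftrightarrow> g \<in> borel_measurable borel \<and> (\<integral>\<^sup>+x. ennreal (norm (g x) powr p) \<partial>lborel) < \<infinity>"
  unfolding Lp_def by (auto simp: integrable_iff_bounded)

lemma LpI_bound:
  fixes g :: "real ^ 'd \<Rightarrow> complex"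
  assumes g: "g \<in> borel_measurable borel" and p: "0 < p" and c: "0 \<le> c"
    and le: "(\<integral>\<^sup>+x. ennreal (norm (g x) powr p) \<partial>lborel) \<le> ennreal (c powr p)"
  shows "g \<in> Lp p" "Lp_norm p g \<le> c"
proof -
  show L: "g \<in> Lp p" using g le by (auto simp: Lp_iff_nn_integral intro: order_le_less_trans)
  have "Lp_norm p g powr p \<le> c powr p"
    using le unfolding Lp_nn_integral[OF L p] by simp
  thus "Lp_norm p g \<le> c" using p c by (meson Lp_norm_nonneg not_le powr_less_mono2)
qed

lemma Lp_cong_AE:
  fixes f g :: "real ^ 'd \<Rightarrow> complex"
  assumes "f \<in> borel_measurable borel" "g \<in> borel_measurable borel" "AE x in lborel. f x = g x"
  shows "f \<in> Lp p \<longleftrightarrow> g \<in> Lp p" "Lp_norm p f = Lp_norm p g"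
proof -
  have "(\<integral>\<^sup>+x. ennreal (norm (f x) powr p) \<partial>lborel) = (\<integral>\<^sup>+x. ennreal (norm (g x) powr p) \<partial>lborel)"
    using assms(3) by (intro nn_integral_cong_AE) auto
  thus "f \<in> Lp p \<longleftrightarrow> g \<in> Lp p" using assms by (simp add: Lp_iff_nn_integral)
  have "(LINT x|lborel. norm (f x) powr p) = (LINT x|lborel. norm (g x) powr p)"
    using assms by (intro integral_cong_AE) auto
  thus "Lp_norm p f = Lp_norm p g" by (simp add: Lp_norm_def)
qed

lemma powr_convex_combination:
  fixes x y u v p :: real
  assumes "1 \<le> p" "0 \<le> x" "0 \<le> y" "0 \<le> u" "0 \<le> v" "u + v = 1"
  shows "(u * x + v * y) powr p \<le> u * x powr p + v * y powr p"
proof (cases "x = 0 \<or> y = 0")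
  case True
  have "w powr p \<le> w" if "0 \<le> w" "w \<le> 1" for w :: real
    using powr_mono'[of 1 p w] that assms(1) by simp
  hence "u powr p * x powr p \<le> u * x powr p" "v powr p * y powr p \<le> v * y powr p"
    using assms by (auto intro!: mult_right_mono)
  thus ?thesis using True assms by (auto simp: powr_mult)
next
  case False
  thus ?thesis using powr_convex[OF assms(1)] assms unfolding convex_on_def by auto
qed

text \<open>The point (a+b)/(s+t) is the convex combination of a/s and b/t with weights s/(s+t) and
  t/(s+t). With s and t slightly above the norms of two functions this is Minkowski's inequality
  before integration.\<close>

lemma powr_add_le_convex:
  fixes a b s t p :: real
  assumes "1 \<le> p" "0 \<le> a" "0 \<le> b" "0 < s" "0 < t"
  shows "(a + b) powr p \<le> (s + t) powr p * (s / (s + t) * (a / s) powr p + t / (s + t) * (b / t) powr p)"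
proof -
  have e: "(s / (s + t)) * (a / s) + (t / (s + t)) * (b / t) = (a + b) / (s + t)"
    using assms by (simp add: add_divide_distrib)
  have "((s / (s + t)) *\<^sub>R (a / s) + (t / (s + t)) *\<^sub>R (b / t)) powr p
     \<le> s / (s + t) * (a / s) powr p + t / (s + t) * (b / t) powr p"
    unfolding real_scaleR_def using assms
    by (intro powr_convex_combination) (auto simp: add_divide_distrib[symmetric])
  hence "((a + b) / (s + t)) powr p \<le> s / (s + t) * (a / s) powr p + t / (s + t) * (b / t) powr p"
    unfolding real_scaleR_def e .
  hence "(s + t) powr p * ((a + b) / (s + t)) powr p \<le> (s + t) powr p * (s / (s + t) * (a / s) powr p + t / (s + t) * (b / t) powr p)"
    by (intro mult_left_mono) auto
  moreover have "(s + t) powr p * ((a + b) / (s + t)) powr p = (a + b) powr p"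
    using assms by (simp add: powr_mult[symmetric])
  ultimately show ?thesis by simp
qed

text \<open>Strict bounds keep the divisors s and t positive even if a norm is 0; letting them
  decrease to the norms gives the triangle inequality.\<close>

lemma Lp_add_strict:
  fixes f g :: "real ^ 'd \<Rightarrow> complex"
  assumes p: "1 \<le> p" and f: "f \<in> Lp p" and g: "g \<in> Lp p" and st: "Lp_norm p f < s" "Lp_norm p g < t"
  shows "(\<lambda>x. f x + g x) \<in> Lp p" "Lp_norm p (\<lambda>x. f x + g x) \<le> s + t"
proof -
  have pos: "s > 0" "t > 0" using st Lp_norm_nonneg[of p f] Lp_norm_nonneg[of p g] by linarith+
  note [measurable] = Lp_measurable[OF f] Lp_measurable[OF g]
  have sc: "(\<integral>\<^sup>+x. ennreal ((norm (h x) / s) powr p) \<partial>lborel) \<le> 1" if h: "h \<in> Lp p" and s: "Lp_norm p h < s" "s > 0" 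
    for h :: "real ^ 'd \<Rightarrow> complex" and s
  proof -
    note [measurable] = Lp_measurable[OF h]
    have "(\<integral>\<^sup>+x. ennreal ((norm (h x) / s) powr p) \<partial>lborel) = (\<integral>\<^sup>+x. ennreal (1 / s powr p) * ennreal (norm (h x) powr p) \<partial>lborel)"
      using s by (intro nn_integral_cong) (simp add: ennreal_mult'[symmetric] powr_divide)
    also have "\<dots> = ennreal (1 / s powr p) * ennreal (Lp_norm p h powr p)"
      using Lp_nn_integral[OF h] p by (subst nn_integral_cmult) auto
    also have "\<dots> = ennreal (Lp_norm p h powr p / s powr p)" by (simp add: ennreal_mult'[symmetric])
    also have "\<dots> \<le> 1"
      using s p powr_mono2[of p "Lp_norm p h" s] by (simp add: ennreal_le_1 divide_le_eq_1)
    finally show ?thesis .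
  qed
  let ?a = "(s + t) powr p * (s / (s + t))" and ?b = "(s + t) powr p * (t / (s + t))"
  have "(\<integral>\<^sup>+x. ennreal (norm (f x + g x) powr p) \<partial>lborel)
     \<le> (\<integral>\<^sup>+x. ennreal ?a * ennreal ((norm (f x) / s) powr p) + ennreal ?b * ennreal ((norm (g x) / t) powr p) \<partial>lborel)"
  proof (rule nn_integral_mono)
    fix x
    have "norm (f x + g x) powr p \<le> (norm (f x) + norm (g x)) powr p"
      using p by (intro powr_mono2 norm_triangle_ineq) auto
    also have "\<dots> \<le> (s + t) powr p * (s / (s + t) * (norm (f x) / s) powr p + t / (s + t) * (norm (g x) / t) powr p)"
      using p pos by (intro powr_add_le_convex) auto
    also have "\<dots> = ?a * (norm (f x) / s) powr p + ?b * (norm (g x) / t) powr p" by (simp add: algebra_simps)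
    finally show "ennreal (norm (f x + g x) powr p) \<le> ennreal ?a * ennreal ((norm (f x) / s) powr p) + ennreal ?b * ennreal ((norm (g x) / t) powr p)"
      using pos by (subst (1 2) ennreal_mult'[symmetric]) (auto simp flip: ennreal_plus intro!: ennreal_leI)
  qed
  also have "\<dots> = ennreal ?a * (\<integral>\<^sup>+x. ennreal ((norm (f x) / s) powr p) \<partial>lborel) + ennreal ?b * (\<integral>\<^sup>+x. ennreal ((norm (g x) / t) powr p) \<partial>lborel)"
    by (subst nn_integral_add) (auto simp: nn_integral_cmult)
  also have "\<dots> \<le> ennreal ?a * 1 + ennreal ?b * 1"
    by (intro add_mono mult_left_mono sc f g st pos) auto
  also have "\<dots> = ennreal ((s + t) powr p)"
    using pos by (simp flip: ennreal_plus add: distrib_left[symmetric] add_divide_distrib[symmetric])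
  finally have le: "(\<integral>\<^sup>+x. ennreal (norm (f x + g x) powr p) \<partial>lborel) \<le> ennreal ((s + t) powr p)" .
  from LpI_bound[OF _ _ _ le] show "(\<lambda>x. f x + g x) \<in> Lp p" "Lp_norm p (\<lambda>x. f x + g x) \<le> s + t"
    using p pos by auto
qed

lemma Lp_add: "1 \<le> p \<Longrightarrow> f \<in> Lp p \<Longrightarrow> g \<in> Lp p \<Longrightarrow> (\<lambda>x. f x + g x) \<in> Lp p"
  by (rule Lp_add_strict(1)[of p f g "Lp_norm p f + 1" "Lp_norm p g + 1"]) auto

lemma Lp_norm_triangle:
  assumes "1 \<le> p" "f \<in> Lp p" "g \<in> Lp p"
  shows "Lp_norm p (\<lambda>x. f x + g x) \<le> Lp_norm p f + Lp_norm p g"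
proof (rule field_le_epsilon)
  fix e :: real assume "e > 0"
  thus "Lp_norm p (\<lambda>x. f x + g x) \<le> Lp_norm p f + Lp_norm p g + e"
    using Lp_add_strict(2)[OF assms, of "Lp_norm p f + e/2" "Lp_norm p g + e/2"] by simp
qed

lemma Lp_scale: 
  assumes "0 < p" "f \<in> Lp p"
  shows "(\<lambda>x. c * f x) \<in> Lp p" "Lp_norm p (\<lambda>x. c * f x) = norm c * Lp_norm p f"
  using assms unfolding Lp_def Lp_norm_def 
  by (auto simp: norm_mult powr_mult powr_powr integral_nonneg_AE)

lemma Lp_minus:
  assumes "f \<in> Lp p"
  shows "(\<lambda>x. - f x) \<in> Lp p" "Lp_norm p (\<lambda>x. - f x) = Lp_norm p f"
  using assms by (auto simp: Lp_def Lp_norm_def)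

lemma Lp_diff: "1 \<le> p \<Longrightarrow> f \<in> Lp p \<Longrightarrow> g \<in> Lp p \<Longrightarrow> (\<lambda>x. f x - g x) \<in> Lp p"
  using Lp_add[of p f "\<lambda>x. - g x"] Lp_minus(1)[of g p] by simp

lemma Lp_norm_commute: "Lp_norm p (\<lambda>x. f x - g x) = Lp_norm p (\<lambda>x. g x - f x)"
  by (simp add: Lp_norm_def norm_minus_commute)

lemma Lp_norm_triangle3:
  assumes "1 \<le> p" "f \<in> Lp p" "g \<in> Lp p" "h \<in> Lp p"
  shows "Lp_norm p (\<lambda>x. f x - h x) \<le> Lp_norm p (\<lambda>x. f x - g x) + Lp_norm p (\<lambda>x. g x - h x)"
  using Lp_norm_triangle[OF assms(1) Lp_diff[OF assms(1-3)] Lp_diff[OF assms(1,3,4)]] by simp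

lemma Lp_norm_diff_ge:
  assumes "1 \<le> p" "f \<in> Lp p" "g \<in> Lp p"
  shows "\<bar>Lp_norm p f - Lp_norm p g\<bar> \<le> Lp_norm p (\<lambda>x. f x - g x)"
  using Lp_norm_triangle[OF assms(1) Lp_diff[OF assms] assms(3)]
    Lp_norm_triangle[OF assms(1) Lp_diff[OF assms(1,3,2)] assms(2)] Lp_norm_commute[of p f g] by simp

lemma Lp_norm_eq_0D:
  assumes "f \<in> Lp p" "0 < p" "Lp_norm p f = 0"
  shows "AE x in lborel. f x = 0"
proof -
  have "(\<integral>\<^sup>+x. ennreal (norm (f x) powr p) \<partial>lborel) = 0"
    using assms by (simp add: Lp_nn_integral)
  hence "AE x in lborel. norm (f x) powr p = 0"
    using Lp_measurable[OF assms(1)] by (subst (asm) nn_integral_0_iff_AE) auto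
  thus ?thesis by eventually_elim simp
qed

lemma Lp_zero: "0 < p \<Longrightarrow> (\<lambda>x. 0) \<in> Lp p" "0 < p \<Longrightarrow> Lp_norm p (\<lambda>x. 0) = 0"
  by (auto simp: Lp_def Lp_norm_def)

lemma Lp_bound:
  fixes f g :: "real ^ 'd \<Rightarrow> complex"
  assumes f: "f \<in> borel_measurable borel" and g: "g \<in> Lp p" and p: "0 < p"
    and le: "AE x in lborel. norm (f x) \<le> c * norm (g x)" and c: "0 \<le> c"
  shows "f \<in> Lp p" "Lp_norm p f \<le> c * Lp_norm p g"
proof -
  have "(\<integral>\<^sup>+x. ennreal (norm (f x) powr p) \<partial>lborel) \<le> (\<integral>\<^sup>+x. ennreal (norm (complex_of_real c * g x) powr p) \<partial>lborel)"
    using le c p by (intro nn_integral_mono_AE, elim eventually_mono) (auto intro!: powr_mono2 simp: norm_mult ennreal_leI)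
  also have "\<dots> = ennreal ((c * Lp_norm p g) powr p)"
    using Lp_scale[OF p g, of "complex_of_real c"] c by (subst Lp_nn_integral) (auto simp: p)
  finally show "f \<in> Lp p" "Lp_norm p f \<le> c * Lp_norm p g"
    using LpI_bound[OF f p, of "c * Lp_norm p g"] c by auto
qed

lemma Lp_Fatou:
  fixes u :: "nat \<Rightarrow> real ^ 'd \<Rightarrow> complex"
  assumes u: "\<And>n. u n \<in> Lp p" and p: "0 < p" and c: "0 \<le> c" and le: "\<forall>\<^sub>F n in sequentially. Lp_norm p (u n) \<le> c"
    and lim: "AE x in lborel. (\<lambda>n. u n x) \<longlonglongrightarrow> f x" and f: "f \<in> borel_measurable borel"
  shows "f \<in> Lp p" "Lp_norm p f \<le> c"
proof -
  note [measurable] = Lp_measurable[OF u]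
  have "(\<integral>\<^sup>+x. ennreal (norm (f x) powr p) \<partial>lborel) = (\<integral>\<^sup>+x. liminf (\<lambda>n. ennreal (norm (u n x) powr p)) \<partial>lborel)"
  proof (rule nn_integral_cong_AE)
    show "AE x in lborel. ennreal (norm (f x) powr p) = liminf (\<lambda>n. ennreal (norm (u n x) powr p))"
      using lim
    proof eventually_elim
      case (elim x)
      have "(\<lambda>n. ennreal (norm (u n x) powr p)) \<longlonglongrightarrow> ennreal (norm (f x) powr p)"
        using elim p by (intro tendsto_ennrealI tendsto_powr' tendsto_norm) auto
      from lim_imp_Liminf[OF _ this] show ?case by simp
    qed
  qed
  also have "\<dots> \<le> liminf (\<lambda>n. \<integral>\<^sup>+x. ennreal (norm (u n x) powr p) \<partial>lborel)"
    by (intro nn_integral_liminf) auto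
  also have "\<dots> = liminf (\<lambda>n. ennreal (Lp_norm p (u n) powr p))"
    using u p by (simp add: Lp_nn_integral)
  also have "\<dots> \<le> ennreal (c powr p)"
  proof -
    have "\<forall>\<^sub>F n in sequentially. ennreal (Lp_norm p (u n) powr p) \<le> ennreal (c powr p)"
      using le by eventually_elim (use p in \<open>auto intro!: ennreal_leI powr_mono2\<close>)
    hence "liminf (\<lambda>n. ennreal (Lp_norm p (u n) powr p)) \<le> liminf (\<lambda>n::nat. ennreal (c powr p))"
      by (rule Liminf_mono)
    thus ?thesis by (simp add: Liminf_const)
  qed
  finally show "f \<in> Lp p" "Lp_norm p f \<le> c" using LpI_bound[OF f p c] by auto
qed

section \<open>Convergence in L^p, completeness and extension by continuity\<close>

lemma Lp_tendstoD: "Lp_tendsto p u f \<Longrightarrow> u n \<in> Lp p" "Lp_tendsto p u f \<Longrightarrow> f \<in> Lp p"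
   "Lp_tendsto p u f \<Longrightarrow> (\<lambda>n. Lp_norm p (\<lambda>x. u n x - f x)) \<longlonglongrightarrow> 0"
  by (auto simp: Lp_tendsto_def)

lemma Lp_tendstoI:
  "(\<And>n. u n \<in> Lp p) \<Longrightarrow> f \<in> Lp p \<Longrightarrow> (\<lambda>n. Lp_norm p (\<lambda>x. u n x - f x)) \<longlonglongrightarrow> 0 \<Longrightarrow> Lp_tendsto p u f"
  by (auto simp: Lp_tendsto_def)

lemma Lp_tendsto_norm:
  assumes "1 \<le> p" "Lp_tendsto p u f"
  shows "(\<lambda>n. Lp_norm p (u n)) \<longlonglongrightarrow> Lp_norm p f"
proof (rule LIM_zero_cancel, rule Lim_null_comparison[OF _ Lp_tendstoD(3)[OF assms(2)]])
  show "\<forall>\<^sub>F n in sequentially. norm (Lp_norm p (u n) - Lp_norm p f) \<le> Lp_norm p (\<lambda>x. u n x - f x)"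
    using Lp_norm_diff_ge[OF assms(1) Lp_tendstoD(1,2)[OF assms(2)]] by simp
qed

lemma Lp_tendsto_unique:
  assumes p: "1 \<le> p" and f: "Lp_tendsto p u f" and g: "Lp_tendsto p u g"
  shows "AE x in lborel. f x = g x"
proof -
  note L = Lp_tendstoD[OF f] Lp_tendstoD[OF g]
  have "(\<lambda>n. Lp_norm p (\<lambda>x. u n x - f x) + Lp_norm p (\<lambda>x. u n x - g x)) \<longlonglongrightarrow> 0 + 0"
    by (intro tendsto_add L)
  moreover have "Lp_norm p (\<lambda>x. f x - g x) \<le> Lp_norm p (\<lambda>x. u n x - f x) + Lp_norm p (\<lambda>x. u n x - g x)" for n
    using Lp_norm_triangle3[OF p L(2) L(1) L(5), of n] by (simp add: Lp_norm_commute[of p f "u n"])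
  ultimately have "Lp_norm p (\<lambda>x. f x - g x) \<le> 0"
    by (intro LIMSEQ_le_const) (auto)
  hence "Lp_norm p (\<lambda>x. f x - g x) = 0" using Lp_norm_nonneg[of p "\<lambda>x. f x - g x"] by linarith
  hence "AE x in lborel. f x - g x = 0"
    using Lp_norm_eq_0D[OF Lp_diff[OF p L(2,5)]] p by simp
  thus ?thesis by simp
qed

lemma Lp_tendsto_cong_AE:
  assumes u: "Lp_tendsto p u f" and v: "\<And>n. v n \<in> borel_measurable borel" "g \<in> borel_measurable borel"
    and eq: "\<And>n. AE x in lborel. u n x = v n x" "AE x in lborel. f x = g x"
  shows "Lp_tendsto p v g"
proof (rule Lp_tendstoI)
  note L = Lp_tendstoD[OF u] and [measurable] = Lp_measurable[OF Lp_tendstoD(1)[OF u]] Lp_measurable[OF Lp_tendstoD(2)[OF u]] v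
  show "v n \<in> Lp p" for n using Lp_cong_AE(1)[OF _ _ eq(1)] L(1) by auto
  show "g \<in> Lp p" using Lp_cong_AE(1)[OF _ _ eq(2)] L(2) by auto
  have "Lp_norm p (\<lambda>x. v n x - g x) = Lp_norm p (\<lambda>x. u n x - f x)" for n
    using eq(1)[of n] eq(2) by (intro Lp_cong_AE) auto
  thus "(\<lambda>n. Lp_norm p (\<lambda>x. v n x - g x)) \<longlonglongrightarrow> 0" using L(3) by simp
qed

lemma Lp_tendsto_lin:
  assumes p: "1 \<le> p" and u: "Lp_tendsto p u f" and v: "Lp_tendsto p v g"
  shows "Lp_tendsto p (\<lambda>n x. a * u n x + b * v n x) (\<lambda>x. a * f x + b * g x)"
proof (rule Lp_tendstoI)
  have p0: "0 < p" using p by simp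
  note L = Lp_tendstoD[OF u] Lp_tendstoD[OF v]
  show "(\<lambda>x. a * u n x + b * v n x) \<in> Lp p" for n by (intro Lp_add Lp_scale p p0 L)
  show "(\<lambda>x. a * f x + b * g x) \<in> Lp p" by (intro Lp_add Lp_scale p p0 L)
  have "Lp_norm p (\<lambda>x. (a * u n x + b * v n x) - (a * f x + b * g x))
    \<le> norm a * Lp_norm p (\<lambda>x. u n x - f x) + norm b * Lp_norm p (\<lambda>x. v n x - g x)" for n
  proof -
    have "Lp_norm p (\<lambda>x. a * (u n x - f x) + b * (v n x - g x))
      \<le> Lp_norm p (\<lambda>x. a * (u n x - f x)) + Lp_norm p (\<lambda>x. b * (v n x - g x))"
      by (intro Lp_norm_triangle p Lp_scale p0 Lp_diff L)
    also have "\<dots> = norm a * Lp_norm p (\<lambda>x. u n x - f x) + norm b * Lp_norm p (\<lambda>x. v n x - g x)"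
      using L p p0 by (simp add: Lp_scale(2)[OF p0 Lp_diff])
    finally show ?thesis by (simp add: algebra_simps)
  qed
  moreover have "(\<lambda>n. norm a * Lp_norm p (\<lambda>x. u n x - f x) + norm b * Lp_norm p (\<lambda>x. v n x - g x)) \<longlonglongrightarrow> norm a * 0 + norm b * 0"
    by (intro tendsto_intros L)
  ultimately have "(\<lambda>n. norm a * Lp_norm p (\<lambda>x. u n x - f x) + norm b * Lp_norm p (\<lambda>x. v n x - g x)) \<longlonglongrightarrow> 0"
    and le: "\<And>n. norm (Lp_norm p (\<lambda>x. (a * u n x + b * v n x) - (a * f x + b * g x)))
      \<le> norm a * Lp_norm p (\<lambda>x. u n x - f x) + norm b * Lp_norm p (\<lambda>x. v n x - g x)"
    unfolding real_norm_def abs_of_nonneg[OF Lp_norm_nonneg] mult_zero_right add_0 by blast+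
  from this(1) show "(\<lambda>n. Lp_norm p (\<lambda>x. (a * u n x + b * v n x) - (a * f x + b * g x))) \<longlonglongrightarrow> 0"
    by (rule Lim_null_comparison[OF always_eventually, rotated]) (intro allI le)
qed

lemma Lp_tendsto_AE_subseq:
  assumes p: "0 < p" and u: "Lp_tendsto p u f"
  obtains r where "strict_mono r" "AE x in lborel. (\<lambda>n. u (r n) x) \<longlonglongrightarrow> f x"
proof -
  note L = Lp_tendstoD[OF u] and [measurable] = Lp_measurable[OF Lp_tendstoD(1)[OF u]] Lp_measurable[OF Lp_tendstoD(2)[OF u]]
  let ?d = "\<lambda>n x. u n x - f x"
  have "(\<lambda>n. Lp_norm p (?d n) powr p) \<longlonglongrightarrow> 0 powr p"
    using p by (intro tendsto_powr' L tendsto_const) auto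
  have "(\<lambda>n. LINT x|lborel. norm (norm (?d n x) powr p)) \<longlonglongrightarrow> 0"
  proof -
    have "(LINT x|lborel. norm (norm (?d n x) powr p)) = Lp_norm p (?d n) powr p" for n
      using p by (simp add: Lp_norm_def powr_powr integral_nonneg_AE)
    thus ?thesis using \<open>(\<lambda>n. Lp_norm p (?d n) powr p) \<longlonglongrightarrow> 0 powr p\<close> by simp
  qed
  moreover have "integrable lborel (\<lambda>x. norm (?d n x) powr p)" for n
  proof (rule Bochner_Integration.integrable_bound[of _ "\<lambda>x. 2 powr p * (norm (u n x) powr p + norm (f x) powr p)"])
    show "integrable lborel (\<lambda>x. 2 powr p * (norm (u n x) powr p + norm (f x) powr p))"
      using L(1)[of n] L(2) unfolding Lp_def by auto
    show "AE x in lborel. norm (norm (?d n x) powr p) \<le> norm (2 powr p * (norm (u n x) powr p + norm (f x) powr p))"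
    proof (intro AE_I2)
      fix x
      have "norm (?d n x) \<le> 2 * max (norm (u n x)) (norm (f x))" using norm_triangle_ineq4[of "u n x" "f x"] by (simp add: max_def)
      hence "norm (?d n x) powr p \<le> (2 * max (norm (u n x)) (norm (f x))) powr p" using p by (intro powr_mono2) auto
      also have "\<dots> = 2 powr p * max (norm (u n x)) (norm (f x)) powr p" by (simp add: powr_mult)
      also have "\<dots> \<le> 2 powr p * (norm (u n x) powr p + norm (f x) powr p)"
        by (intro mult_left_mono) (auto simp: max_def)
      finally show "norm (norm (?d n x) powr p) \<le> norm (2 powr p * (norm (u n x) powr p + norm (f x) powr p))" by simp
    qed
  qed simp
  ultimately obtain r where r: "strict_mono r" "AE x in lborel. (\<lambda>n. norm (?d (r n) x) powr p) \<longlonglongrightarrow> 0"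
    using tendsto_L1_AE_subseq[of lborel "\<lambda>n x. norm (?d n x) powr p"] by blast
  have "AE x in lborel. (\<lambda>n. u (r n) x) \<longlonglongrightarrow> f x"
    using r(2)
  proof eventually_elim
    case (elim x)
    have "(\<lambda>n. (norm (?d (r n) x) powr p) powr (1/p)) \<longlonglongrightarrow> 0 powr (1/p)"
      using p by (intro tendsto_powr' elim tendsto_const) auto
    hence "(\<lambda>n. norm (?d (r n) x)) \<longlonglongrightarrow> 0" using p by (simp add: powr_powr)
    from LIM_zero_cancel[OF tendsto_norm_zero_cancel[OF this]] show ?case .
  qed
  thus ?thesis using that r(1) by blast
qed

lemma Lp_dominated_convergence:
  fixes u :: "nat \<Rightarrow> real ^ 'd \<Rightarrow> complex"
  assumes p: "1 \<le> p" and u: "\<And>n. u n \<in> borel_measurable borel" and f: "f \<in> borel_measurable borel"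
    and g: "g \<in> Lp p" and le: "\<And>n. AE x in lborel. norm (u n x) \<le> norm (g x)"
    and lim: "AE x in lborel. (\<lambda>n. u n x) \<longlonglongrightarrow> f x"
  shows "Lp_tendsto p u f"
proof (rule Lp_tendstoI)
  have p0: "0 < p" using p by simp
  show un: "u n \<in> Lp p" for n using Lp_bound(1)[OF u g p0, of n 1] le by simp
  note [measurable] = u f Lp_measurable[OF g]
  have "AE x in lborel. \<forall>n. norm (u n x) \<le> norm (g x)" using le by (simp add: AE_all_countable)
  with lim have fg: "AE x in lborel. norm (f x) \<le> norm (g x)"
    by eventually_elim (auto intro: LIMSEQ_le_const2 tendsto_norm)
  show fL: "f \<in> Lp p" using Lp_bound(1)[OF f g p0, of 1] fg by simp
  have gg: "integrable lborel (\<lambda>x. 2 powr p * norm (g x) powr p)" using g unfolding Lp_def by auto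
  have "(\<lambda>n. LINT x|lborel. norm (u n x - f x) powr p) \<longlonglongrightarrow> (LINT (x::real^'d)|lborel. 0)"
  proof (rule integral_dominated_convergence[OF _ _ gg])
    show "AE x in lborel. (\<lambda>n. norm (u n x - f x) powr p) \<longlonglongrightarrow> 0"
      using lim
    proof eventually_elim
      case (elim x)
      have "(\<lambda>n. norm (u n x - f x) powr p) \<longlonglongrightarrow> norm (f x - f x) powr p"
        using p0 by (intro tendsto_powr' tendsto_norm tendsto_diff elim tendsto_const) auto
      thus ?case by simp
    qed
    show "AE x in lborel. norm (norm (u n x - f x) powr p) \<le> 2 powr p * norm (g x) powr p" for n
      using le[of n] fg
    proof eventually_elim
      case (elim x)
      have "norm (u n x - f x) \<le> 2 * norm (g x)" using norm_triangle_ineq4[of "u n x" "f x"] elim by simp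
      hence "norm (u n x - f x) powr p \<le> (2 * norm (g x)) powr p" using p0 by (intro powr_mono2) auto
      thus ?case by (simp add: powr_mult)
    qed
  qed auto
  hence "(\<lambda>n. (LINT x|lborel. norm (u n x - f x) powr p) powr (1/p)) \<longlonglongrightarrow> 0 powr (1/p)"
    using p0 by (intro tendsto_powr' tendsto_const) (auto intro!: always_eventually integral_nonneg_AE)
  thus "(\<lambda>n. Lp_norm p (\<lambda>x. u n x - f x)) \<longlonglongrightarrow> 0" by (simp add: Lp_norm_def)
qed

definition Lp_Cauchy :: "real \<Rightarrow> (nat \<Rightarrow> real ^ 'd \<Rightarrow> complex) \<Rightarrow> bool" where
  "Lp_Cauchy p u \<longleftrightarrow> (\<forall>e>0. \<exists>N. \<forall>m\<ge>N. \<forall>n\<ge>N. Lp_norm p (\<lambda>x. u m x - u n x) < e)"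

lemma Lp_tendsto_Cauchy:
  assumes p: "1 \<le> p" and u: "Lp_tendsto p u f"
  shows "Lp_Cauchy p u"
  unfolding Lp_Cauchy_def
proof (intro allI impI)
  fix e :: real assume "e > 0"
  note L = Lp_tendstoD[OF u]
  obtain N where N: "\<And>n. n \<ge> N \<Longrightarrow> Lp_norm p (\<lambda>x. u n x - f x) < e/2"
    using order_tendstoD(2)[OF L(3), of "e/2"] \<open>e > 0\<close> unfolding eventually_sequentially by auto
  have "Lp_norm p (\<lambda>x. u m x - u n x) < e" if "m \<ge> N" "n \<ge> N" for m n
    using Lp_norm_triangle3[OF p L(1,2,1), of m n] N[OF that(1)] N[OF that(2)]
    by (simp add: Lp_norm_commute[of p f "u n"])
  thus "\<exists>N. \<forall>m\<ge>N. \<forall>n\<ge>N. Lp_norm p (\<lambda>x. u m x - u n x) < e" by blast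
qed

text \<open>The increments multiplied by 2^n still have norm at most 2^(-n), and as p >= 1 the
  integrals of their p-th powers have a finite sum. Almost everywhere these multiples tend to 0, so
  the increments are eventually below 2^(-n) and the telescoping series converges
  absolutely.\<close>

lemma Lp_fast_Cauchy_AE_convergent:
  fixes v :: "nat \<Rightarrow> real ^ 'd \<Rightarrow> complex"
  assumes p: "1 \<le> p" and v: "\<And>n. v n \<in> Lp p" and fast: "\<And>n. Lp_norm p (\<lambda>x. v (Suc n) x - v n x) \<le> (1/4) ^ n"
  shows "AE x in lborel. convergent (\<lambda>n. v n x)"
proof -
  have p0: "0 < p" using p by simp
  note [measurable] = Lp_measurable[OF v]
  define d where "d n x = ennreal (norm (2 ^ n * (v (Suc n) x - v n x)) powr p)" for n x
  have dm [measurable]: "d n \<in> borel_measurable borel" for n unfolding d_def by measurable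
  have di: "(\<integral>\<^sup>+x. d n x \<partial>lborel) \<le> ennreal ((1/2) ^ n)" for n
  proof -
    have "(\<integral>\<^sup>+x. d n x \<partial>lborel) = ennreal ((2 ^ n * Lp_norm p (\<lambda>x. v (Suc n) x - v n x)) powr p)"
      unfolding d_def using Lp_scale[OF p0 Lp_diff[OF p v v], of "2 ^ n" "Suc n" n] p0
      by (subst Lp_nn_integral) (auto simp: norm_power)
    also have "\<dots> \<le> ennreal ((2 ^ n * (1/4) ^ n) powr p)"
      using fast p0 by (intro ennreal_leI powr_mono2 mult_left_mono) auto
    also have "(2 ^ n * (1/4) ^ n :: real) = (1/2) ^ n" by (simp add: power_mult_distrib[symmetric])
    also have "((1/2) ^ n :: real) powr p \<le> ((1/2)^n) powr 1"
      using p by (intro powr_mono') (auto simp: power_le_one)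
    finally show ?thesis by (simp add: ennreal_leI)
  qed
  have "(\<integral>\<^sup>+x. (\<Sum>n. d n x) \<partial>lborel) = (\<Sum>n. \<integral>\<^sup>+x. d n x \<partial>lborel)"
    by (rule nn_integral_suminf) simp
  also have "\<dots> \<le> (\<Sum>n. ennreal ((1/2) ^ n))" by (intro suminf_le di) auto
  also have "\<dots> < \<infinity>" by (subst suminf_ennreal_eq[OF _ geometric_sums]) auto
  finally have "AE x in lborel. (\<Sum>n. d n x) \<noteq> \<infinity>"
    by (intro nn_integral_PInf_AE) auto
  thus ?thesis
  proof eventually_elim
    case (elim x)
    have "summable (\<lambda>n. norm (2 ^ n * (v (Suc n) x - v n x)) powr p)"
      using elim unfolding d_def by (intro summable_suminf_not_top) auto
    hence "(\<lambda>n. norm (2 ^ n * (v (Suc n) x - v n x)) powr p) \<longlonglongrightarrow> 0" by (rule summable_LIMSEQ_zero)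
    hence "\<forall>\<^sub>F n in sequentially. norm (2 ^ n * (v (Suc n) x - v n x)) powr p < 1"
      by (rule order_tendstoD) simp
    hence "\<forall>\<^sub>F n in sequentially. norm (v (Suc n) x - v n x) \<le> (1/2) ^ n"
    proof eventually_elim
      case (elim n)
      have "norm (2 ^ n * (v (Suc n) x - v n x)) \<le> 1"
      proof (rule ccontr)
        assume "\<not> ?thesis"
        hence "norm (2 ^ n * (v (Suc n) x - v n x)) powr p \<ge> 1" using p0 by (intro ge_one_powr_ge_zero) auto
        thus False using elim by simp
      qed
      hence "2 ^ n * norm (v (Suc n) x - v n x) \<le> 1" by (simp add: norm_mult norm_power)
      thus ?case by (simp add: field_simps)
    qed
    hence "summable (\<lambda>n. v (Suc n) x - v n x)"
      by (rule summable_comparison_test_ev) (simp add: summable_geometric)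
    hence "convergent (\<lambda>n. \<Sum>i<n. v (Suc i) x - v i x)" by (simp add: summable_iff_convergent)
    hence "convergent (\<lambda>n. v n x - v 0 x)" by (simp only: sum_lessThan_telescope[of "\<lambda>i. v i x"])
    from convergent_add[OF this convergent_const[of "v 0 x"]] show ?case by simp
  qed
qed

lemma Lp_complete:
  fixes u :: "nat \<Rightarrow> real ^ 'd \<Rightarrow> complex"
  assumes p: "1 \<le> p" and u: "\<And>n. u n \<in> Lp p" and C: "Lp_Cauchy p u"
  obtains h where "Lp_tendsto p u h"
proof -
  have p0: "0 < p" using p by simp
  have "\<exists>N. \<forall>m\<ge>N. \<forall>n\<ge>N. Lp_norm p (\<lambda>x. u m x - u n x) < (1/4) ^ k" for k
    using C unfolding Lp_Cauchy_def by simp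
  then obtain N where N: "\<And>k m n. m \<ge> N k \<Longrightarrow> n \<ge> N k \<Longrightarrow> Lp_norm p (\<lambda>x. u m x - u n x) < (1/4) ^ k" by metis
  \<comment> \<open>\<open>Suc m\<close> makes the indices strictly increasing, and
    \<open>N (Suc k)\<close> makes the increments as small as the preceding lemma demands.\<close>
  define r where "r = rec_nat (N 0) (\<lambda>k m. max (Suc m) (N (Suc k)))"
  have r0: "r 0 = N 0" and rS: "r (Suc k) = max (Suc (r k)) (N (Suc k))" for k by (auto simp: r_def)
  have rN: "r k \<ge> N k" for k by (cases k) (auto simp: r0 rS)
  have sm: "strict_mono r" by (rule strict_mono_Suc_iff[THEN iffD2]) (auto simp: rS)
  define v where "v k = u (r k)" for k
  have vL: "v k \<in> Lp p" for k using u by (simp add: v_def)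
  note [measurable] = Lp_measurable[OF u] Lp_measurable[OF vL]
  have "AE x in lborel. convergent (\<lambda>n. v n x)"
  proof (rule Lp_fast_Cauchy_AE_convergent[OF p vL])
    show "Lp_norm p (\<lambda>x. v (Suc n) x - v n x) \<le> (1/4) ^ n" for n
      unfolding v_def using N[of n "r (Suc n)" "r n"] rN[of n] by (auto simp: rS intro!: less_imp_le)
  qed
  define h where "h x = lim (\<lambda>n. v n x)" for x
  have [measurable]: "h \<in> borel_measurable borel" unfolding h_def by measurable
  have lim: "AE x in lborel. (\<lambda>n. v n x) \<longlonglongrightarrow> h x"
    using \<open>AE x in lborel. convergent (\<lambda>n. v n x)\<close> by eventually_elim (simp add: h_def convergent_LIMSEQ_iff)
  \<comment> \<open>Fatou's lemma in the index k of the subsequence, with n fixed, turns the Cauchy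
    estimate into a bound on the distance to \<open>h\<close>; it also yields \<open>h\<close> in
    L^p.\<close>
  have F: "(\<lambda>x. u n x - h x) \<in> Lp p \<and> Lp_norm p (\<lambda>x. u n x - h x) \<le> e"
    if "e > 0" "\<And>m m'. m \<ge> M \<Longrightarrow> m' \<ge> M \<Longrightarrow> Lp_norm p (\<lambda>x. u m x - u m' x) < e" "n \<ge> M" for n e M
  proof -
    have "\<forall>\<^sub>F k in sequentially. Lp_norm p (\<lambda>x. u n x - v k x) \<le> e"
      using eventually_ge_at_top[of M]
    proof eventually_elim
      case (elim k)
      have "r k \<ge> M" using elim strict_mono_imp_increasing[OF sm, of k] by simp
      thus ?case using that(2)[of n "r k"] that(3) by (simp add: v_def less_imp_le)
    qed
    moreover have "AE x in lborel. (\<lambda>k. u n x - v k x) \<longlonglongrightarrow> u n x - h x"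
      using lim by eventually_elim (intro tendsto_intros)
    ultimately show ?thesis
      using Lp_Fatou[of "\<lambda>k x. u n x - v k x" p e "\<lambda>x. u n x - h x"] Lp_diff[OF p u vL] that(1) p0 by auto
  qed
  have hL: "h \<in> Lp p"
  proof -
    have "(\<lambda>x. u (N 0) x - h x) \<in> Lp p" using F[of 1 "N 0" "N 0"] N[of 0] by auto
    from Lp_diff[OF p u this, of "N 0"] show ?thesis by simp
  qed
  have "Lp_tendsto p u h"
  proof (rule Lp_tendstoI[OF u hL], rule LIMSEQ_I)
    fix e :: real assume e: "e > 0"
    obtain M where "\<forall>m\<ge>M. \<forall>n\<ge>M. Lp_norm p (\<lambda>x. u m x - u n x) < e/2"
      using C e unfolding Lp_Cauchy_def by (meson half_gt_zero)
    hence "Lp_norm p (\<lambda>x. u n x - h x) \<le> e/2" if "n \<ge> M" for n using F[of "e/2" M n] e that by auto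
    thus "\<exists>M. \<forall>n\<ge>M. norm (Lp_norm p (\<lambda>x. u n x - h x) - 0) < e"
      using e by (intro exI[of _ M]) fastforce
  qed
  thus ?thesis using that by blast
qed

text \<open>Cutting off where |x| > n and where |g| > n makes the same sequence lie in every L^q
  with q >= 1, so that it serves L^1, L^2 and L^p at once.\<close>

lemma Lp_truncations:
  fixes g :: "real ^ 'd \<Rightarrow> complex"
  assumes p: "1 \<le> p" and g: "g \<in> Lp p"
  obtains u where "\<And>n. u n \<in> borel_measurable borel" "\<And>n q. 1 \<le> q \<Longrightarrow> u n \<in> Lp q"
    "\<And>n x. norm (u n x) \<le> norm (g x)" "\<And>n x. norm (u n x) \<le> real n" "\<And>x. (\<lambda>n. u n x) \<longlonglongrightarrow> g x"
proof -
  note [measurable] = Lp_measurable[OF g]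
  define S where "S n = {x::real^'d. norm x \<le> real n \<and> norm (g x) \<le> real n}" for n
  have [measurable]: "S n \<in> sets borel" for n unfolding S_def by measurable
  define u where "u n x = indicator (S n) x * g x" for n x
  have m: "u n \<in> borel_measurable borel" for n unfolding u_def by measurable
  have "u n \<in> Lp q" if q: "1 \<le> q" for n q
  proof -
    have "norm (norm (u n x) powr q) \<le> real n powr q * indicator (cball 0 (real n)) x" for x
      using q by (auto simp: u_def S_def indicator_def intro!: powr_mono2)
    note le = this
    have "integrable lborel (\<lambda>x::real^'d. real n powr q * indicator (cball 0 (real n)) x)"
      by (intro integrable_mult_right integrable_real_indicator) (auto intro: emeasure_lborel_cball_finite[unfolded infinity_ennreal_def])
    hence "integrable lborel (\<lambda>x. norm (u n x) powr q)"
      by (rule Bochner_Integration.integrable_bound)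
         (use m in simp, intro AE_I2 order_trans[OF le], simp)
    thus ?thesis using m unfolding Lp_def by simp
  qed
  moreover have "norm (u n x) \<le> norm (g x)" "norm (u n x) \<le> real n" for n x by (auto simp: u_def S_def indicator_def)
  moreover have "(\<lambda>n. u n x) \<longlonglongrightarrow> g x" for x
  proof (rule tendsto_eventually)
    obtain N :: nat where "real N \<ge> max (norm x) (norm (g x))" using real_arch_simple by blast
    thus "\<forall>\<^sub>F n in sequentially. u n x = g x"
      by (intro eventually_sequentiallyI[of N]) (auto simp: u_def S_def indicator_def)
  qed
  ultimately show ?thesis using that m by blast
qed

lemma Lp_approx:
  fixes f :: "real ^ 'd \<Rightarrow> complex"
  assumes p: "1 \<le> p" and f: "f \<in> Lp p"
  obtains u where "\<And>n q. 1 \<le> q \<Longrightarrow> u n \<in> Lp q" "Lp_tendsto p u f"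
proof -
  obtain u where u: "\<And>n. u n \<in> borel_measurable borel" "\<And>n q. 1 \<le> q \<Longrightarrow> u n \<in> Lp q"
    "\<And>n x. norm (u n x) \<le> norm (f x)" "\<And>x. (\<lambda>n. u n x) \<longlonglongrightarrow> f x"
    by (rule Lp_truncations[OF p f]) blast
  have "Lp_tendsto p u f"
    by (rule Lp_dominated_convergence[OF p u(1) Lp_measurable[OF f] f]) (use u in auto)
  thus ?thesis using that u(2) by blast
qed

text \<open>Used for the Fourier transform on the intersection of L^1 and L^2, and for the
  multiplier operator on that of L^2 and L^p. A single h serves all approximating sequences, so a
  value chosen by \<open>SOME\<close> with this property can later be computed along any of
  them.\<close>

lemma Lp_limit_extension:
  fixes f :: "real ^ 'd \<Rightarrow> complex"
  assumes q: "1 \<le> q" and D: "D \<subseteq> Lp q" and S: "\<And>v. v \<in> D \<Longrightarrow> S v \<in> Lp q" and C: "0 \<le> C"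
    and lip: "\<And>v w. v \<in> D \<Longrightarrow> w \<in> D \<Longrightarrow> Lp_norm q (\<lambda>x. S v x - S w x) \<le> C * Lp_norm q (\<lambda>x. v x - w x)"
    and u: "\<And>n. u n \<in> D" "Lp_tendsto q u f"
  shows "\<exists>h. h \<in> Lp q \<and> (\<forall>v. (\<forall>n. v n \<in> D) \<and> Lp_tendsto q v f \<longrightarrow> Lp_tendsto q (\<lambda>n. S (v n)) h)"
proof -
  have "Lp_Cauchy q (\<lambda>n. S (u n))"
    unfolding Lp_Cauchy_def
  proof (intro allI impI)
    fix e :: real assume "e > 0"
    hence "e / (C + 1) > 0" using C by simp
    then obtain N where N: "\<And>m n. m \<ge> N \<Longrightarrow> n \<ge> N \<Longrightarrow> Lp_norm q (\<lambda>x. u m x - u n x) < e / (C + 1)"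
      using Lp_tendsto_Cauchy[OF q u(2)] unfolding Lp_Cauchy_def by blast
    have "Lp_norm q (\<lambda>x. S (u m) x - S (u n) x) < e" if "m \<ge> N" "n \<ge> N" for m n
    proof -
      \<comment> \<open>C + 1 takes the place of C because C may be 0 and the estimate is divided by
        it.\<close>
      have "Lp_norm q (\<lambda>x. S (u m) x - S (u n) x) \<le> (C + 1) * Lp_norm q (\<lambda>x. u m x - u n x)"
        unfolding distrib_right mult_1
        using lip[OF u(1) u(1), of m n] Lp_norm_nonneg[of q "\<lambda>x. u m x - u n x"] by linarith
      also have "\<dots> < (C + 1) * (e / (C + 1))" using N[OF that] C by (intro mult_strict_left_mono) auto
      finally show ?thesis using C by simp
    qed
    thus "\<exists>N. \<forall>m\<ge>N. \<forall>n\<ge>N. Lp_norm q (\<lambda>x. S (u m) x - S (u n) x) < e" by blast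
  qed
  then obtain h where h: "Lp_tendsto q (\<lambda>n. S (u n)) h"
    using Lp_complete[OF q, of "\<lambda>n. S (u n)"] S[OF u(1)] by auto
  note hL = Lp_tendstoD[OF h] and uL = Lp_tendstoD[OF u(2)]
  have "Lp_tendsto q (\<lambda>n. S (v n)) h" if v: "\<And>n. v n \<in> D" "Lp_tendsto q v f" for v
  proof (rule Lp_tendstoI)
    note vL = Lp_tendstoD[OF v(2)]
    show "S (v n) \<in> Lp q" for n by (rule S[OF v(1)])
    show "h \<in> Lp q" by (rule hL)
    show "(\<lambda>n. Lp_norm q (\<lambda>x. S (v n) x - h x)) \<longlonglongrightarrow> 0"
    proof (rule Lim_null_comparison)
      let ?b = "\<lambda>n. C * (Lp_norm q (\<lambda>x. v n x - f x) + Lp_norm q (\<lambda>x. u n x - f x)) + Lp_norm q (\<lambda>x. S (u n) x - h x)"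
      have "?b \<longlonglongrightarrow> C * (0 + 0) + 0" by (intro tendsto_intros vL hL uL)
      thus "?b \<longlonglongrightarrow> 0" by simp
      show "\<forall>\<^sub>F n in sequentially. norm (Lp_norm q (\<lambda>x. S (v n) x - h x)) \<le> ?b n"
      proof (intro always_eventually allI)
        fix n
        have "Lp_norm q (\<lambda>x. S (v n) x - h x) \<le> C * Lp_norm q (\<lambda>x. v n x - u n x) + Lp_norm q (\<lambda>x. S (u n) x - h x)"
          using Lp_norm_triangle3[OF q S[OF v(1)] S[OF u(1)] hL(2), of n n] lip[OF v(1) u(1), of n n] by simp
        moreover have "C * Lp_norm q (\<lambda>x. v n x - u n x) \<le> C * (Lp_norm q (\<lambda>x. v n x - f x) + Lp_norm q (\<lambda>x. u n x - f x))"
          using Lp_norm_triangle3[OF q vL(1) vL(2) uL(1), of n n] Lp_norm_commute[of q f "u n"] C by (intro mult_left_mono) auto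
        ultimately show "norm (Lp_norm q (\<lambda>x. S (v n) x - h x)) \<le> ?b n"
          unfolding real_norm_def abs_of_nonneg[OF Lp_norm_nonneg] by linarith
      qed
    qed
  qed
  thus ?thesis using hL(2) by blast
qed

section \<open>Translations in L^p\<close>

lemma nn_integral_lborel_shift:
  fixes f :: "'a::euclidean_space \<Rightarrow> ennreal"
  assumes [measurable]: "f \<in> borel_measurable borel"
  shows "(\<integral>\<^sup>+x. f (x + z) \<partial>lborel) = (\<integral>\<^sup>+x. f x \<partial>lborel)"
proof -
  have "(\<integral>\<^sup>+x. f x \<partial>lborel) = (\<integral>\<^sup>+x. f x \<partial>distr lborel borel ((+) z))" by (simp add: lborel_distr_plus)
  also have "\<dots> = (\<integral>\<^sup>+x. f (z + x) \<partial>lborel)" by (subst nn_integral_distr) auto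
  finally show ?thesis by (simp add: add.commute)
qed

lemma lborel_integral_shift:
  fixes f :: "'a::euclidean_space \<Rightarrow> 'b::{banach, second_countable_topology}"
  assumes [measurable]: "f \<in> borel_measurable borel"
  shows "(\<integral>x. f (x + z) \<partial>lborel) = (\<integral>x. f x \<partial>lborel)"
proof -
  have "(\<integral>x. f x \<partial>lborel) = (\<integral>x. f x \<partial>distr lborel borel ((+) z))" by (simp add: lborel_distr_plus)
  also have "\<dots> = (\<integral>x. f (z + x) \<partial>lborel)" by (subst integral_distr) auto
  finally show ?thesis by (simp add: add.commute)
qed

lemma lborel_integrable_shift:
  fixes f :: "'a::euclidean_space \<Rightarrow> 'b::{banach, second_countable_topology}"
  assumes "integrable lborel f"
  shows "integrable lborel (\<lambda>x. f (x + z))"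
  using assms nn_integral_lborel_shift[of "\<lambda>x. ennreal (norm (f x))" z] by (auto simp: integrable_iff_bounded)

lemma Lp_shift:
  fixes f :: "real ^ 'd \<Rightarrow> complex"
  assumes "f \<in> Lp p"
  shows "(\<lambda>x. f (x + z)) \<in> Lp p" "Lp_norm p (\<lambda>x. f (x + z)) = Lp_norm p f"
proof -
  note [measurable] = Lp_measurable[OF assms]
  show "(\<lambda>x. f (x + z)) \<in> Lp p"
    using assms nn_integral_lborel_shift[of "\<lambda>x. ennreal (norm (f x) powr p)" z]
    by (auto simp: Lp_iff_nn_integral)
  show "Lp_norm p (\<lambda>x. f (x + z)) = Lp_norm p f"
    unfolding Lp_norm_def using lborel_integral_shift[of "\<lambda>x. norm (f x) powr p" z] by simp
qed

lemma Lp_tendsto_shift: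
  assumes "Lp_tendsto p u f"
  shows "Lp_tendsto p (\<lambda>n x. u n (x + z)) (\<lambda>x. f (x + z))"
proof (rule Lp_tendstoI)
  note L = Lp_tendstoD[OF assms]
  show "(\<lambda>x. u n (x + z)) \<in> Lp p" "(\<lambda>x. f (x + z)) \<in> Lp p" for n by (intro Lp_shift L)+
  have "Lp_norm p (\<lambda>x. u n (x + z) - f (x + z)) = Lp_norm p (\<lambda>x. u n x - f x)" for n
    using Lp_measurable[OF L(1)[of n]] Lp_measurable[OF L(2)]
    unfolding Lp_norm_def by (subst lborel_integral_shift[of "\<lambda>x. norm (u n x - f x) powr p"]) auto
  thus "(\<lambda>n. Lp_norm p (\<lambda>x. u n (x + z) - f (x + z))) \<longlonglongrightarrow> 0" using L(3) by simp
qed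

section \<open>Gaussian kernels and continuity of translations\<close>

lemma Lp_1_iff:
  fixes f :: "real ^ 'd \<Rightarrow> complex"
  shows "f \<in> Lp 1 \<longleftrightarrow> integrable lborel f"
  unfolding Lp_def by (auto simp: integrable_norm_iff dest: borel_measurable_integrable)

lemma fourier_measurable:
  fixes f :: "real ^ 'd \<Rightarrow> complex"
  assumes [measurable]: "f \<in> borel_measurable borel"
  shows "fourier f \<in> borel_measurable borel"
  unfolding fourier_def[abs_def] 
  using lborel.borel_measurable_lebesgue_integral[of "\<lambda>\<xi> x. exp (\<i> * complex_of_real (\<xi> \<bullet> x)) * f x" borel]
  by simp

lemma fourier_kernel_integrable:
  fixes f :: "real ^ 'd \<Rightarrow> complex"
  assumes "integrable lborel f"
  shows "integrable lborel (\<lambda>x. exp (\<i> * complex_of_real (\<xi> \<bullet> x)) * f x)"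
  by (rule Bochner_Integration.integrable_bound[OF assms]) 
     (use borel_measurable_integrable[OF assms] in \<open>auto simp: norm_mult\<close>)

lemma norm_fourier_le:
  fixes f :: "real ^ 'd \<Rightarrow> complex"
  shows "norm (fourier f \<xi>) \<le> (LINT x|lborel. norm (f x))"
  unfolding fourier_def by (rule order_trans[OF integral_norm_bound]) (simp add: norm_mult)

lemma fourier_add:
  fixes f g :: "real ^ 'd \<Rightarrow> complex"
  assumes "integrable lborel f" "integrable lborel g"
  shows "fourier (\<lambda>x. a * f x + b * g x) \<xi> = a * fourier f \<xi> + b * fourier g \<xi>"
proof -
  have "fourier (\<lambda>x. a * f x + b * g x) \<xi> = (LINT x|lborel. a * (exp (\<i> * complex_of_real (\<xi> \<bullet> x)) * f x) + b * (exp (\<i> * complex_of_real (\<xi> \<bullet> x)) * g x))"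
    unfolding fourier_def by (simp add: algebra_simps)
  also have "\<dots> = a * fourier f \<xi> + b * fourier g \<xi>"
    unfolding fourier_def using fourier_kernel_integrable[OF assms(1)] fourier_kernel_integrable[OF assms(2)] by simp
  finally show ?thesis .
qed

lemma fourier_shift:
  fixes f :: "real ^ 'd \<Rightarrow> complex"
  assumes [measurable]: "f \<in> borel_measurable borel"
  shows "fourier (\<lambda>x. f (x + z)) \<xi> = exp (- \<i> * complex_of_real (\<xi> \<bullet> z)) * fourier f \<xi>"
proof -
  have "fourier f \<xi> = (LINT x|lborel. exp (\<i> * complex_of_real (\<xi> \<bullet> (x + z))) * f (x + z))"
    unfolding fourier_def by (subst lborel_integral_shift[of "\<lambda>x. exp (\<i> * complex_of_real (\<xi> \<bullet> x)) * f x"]) auto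
  also have "\<dots> = (LINT x|lborel. exp (\<i> * complex_of_real (\<xi> \<bullet> z)) * (exp (\<i> * complex_of_real (\<xi> \<bullet> x)) * f (x + z)))"
    by (simp add: inner_add_right exp_add distrib_left mult_ac)
  also have "\<dots> = exp (\<i> * complex_of_real (\<xi> \<bullet> z)) * fourier (\<lambda>x. f (x + z)) \<xi>"
    unfolding fourier_def by simp
  finally show ?thesis by (simp add: exp_minus)
qed

lemma integrable_mult_bounded:
  fixes f :: "'a \<Rightarrow> 'b::{real_normed_algebra, banach, second_countable_topology}"
  assumes f: "integrable M f" and g: "g \<in> borel_measurable M" and b: "\<And>x. norm (g x) \<le> B"
  shows "integrable M (\<lambda>x. f x * g x)" "integrable M (\<lambda>x. g x * f x)"
proof -
  note [measurable] = borel_measurable_integrable[OF f] g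
  have 1: "norm (f x * g x) \<le> norm (B * norm (f x))" "norm (g x * f x) \<le> norm (B * norm (f x))" for x
  proof -
    have "B \<ge> 0" using b[of x] norm_ge_zero order_trans by blast
    thus "norm (f x * g x) \<le> norm (B * norm (f x))" "norm (g x * f x) \<le> norm (B * norm (f x))"
      using norm_mult_ineq[of "f x" "g x"] norm_mult_ineq[of "g x" "f x"] mult_right_mono[OF b[of x], of "norm (f x)"] 
      by (auto simp: mult.commute)
  qed
  have i: "integrable M (\<lambda>x. B * norm (f x))" using f by simp
  show "integrable M (\<lambda>x. f x * g x)" "integrable M (\<lambda>x. g x * f x)"
    by (rule Bochner_Integration.integrable_bound[OF i]; use 1 in simp)+
qed

text \<open>The kernel is symmetric in its two variables and of modulus 1, so Fubini's theorem
  applies with f(x) g(\<xi>) as majorant. This identity does the work of an inversion formula in the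
  proof of Plancherel's identity.\<close>

lemma fourier_mult_formula:
  fixes f g :: "real ^ 'd \<Rightarrow> complex"
  assumes f: "integrable lborel f" and g: "integrable lborel g"
  shows "(LINT \<xi>|lborel. fourier f \<xi> * g \<xi>) = (LINT x|lborel. f x * fourier g x)"
proof -
  note [measurable] = borel_measurable_integrable[OF f, simplified] borel_measurable_integrable[OF g, simplified]
  have int: "integrable (lborel \<Otimes>\<^sub>M lborel) (\<lambda>(\<xi>, x). exp (\<i> * complex_of_real (\<xi> \<bullet> x)) * f x * g \<xi>)"
  proof (rule lborel_pair.Fubini_integrable)
    show "integrable lborel (\<lambda>\<xi>. LINT x|lborel. norm (case (\<xi>, x) of (\<xi>, x) \<Rightarrow> exp (\<i> * complex_of_real (\<xi> \<bullet> x)) * f x * g \<xi>))"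
      using g by (simp add: norm_mult)
    show "AE \<xi> in lborel. integrable lborel (\<lambda>x. case (\<xi>, x) of (\<xi>, x) \<Rightarrow> exp (\<i> * complex_of_real (\<xi> \<bullet> x)) * f x * g \<xi>)"
      using fourier_kernel_integrable[OF f] by simp
  qed measurable
  have "(LINT \<xi>|lborel. fourier f \<xi> * g \<xi>) = (LINT \<xi>|lborel. LINT x|lborel. exp (\<i> * complex_of_real (\<xi> \<bullet> x)) * f x * g \<xi>)"
    unfolding fourier_def by simp
  also have "\<dots> = (LINT x|lborel. LINT \<xi>|lborel. exp (\<i> * complex_of_real (\<xi> \<bullet> x)) * f x * g \<xi>)"
    by (rule lborel_pair.Fubini_integral[OF int, symmetric])
  also have "\<dots> = (LINT x|lborel. LINT \<xi>|lborel. f x * (exp (\<i> * complex_of_real (x \<bullet> \<xi>)) * g \<xi>))"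
    by (simp add: mult_ac inner_commute)
  finally show ?thesis unfolding fourier_def by simp
qed

section \<open>Fourier transforms of Gaussians\<close>

lemma lborel_integral_prod_Basis:
  fixes f :: "'a::euclidean_space \<Rightarrow> real \<Rightarrow> complex"
  assumes f: "\<And>b. b \<in> Basis \<Longrightarrow> integrable lborel (f b)"
  shows "integrable lborel (\<lambda>x::'a. \<Prod>b\<in>Basis. f b (x \<bullet> b))"
    and "(LINT x|lborel. (\<Prod>b\<in>Basis. f b (x \<bullet> b))) = (\<Prod>b\<in>Basis. LINT s|lborel. f b s)"
proof -
  interpret P: product_sigma_finite "\<lambda>_::'a. lborel :: real measure" ..
  have fm [measurable]: "f b \<in> borel_measurable borel" if "b \<in> Basis" for b
    using borel_measurable_integrable[OF f[OF that]] by simp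
  have M [measurable]: "(\<lambda>x::'a. \<Prod>b\<in>Basis. f b (x \<bullet> b)) \<in> borel_measurable borel"
    by measurable
  have T [measurable]: "(\<lambda>x. \<Sum>b\<in>Basis. x b *\<^sub>R b) \<in> measurable (Pi\<^sub>M Basis (\<lambda>_::'a. lborel :: real measure)) borel"
    by measurable
  have eq: "(\<Prod>b\<in>Basis. f b ((\<Sum>b\<in>Basis. x b *\<^sub>R b) \<bullet> b)) = (\<Prod>b\<in>Basis. f b (x b))" for x :: "'a \<Rightarrow> real"
    by (intro prod.cong) (auto simp: inner_sum_left inner_Basis if_distrib[of "(*) _"] cong: if_cong)
  show "integrable lborel (\<lambda>x::'a. \<Prod>b\<in>Basis. f b (x \<bullet> b))"
    unfolding lborel_eq[where 'a='a] using f
    by (subst integrable_distr_eq[OF T M]) (simp add: eq P.product_integrable_prod)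
  show "(LINT x|lborel. (\<Prod>b\<in>Basis. f b (x \<bullet> b))) = (\<Prod>b\<in>Basis. LINT s|lborel. f b s)"
    unfolding lborel_eq[where 'a='a] using f
    by (subst integral_distr[OF T M]) (simp add: eq P.product_integral_prod)
qed

definition gauss :: "real ^ 'd \<Rightarrow> real" where
  "gauss x = exp (- (norm x)\<^sup>2 / 2)"

lemma gauss_measurable [measurable]: "gauss \<in> borel_measurable borel"
  unfolding gauss_def[abs_def] by measurable

lemma gauss_pos: "0 < gauss x"
  by (simp add: gauss_def)

text \<open>This is the characteristic function of the standard normal distribution with the
  normalizing factor cleared.\<close>

lemma gaussian_fourier_real:
  fixes t :: real
  shows "integrable lborel (\<lambda>s::real. exp (\<i> * complex_of_real (t * s)) * complex_of_real (exp (- s\<^sup>2 / 2)))"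
    and "(LINT s|lborel. exp (\<i> * complex_of_real (t * s)) * complex_of_real (exp (- s\<^sup>2 / 2)))
      = complex_of_real (sqrt (2 * pi)) * complex_of_real (exp (- t\<^sup>2 / 2))"
proof -
  have d: "std_normal_density s = exp (- s\<^sup>2 / 2) / sqrt (2 * pi)" for s
    by (simp add: std_normal_density_def)
  have i: "integrable lborel std_normal_density" by simp
  have g: "integrable lborel (\<lambda>s::real. exp (- s\<^sup>2 / 2))"
    using integrable_mult_right[OF i, of "sqrt (2 * pi)"] by (simp add: d)
  show int: "integrable lborel (\<lambda>s::real. exp (\<i> * complex_of_real (t * s)) * complex_of_real (exp (- s\<^sup>2 / 2)))"
    by (rule Bochner_Integration.integrable_bound[OF g]) (auto simp: norm_mult)
  have "complex_of_real (exp (- t\<^sup>2 / 2)) = char std_normal_distribution t"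
    by (simp add: char_std_normal_distribution)
  also have "\<dots> = (LINT s|lborel. std_normal_density s *\<^sub>R exp (\<i> * complex_of_real (t * s)))"
    unfolding char_def by (subst integral_density) (auto simp: normal_density_nonneg)
  also have "\<dots> = (LINT s|lborel. (exp (\<i> * complex_of_real (t * s)) * complex_of_real (exp (- s\<^sup>2 / 2))) / complex_of_real (sqrt (2 * pi)))"
    by (simp add: d scaleR_conv_of_real mult.commute)
  also have "\<dots> = (LINT s|lborel. exp (\<i> * complex_of_real (t * s)) * complex_of_real (exp (- s\<^sup>2 / 2))) / complex_of_real (sqrt (2 * pi))"
    by (rule integral_divide_zero)
  finally show "(LINT s|lborel. exp (\<i> * complex_of_real (t * s)) * complex_of_real (exp (- s\<^sup>2 / 2)))
      = complex_of_real (sqrt (2 * pi)) * complex_of_real (exp (- t\<^sup>2 / 2))"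
    by (simp add: field_simps)
qed

text \<open>The value (2 \<pi>)^(d/2) is the integral of \<open>gauss\<close> and, without a
  normalizing factor in the Fourier transform, also the constant in Plancherel's identity. The
  argument only carries the dimension.\<close>

definition gauss_mass :: "'d::finite itself \<Rightarrow> real" where
  "gauss_mass _ = sqrt (2 * pi) ^ CARD('d)"

lemma gauss_mass_pos: "0 < gauss_mass TYPE('d::finite)"
  by (simp add: gauss_mass_def)

text \<open>The Gaussian and the exponential kernel both factor over the coordinates, so the
  integral is a product of one-dimensional ones.\<close>

lemma gauss_fourier:
  fixes \<xi> :: "real ^ 'd"
  shows "integrable lborel (\<lambda>x::real^'d. complex_of_real (gauss x))"
    and "fourier (\<lambda>x. complex_of_real (gauss x)) \<xi> = complex_of_real (gauss_mass TYPE('d) * gauss \<xi>)"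
proof -
  have n2: "(norm x)\<^sup>2 = (\<Sum>b\<in>Basis. (x \<bullet> b)\<^sup>2)" for x :: "real ^ 'd"
    by (subst power2_norm_eq_inner, subst euclidean_inner) (simp add: power2_eq_square)
  have eq: "exp (\<i> * complex_of_real (\<xi> \<bullet> x)) * complex_of_real (gauss x) =
      (\<Prod>b\<in>Basis. exp (\<i> * complex_of_real ((\<xi> \<bullet> b) * (x \<bullet> b))) * complex_of_real (exp (- (x \<bullet> b)\<^sup>2 / 2)))" for x \<xi> :: "real ^ 'd"
  proof -
    have "exp (\<i> * complex_of_real (\<xi> \<bullet> x)) = (\<Prod>b\<in>Basis. exp (\<i> * complex_of_real ((\<xi> \<bullet> b) * (x \<bullet> b))))"
      by (subst euclidean_inner) (simp add: exp_sum[symmetric] sum_distrib_left)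
    moreover have "gauss x = (\<Prod>b\<in>Basis. exp (- (x \<bullet> b)\<^sup>2 / 2))"
      by (simp add: gauss_def n2 exp_sum[symmetric] sum_divide_distrib sum_negf)
    ultimately show ?thesis by (simp add: prod.distrib)
  qed
  have i: "integrable lborel (\<lambda>x::real^'d. exp (\<i> * complex_of_real (\<xi> \<bullet> x)) * complex_of_real (gauss x))" for \<xi> :: "real ^ 'd"
    unfolding eq by (rule lborel_integral_prod_Basis) (rule gaussian_fourier_real)
  show "integrable lborel (\<lambda>x::real^'d. complex_of_real (gauss x))" using i[of 0] by simp
  have "fourier (\<lambda>x. complex_of_real (gauss x)) \<xi> = (\<Prod>b\<in>Basis. complex_of_real (sqrt (2 * pi)) * complex_of_real (exp (- (\<xi> \<bullet> b)\<^sup>2 / 2)))"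
    unfolding fourier_def eq
    by (rule trans[OF lborel_integral_prod_Basis(2)], rule gaussian_fourier_real(1), simp only: gaussian_fourier_real(2))
  also have "\<dots> = complex_of_real (gauss_mass TYPE('d)) * complex_of_real (\<Prod>b\<in>(Basis::(real^'d) set). exp (- (\<xi> \<bullet> b)\<^sup>2 / 2))"
    by (simp add: prod.distrib gauss_mass_def)
  also have "(\<Prod>b\<in>(Basis::(real^'d) set). exp (- (\<xi> \<bullet> b)\<^sup>2 / 2)) = gauss \<xi>"
    by (simp add: gauss_def n2 exp_sum[symmetric] sum_divide_distrib sum_negf)
  finally show "fourier (\<lambda>x. complex_of_real (gauss x)) \<xi> = complex_of_real (gauss_mass TYPE('d) * gauss \<xi>)" by simp
qed

lemma gauss_integral:
  shows "integrable lborel (gauss :: real ^ 'd \<Rightarrow> real)" "(LINT x|lborel. gauss (x::real^'d)) = gauss_mass TYPE('d)"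
proof -
  show i: "integrable lborel (gauss :: real ^ 'd \<Rightarrow> real)"
    using gauss_fourier(1)[where 'd='d] complex_of_real_integrable_eq by blast
  have "complex_of_real (LINT x|lborel. gauss (x::real^'d)) = complex_of_real (gauss_mass TYPE('d))"
    using gauss_fourier(2)[of "0::real^'d"] by (simp add: fourier_def gauss_def)
  thus "(LINT x|lborel. gauss (x::real^'d)) = gauss_mass TYPE('d)" by (simp only: of_real_eq_iff)
qed

lemma lborel_integral_scale:
  fixes h :: "real ^ 'd \<Rightarrow> 'b::{banach, second_countable_topology}"
  assumes [measurable]: "h \<in> borel_measurable borel" and c: "c \<noteq> 0"
  shows "(LINT x|lborel. h x) = (\<bar>c\<bar> ^ CARD('d)) *\<^sub>R (LINT x|lborel. h (c *\<^sub>R x))"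
    and "integrable lborel h \<Longrightarrow> integrable lborel (\<lambda>x. h (c *\<^sub>R x))"
proof -
  have L: "(lborel :: (real^'d) measure) = density (distr lborel borel (\<lambda>x. c *\<^sub>R x)) (\<lambda>_. ennreal (\<bar>c\<bar> ^ CARD('d)))"
    using lborel_affine[OF c, of "0::real^'d"] by simp
  show "(LINT x|lborel. h x) = (\<bar>c\<bar> ^ CARD('d)) *\<^sub>R (LINT x|lborel. h (c *\<^sub>R x))"
    by (subst L, subst integral_density) (auto simp: integral_distr)
  assume "integrable lborel h"
  hence "integrable (density (distr lborel borel (\<lambda>x. c *\<^sub>R x)) (\<lambda>_. ennreal (\<bar>c\<bar> ^ CARD('d)))) h" using L by simp
  hence "integrable (distr lborel borel (\<lambda>x. c *\<^sub>R x)) (\<lambda>x. (\<bar>c\<bar> ^ CARD('d)) *\<^sub>R h x)"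
    by (subst (asm) integrable_density) auto
  hence "integrable lborel (\<lambda>x. (\<bar>c\<bar> ^ CARD('d)) *\<^sub>R h (c *\<^sub>R x))"
    by (subst (asm) integrable_distr_eq) auto
  from integrable_scaleR_right[OF this, of "1 / \<bar>c\<bar> ^ CARD('d)"]
  show "integrable lborel (\<lambda>x. h (c *\<^sub>R x))" using c by simp
qed

section \<open>Continuity of translations in L^1\<close>

lemma open_shift_L1_continuous:
  fixes U :: "'a::euclidean_space set"
  assumes U: "open U" "emeasure lborel U < \<infinity>" and h: "h \<longlonglongrightarrow> 0"
  shows "(\<lambda>n. LINT x|lborel. \<bar>indicat_real U (x + h n) - indicat_real U x\<bar>) \<longlonglongrightarrow> 0"
proof -
  have [measurable]: "U \<in> sets borel" using U(1) by simp
  have iU: "integrable lborel (indicat_real U)" using U by (simp add: integrable_real_indicator)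
  have iS: "integrable lborel (\<lambda>x. indicat_real U (x + z))" for z by (rule lborel_integrable_shift[OF iU])
  \<comment> \<open>Openness of U settles the positive part only: a point of U stays in U under
    small translations, while a boundary point outside U may be moved into it again and
    again.\<close>
  have "(\<lambda>n. LINT x|lborel. max 0 (indicat_real U x - indicat_real U (x + h n))) \<longlonglongrightarrow> (LINT (x::'a)|lborel. 0)"
  proof (rule integral_dominated_convergence[OF _ _ iU])
    show "AE x in lborel. (\<lambda>n. max 0 (indicat_real U x - indicat_real U (x + h n))) \<longlonglongrightarrow> 0"
    proof (intro AE_I2 tendsto_eventually)
      fix x :: 'a
      show "\<forall>\<^sub>F n in sequentially. max 0 (indicat_real U x - indicat_real U (x + h n)) = 0"
      proof (cases "x \<in> U")
        case True
        have "(\<lambda>n. x + h n) \<longlonglongrightarrow> x + 0" by (intro tendsto_intros h)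
        hence "\<forall>\<^sub>F n in sequentially. x + h n \<in> U" using U(1) True by (intro topological_tendstoD) auto
        thus ?thesis by eventually_elim (auto simp: indicator_def)
      qed (auto simp: indicator_def)
    qed
  qed (auto simp: indicator_def)
  hence "(\<lambda>n. 2 * (LINT x|lborel. max 0 (indicat_real U x - indicat_real U (x + h n)))) \<longlonglongrightarrow> 2 * 0"
    by (intro tendsto_intros) simp
  \<comment> \<open>An indicator and its translate have equal integrals, so the L^1 distance is
    twice the integral of the positive part.\<close>
  moreover have "(LINT x|lborel. \<bar>indicat_real U (x + h n) - indicat_real U x\<bar>)
     = 2 * (LINT x|lborel. max 0 (indicat_real U x - indicat_real U (x + h n)))" for n
  proof -
    have im: "integrable lborel (\<lambda>x. max 0 (indicat_real U x - indicat_real U (x + h n)))"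
      by (rule Bochner_Integration.integrable_bound[OF iU]) (auto simp: indicator_def)
    have "(LINT x|lborel. \<bar>indicat_real U (x + h n) - indicat_real U x\<bar>)
      = (LINT x|lborel. 2 * max 0 (indicat_real U x - indicat_real U (x + h n)) + (indicat_real U (x + h n) - indicat_real U x))"
      by (intro Bochner_Integration.integral_cong) (auto simp: indicator_def)
    also have "\<dots> = 2 * (LINT x|lborel. max 0 (indicat_real U x - indicat_real U (x + h n))) + ((LINT x|lborel. indicat_real U (x + h n)) - (LINT x|lborel. indicat_real U x))"
      using im iS iU by simp
    also have "(LINT x|lborel. indicat_real U (x + h n)) = (LINT x|lborel. indicat_real U x)"
      by (rule lborel_integral_shift) simp
    finally show ?thesis by simp
  qed
  ultimately show ?thesis by simp
qed

lemma tendsto_0_if_le_null_add: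
  fixes a :: "nat \<Rightarrow> real"
  assumes "\<And>n. 0 \<le> a n" and "\<And>e. e > 0 \<Longrightarrow> \<exists>b. b \<longlonglongrightarrow> 0 \<and> (\<forall>n. a n \<le> b n + e)"
  shows "a \<longlonglongrightarrow> 0"
proof (rule LIMSEQ_I)
  fix e :: real assume e: "e > 0"
  then obtain b where b: "b \<longlonglongrightarrow> 0" "\<And>n. a n \<le> b n + e/2" using assms(2)[of "e/2"] by auto
  obtain N where N: "\<And>n. n \<ge> N \<Longrightarrow> b n < e/2"
    using order_tendstoD(2)[OF b(1), of "e/2"] e unfolding eventually_sequentially by auto
  have "norm (a n - 0) < e" if "n \<ge> N" for n using N[OF that] b(2)[of n] assms(1)[of n] by simp
  thus "\<exists>N. \<forall>n\<ge>N. norm (a n - 0) < e" by blast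
qed

text \<open>By outer regularity A lies in an open U with U - A of measure below e/2. The set U - A
  and its translate then add at most e to the distance for U.\<close>

lemma set_shift_L1_continuous:
  fixes A :: "'a::euclidean_space set"
  assumes A: "A \<in> sets borel" "emeasure lborel A < \<infinity>" and h: "h \<longlonglongrightarrow> 0"
  shows "(\<lambda>n. LINT x|lborel. \<bar>indicat_real A (x + h n) - indicat_real A x\<bar>) \<longlonglongrightarrow> 0"
proof (rule tendsto_0_if_le_null_add)
  fix e :: real assume e: "e > 0"
  have "A \<in> sets lebesgue" "e/2 > 0" using A(1) e by simp_all
  then obtain U where U: "open U" "A \<subseteq> U" "emeasure lebesgue (U - A) < ennreal (e/2)"
    by (rule sets_lebesgue_outer_open) blast
  have [measurable]: "U \<in> sets borel" "A \<in> sets borel" using U(1) A by auto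
  have eD: "emeasure lborel (U - A) < ennreal (e/2)" using U(3) by (simp add: emeasure_completion)
  have "emeasure lborel U \<le> emeasure lborel A + emeasure lborel (U - A)"
    using U(2) by (subst plus_emeasure) (auto intro!: emeasure_mono)
  also have "\<dots> < \<infinity>" using A eD by (simp add: less_top order_less_le_trans)
  finally have fU: "emeasure lborel U < \<infinity>" .
  have iU: "integrable lborel (indicat_real U)" using fU by (simp add: integrable_real_indicator)
  have iD: "integrable lborel (indicat_real (U - A))" using eD by (intro integrable_real_indicator) (auto intro: order.strict_trans)
  have iA: "integrable lborel (indicat_real A)" using A by (simp add: integrable_real_indicator)
  have D: "(LINT x|lborel. indicat_real (U - A) x) \<le> e/2"
  proof -
    have "measure lborel (U - A) \<le> e/2" unfolding measure_def using eD e by (intro enn2real_leI) auto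
    thus ?thesis by simp
  qed
  have "(LINT x|lborel. \<bar>indicat_real A (x + h n) - indicat_real A x\<bar>) \<le> (LINT x|lborel. \<bar>indicat_real U (x + h n) - indicat_real U x\<bar>) + e" for n
  proof -
    have I: "integrable lborel (\<lambda>x. \<bar>indicat_real U (x + h n) - indicat_real U x\<bar>)"
      "integrable lborel (\<lambda>x. indicat_real (U - A) (x + h n))" "integrable lborel (indicat_real (U - A))"
      by (intro integrable_abs Bochner_Integration.integrable_diff iU iD lborel_integrable_shift[OF iU] lborel_integrable_shift[OF iD])+
    have "(LINT x|lborel. \<bar>indicat_real A (x + h n) - indicat_real A x\<bar>)
      \<le> (LINT x|lborel. \<bar>indicat_real U (x + h n) - indicat_real U x\<bar> + (indicat_real (U - A) (x + h n) + indicat_real (U - A) x))"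
    proof (rule integral_mono)
      show "integrable lborel (\<lambda>x. \<bar>indicat_real A (x + h n) - indicat_real A x\<bar>)"
        by (intro integrable_abs Bochner_Integration.integrable_diff iA lborel_integrable_shift[OF iA])
      show "integrable lborel (\<lambda>x. \<bar>indicat_real U (x + h n) - indicat_real U x\<bar> + (indicat_real (U - A) (x + h n) + indicat_real (U - A) x))"
        by (intro integrable_abs Bochner_Integration.integrable_diff Bochner_Integration.integrable_add iU iD lborel_integrable_shift[OF iU] lborel_integrable_shift[OF iD])
      show "\<bar>indicat_real A (x + h n) - indicat_real A x\<bar> \<le> \<bar>indicat_real U (x + h n) - indicat_real U x\<bar> + (indicat_real (U - A) (x + h n) + indicat_real (U - A) x)" for x
        using U(2) by (auto simp: indicator_def)
    qed
    also have "\<dots> = (LINT x|lborel. \<bar>indicat_real U (x + h n) - indicat_real U x\<bar>) + ((LINT x|lborel. indicat_real (U - A) (x + h n)) + (LINT x|lborel. indicat_real (U - A) x))"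
      by (simp only: Bochner_Integration.integral_add[OF I(1) Bochner_Integration.integrable_add[OF I(2,3)]]
          Bochner_Integration.integral_add[OF I(2,3)])
    also have "(LINT x|lborel. indicat_real (U - A) (x + h n)) = (LINT x|lborel. indicat_real (U - A) x)"
      by (rule lborel_integral_shift) simp
    finally show ?thesis using D by linarith
  qed
  thus "\<exists>b. b \<longlonglongrightarrow> 0 \<and> (\<forall>n. (LINT x|lborel. \<bar>indicat_real A (x + h n) - indicat_real A x\<bar>) \<le> b n + e)"
    using open_shift_L1_continuous[OF U(1) fU h] by blast
qed (auto intro: integral_nonneg_AE)

lemma L1_shift_continuous:
  fixes f :: "'a::euclidean_space \<Rightarrow> 'b::{banach, second_countable_topology}"
  assumes "integrable lborel f" and h: "h \<longlonglongrightarrow> 0"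
  shows "(\<lambda>n. LINT x|lborel. norm (f (x + h n) - f x)) \<longlonglongrightarrow> 0"
  using assms(1)
proof (induction rule: integrable_induct)
  case (base A c)
  have "(\<lambda>n. norm c * (LINT x|lborel. \<bar>indicat_real A (x + h n) - indicat_real A x\<bar>)) \<longlonglongrightarrow> norm c * 0"
    using base by (intro tendsto_mult_left set_shift_L1_continuous h) auto
  thus ?case by (simp add: scaleR_left_diff_distrib[symmetric] mult.commute)
next
  case (add f g)
  show ?case
  proof (rule Lim_null_comparison)
    show "(\<lambda>n. (LINT x|lborel. norm (f (x + h n) - f x)) + (LINT x|lborel. norm (g (x + h n) - g x))) \<longlonglongrightarrow> 0"
      using tendsto_add[OF add.IH] by simp
    show "\<forall>\<^sub>F n in sequentially. norm (LINT x|lborel. norm (f (x + h n) + g (x + h n) - (f x + g x)))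
      \<le> (LINT x|lborel. norm (f (x + h n) - f x)) + (LINT x|lborel. norm (g (x + h n) - g x))"
    proof (intro always_eventually allI)
      fix n
      note i = add.hyps(1,2) lborel_integrable_shift[OF add.hyps(1), of "h n"] lborel_integrable_shift[OF add.hyps(2), of "h n"]
      have "(LINT x|lborel. norm (f (x + h n) + g (x + h n) - (f x + g x)))
        \<le> (LINT x|lborel. norm (f (x + h n) - f x) + norm (g (x + h n) - g x))"
        using i by (intro integral_mono) (auto simp: add_diff_add norm_triangle_ineq)
      also have "\<dots> = (LINT x|lborel. norm (f (x + h n) - f x)) + (LINT x|lborel. norm (g (x + h n) - g x))"
        using i by simp
      finally show "norm (LINT x|lborel. norm (f (x + h n) + g (x + h n) - (f x + g x)))
        \<le> (LINT x|lborel. norm (f (x + h n) - f x)) + (LINT x|lborel. norm (g (x + h n) - g x))"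
        by (simp add: integral_nonneg_AE)
    qed
  qed
next
  case (lim f s)
  have conv: "(\<lambda>i. LINT x|lborel. norm (s i x - f x)) \<longlonglongrightarrow> (LINT (x::'a)|lborel. 0)"
  proof (rule integral_dominated_convergence[where w = "\<lambda>x. 3 * norm (f x)"])
    show "AE x in lborel. (\<lambda>i. norm (s i x - f x)) \<longlonglongrightarrow> 0"
      using lim.hyps(2) by (intro AE_I2 tendsto_norm_zero LIM_zero) auto
    show "AE x in lborel. norm (norm (s i x - f x)) \<le> 3 * norm (f x)" for i
    proof (intro AE_I2)
      fix x show "norm (norm (s i x - f x)) \<le> 3 * norm (f x)"
        using lim.hyps(3)[of x i] norm_triangle_ineq4[of "s i x" "f x"] by simp
    qed
  qed (use lim.hyps(1,4) in auto)
  show ?case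
  proof (rule tendsto_0_if_le_null_add)
    fix e :: real assume e: "e > 0"
    have "\<forall>\<^sub>F i in sequentially. (LINT x|lborel. norm (s i x - f x)) < e/2"
      using conv e by (intro order_tendstoD(2)[OF conv]) auto
    then obtain i where i: "(LINT x|lborel. norm (s i x - f x)) < e/2"
      by (auto simp: eventually_sequentially)
    \<comment> \<open>By translation invariance the error of \<open>s i\<close> enters twice with
      the same value, uniformly in n.\<close>
    have "(LINT x|lborel. norm (f (x + h n) - f x)) \<le> (LINT x|lborel. norm (s i (x + h n) - s i x)) + e" for n
    proof -
      note I = lim.hyps(1)[of i] lim.hyps(4) lborel_integrable_shift[OF lim.hyps(1)[of i], of "h n"] lborel_integrable_shift[OF lim.hyps(4), of "h n"]
      have J: "integrable lborel (\<lambda>x. norm (s i x - f x))" using I by simp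
      have "(LINT x|lborel. norm (f (x + h n) - f x))
        \<le> (LINT x|lborel. norm (s i (x + h n) - s i x) + (norm (s i (x + h n) - f (x + h n)) + norm (s i x - f x)))"
      proof (intro integral_mono)
        fix x
        have "f (x + h n) - f x = (s i (x + h n) - s i x) - (s i (x + h n) - f (x + h n)) + (s i x - f x)" by simp
        thus "norm (f (x + h n) - f x) \<le> norm (s i (x + h n) - s i x) + (norm (s i (x + h n) - f (x + h n)) + norm (s i x - f x))"
          using norm_triangle_ineq4[of "s i (x + h n) - s i x" "s i (x + h n) - f (x + h n)"]
            norm_triangle_ineq[of "(s i (x + h n) - s i x) - (s i (x + h n) - f (x + h n))" "s i x - f x"] by simp
      qed (use I in auto)
      also have "\<dots> = (LINT x|lborel. norm (s i (x + h n) - s i x)) + ((LINT x|lborel. norm (s i (x + h n) - f (x + h n))) + (LINT x|lborel. norm (s i x - f x)))"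
        using I by simp
      also have "(LINT x|lborel. norm (s i (x + h n) - f (x + h n))) = (LINT x|lborel. norm (s i x - f x))"
        using lborel_integral_shift[of "\<lambda>x. norm (s i x - f x)" "h n"] borel_measurable_integrable[OF J] by simp
      finally show ?thesis using i by linarith
    qed
    thus "\<exists>b. b \<longlonglongrightarrow> 0 \<and> (\<forall>n. (LINT x|lborel. norm (f (x + h n) - f x)) \<le> b n + e)"
      using lim.IH by blast
  qed (auto intro: integral_nonneg_AE)
qed

section \<open>The Fourier transform on square integrable functions\<close>

lemma borel_measurable_cnj [measurable]:
  "f \<in> borel_measurable M \<Longrightarrow> (\<lambda>x. cnj (f x)) \<in> borel_measurable M"
  by (rule measurable_compose[OF _ borel_measurable_continuous_onI]) (auto intro: continuous_intros)

lemma gauss_scaled_fourier: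
  fixes v :: "real ^ 'd"
  assumes e: "e > 0"
  shows "integrable lborel (\<lambda>\<xi>::real^'d. complex_of_real (gauss (e *\<^sub>R \<xi>)))"
    and "fourier (\<lambda>\<xi>. complex_of_real (gauss (e *\<^sub>R \<xi>))) v
      = complex_of_real (gauss_mass TYPE('d) / e ^ CARD('d) * gauss ((1/e) *\<^sub>R v))"
proof -
  show "integrable lborel (\<lambda>\<xi>::real^'d. complex_of_real (gauss (e *\<^sub>R \<xi>)))"
    using e by (intro lborel_integral_scale(2)[of "\<lambda>\<xi>. complex_of_real (gauss \<xi>)"] gauss_fourier) auto
  have "complex_of_real (gauss_mass TYPE('d) * gauss ((1/e) *\<^sub>R v)) = fourier (\<lambda>x. complex_of_real (gauss x)) ((1/e) *\<^sub>R v)"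
    by (simp add: gauss_fourier)
  also have "\<dots> = (e ^ CARD('d)) *\<^sub>R (LINT \<xi>|lborel. exp (\<i> * complex_of_real (((1/e) *\<^sub>R v) \<bullet> (e *\<^sub>R \<xi>))) * complex_of_real (gauss (e *\<^sub>R \<xi>)))"
    unfolding fourier_def using e by (subst lborel_integral_scale(1)[of _ e]) auto
  also have "\<dots> = (e ^ CARD('d)) *\<^sub>R fourier (\<lambda>\<xi>. complex_of_real (gauss (e *\<^sub>R \<xi>))) v"
    unfolding fourier_def using e by simp
  finally show "fourier (\<lambda>\<xi>. complex_of_real (gauss (e *\<^sub>R \<xi>))) v
      = complex_of_real (gauss_mass TYPE('d) / e ^ CARD('d) * gauss ((1/e) *\<^sub>R v))"
    using e by (simp add: scaleR_conv_of_real field_simps)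
qed

lemma autocorrelation_integrable:
  fixes f :: "real ^ 'd \<Rightarrow> complex"
  assumes f: "integrable lborel f" and b: "\<And>x. norm (f x) \<le> B"
  shows "integrable lborel (\<lambda>x. f x * cnj (f (x - u)))"
    and "norm (LINT x|lborel. f x * cnj (f (x - u))) \<le> B * (LINT x|lborel. norm (f x))"
proof -
  note [measurable] = borel_measurable_integrable[OF f, simplified]
  show 1: "integrable lborel (\<lambda>x. f x * cnj (f (x - u)))"
    by (rule integrable_mult_bounded[OF f, of _ B]) (use b in auto)
  have "norm (LINT x|lborel. f x * cnj (f (x - u))) \<le> (LINT x|lborel. norm (f x * cnj (f (x - u))))"
    by (rule integral_norm_bound)
  also have "\<dots> \<le> (LINT x|lborel. B * norm (f x))"
    using integrable_norm[OF 1] f mult_right_mono[OF b, of "norm (f _)"]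
    by (intro integral_mono) (auto simp: norm_mult mult.commute)
  finally show "norm (LINT x|lborel. f x * cnj (f (x - u))) \<le> B * (LINT x|lborel. norm (f x))" by simp
qed

text \<open>The transform of f is bounded but not yet known to be square integrable, so a Gaussian
  weight makes the integral finite. Moving one transform across turns it into a Gaussian average of
  autocorrelations of f at distances of order e.\<close>

lemma plancherel_gaussian_regularized:
  fixes f :: "real ^ 'd \<Rightarrow> complex"
  assumes f: "integrable lborel f" and b: "\<And>x. norm (f x) \<le> B" and e: "e > 0"
  shows "integrable lborel (\<lambda>\<xi>. (norm (fourier f \<xi>))\<^sup>2 * gauss (e *\<^sub>R \<xi>))"
    and "complex_of_real (LINT \<xi>|lborel. (norm (fourier f \<xi>))\<^sup>2 * gauss (e *\<^sub>R \<xi>))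
      = complex_of_real (gauss_mass TYPE('d)) * (LINT u|lborel. complex_of_real (gauss u) * (LINT x|lborel. f x * cnj (f (x - e *\<^sub>R u))))"
proof -
  note fm [measurable] = borel_measurable_integrable[OF f, simplified]
  note Fm [measurable] = fourier_measurable[OF fm]
  define N where "N = (LINT x|lborel. norm (f x))"
  define \<Gamma> where "\<Gamma> v = complex_of_real (gauss_mass TYPE('d) / e ^ CARD('d) * gauss ((1/e) *\<^sub>R v))" for v :: "real ^ 'd"
  have \<Gamma>m [measurable]: "\<Gamma> \<in> borel_measurable borel" unfolding \<Gamma>_def[abs_def] by measurable
  have \<Gamma>i: "integrable lborel \<Gamma>"
    unfolding \<Gamma>_def of_real_mult using gauss_scaled_fourier(1)[of "1/e"] e by (intro integrable_mult_right) auto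
  note G = gauss_scaled_fourier[OF e, where 'd='d]
  define S where "S \<xi> = cnj (fourier f \<xi>) * complex_of_real (gauss (e *\<^sub>R \<xi>))" for \<xi>
  have FN: "norm (fourier f \<xi>) \<le> N" for \<xi> unfolding N_def by (rule norm_fourier_le)
  have Si: "integrable lborel S"
    unfolding S_def by (rule integrable_mult_bounded(2)[OF G(1)]) (use FN in auto)
  have eqS: "fourier f \<xi> * S \<xi> = complex_of_real ((norm (fourier f \<xi>))\<^sup>2 * gauss (e *\<^sub>R \<xi>))" for \<xi>
    unfolding S_def of_real_mult complex_norm_square by (simp add: mult_ac)
  have "integrable lborel (\<lambda>\<xi>. fourier f \<xi> * S \<xi>)"
    by (rule integrable_mult_bounded(2)[OF Si]) (use FN in auto)
  thus "integrable lborel (\<lambda>\<xi>. (norm (fourier f \<xi>))\<^sup>2 * gauss (e *\<^sub>R \<xi>))"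
    unfolding eqS complex_of_real_integrable_eq .
  \<comment> \<open>The conjugate of \<open>fourier f\<close> is the transform of the reflected
    conjugate \<open>fr\<close>. Moving that transform onto the Gaussian factor shows that
    \<open>fourier S\<close> is the convolution of \<Gamma> with the conjugate of f.\<close>
  have fS: "fourier S x = (LINT u|lborel. \<Gamma> u * cnj (f (x - u)))" for x
  proof -
    define fr where "fr y = cnj (f (- y))" for y
    have fri: "integrable lborel fr"
      unfolding fr_def using lborel_integral_scale(2)[of f "-1"] f by (simp add: integrable_cnj)
    have cF: "cnj (fourier f \<xi>) = fourier fr \<xi>" for \<xi>
    proof -
      have "cnj (fourier f \<xi>) = (LINT y|lborel. exp (\<i> * complex_of_real (\<xi> \<bullet> (- y))) * cnj (f y))"
        unfolding fourier_def
        by (rule trans[OF Bochner_Integration.integral_cnj[symmetric]], intro Bochner_Integration.integral_cong refl) (simp add: exp_cnj)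
      also have "\<dots> = fourier fr \<xi>"
        unfolding fourier_def fr_def
        using lborel_integral_scale(1)[of "\<lambda>y. exp (\<i> * complex_of_real (\<xi> \<bullet> (- y))) * cnj (f y)" "-1"] by simp
      finally show ?thesis .
    qed
    define g where "g \<xi> = exp (\<i> * complex_of_real (x \<bullet> \<xi>)) * complex_of_real (gauss (e *\<^sub>R \<xi>))" for \<xi>
    have gi: "integrable lborel g" unfolding g_def by (rule fourier_kernel_integrable[OF G(1)])
    have "fourier S x = (LINT \<xi>|lborel. fourier fr \<xi> * g \<xi>)"
      unfolding fourier_def[of S] S_def cF g_def by (simp add: mult_ac)
    also have "\<dots> = (LINT y|lborel. fr y * fourier g y)" by (rule fourier_mult_formula[OF fri gi])
    also have "\<dots> = (LINT y|lborel. fr y * \<Gamma> (y + x))"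
    proof -
      have "fourier g y = \<Gamma> (y + x)" for y
        unfolding \<Gamma>_def G(2)[symmetric] fourier_def g_def by (simp add: inner_add_left distrib_left exp_add mult_ac)
      thus ?thesis by simp
    qed
    also have "\<dots> = (LINT u|lborel. fr (u - x) * \<Gamma> u)"
      using lborel_integral_shift[of "\<lambda>u. fr (u - x) * \<Gamma> u" x] borel_measurable_integrable[OF fri] by simp
    finally show ?thesis unfolding fr_def by (simp add: mult.commute)
  qed
  have int: "integrable (lborel \<Otimes>\<^sub>M lborel) (\<lambda>(x, u). f x * (\<Gamma> u * cnj (f (x - u))))"
  proof (rule lborel_pair.Fubini_integrable)
    have i: "integrable lborel (\<lambda>u. \<Gamma> u * cnj (f (x - u)))" for x
      by (rule integrable_mult_bounded[OF \<Gamma>i, of _ B]) (use b in auto)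
    thus "AE x in lborel. integrable lborel (\<lambda>u. case (x, u) of (x, u) \<Rightarrow> f x * (\<Gamma> u * cnj (f (x - u))))"
      by simp
    have bd: "norm (LINT u|lborel. norm (\<Gamma> u * cnj (f (x - u)))) \<le> B * (LINT u|lborel. norm (\<Gamma> u))" for x
    proof -
      have "(LINT u|lborel. norm (\<Gamma> u * cnj (f (x - u)))) \<le> (LINT u|lborel. B * norm (\<Gamma> u))"
        using integrable_norm[OF i] \<Gamma>i mult_right_mono[OF b, of "norm (\<Gamma> _)"]
        by (intro integral_mono) (auto simp: norm_mult mult.commute)
      thus ?thesis by (simp add: integral_nonneg_AE)
    qed
    have "integrable lborel (\<lambda>x. norm (f x) * (LINT u|lborel. norm (\<Gamma> u * cnj (f (x - u)))))"
    proof (rule integrable_mult_bounded[OF _ _ bd])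
      show "(\<lambda>x. LINT u|lborel. norm (\<Gamma> u * cnj (f (x - u)))) \<in> borel_measurable lborel"
        using lborel.borel_measurable_lebesgue_integral[of "\<lambda>x u. norm (\<Gamma> u * cnj (f (x - u)))" lborel] by simp
    qed (use f in simp)
    thus "integrable lborel (\<lambda>x. LINT u|lborel. norm (case (x, u) of (x, u) \<Rightarrow> f x * (\<Gamma> u * cnj (f (x - u)))))"
      by (simp add: norm_mult)
  qed measurable
  have "complex_of_real (LINT \<xi>|lborel. (norm (fourier f \<xi>))\<^sup>2 * gauss (e *\<^sub>R \<xi>)) = (LINT \<xi>|lborel. fourier f \<xi> * S \<xi>)"
    unfolding eqS by (rule integral_complex_of_real[symmetric])
  also have "\<dots> = (LINT x|lborel. f x * fourier S x)" by (rule fourier_mult_formula[OF f Si])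
  also have "\<dots> = (LINT x|lborel. LINT u|lborel. f x * (\<Gamma> u * cnj (f (x - u))))" unfolding fS by simp
  also have "\<dots> = (LINT u|lborel. LINT x|lborel. f x * (\<Gamma> u * cnj (f (x - u))))"
    by (rule lborel_pair.Fubini_integral[OF int, symmetric])
  also have "\<dots> = (LINT u|lborel. \<Gamma> u * (LINT x|lborel. f x * cnj (f (x - u))))"
    unfolding integral_mult_right_zero[symmetric] by (simp add: mult_ac)
  \<comment> \<open>The substitution u -> e u cancels the factor e^(-d) contained in
    \<Gamma>.\<close>
  also have "\<dots> = (e ^ CARD('d)) *\<^sub>R (LINT u|lborel. \<Gamma> (e *\<^sub>R u) * (LINT x|lborel. f x * cnj (f (x - e *\<^sub>R u))))"
  proof -
    have [measurable]: "(\<lambda>u. LINT x|lborel. f x * cnj (f (x - u))) \<in> borel_measurable borel"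
      using lborel.borel_measurable_lebesgue_integral[of "\<lambda>u x. f x * cnj (f (x - u))" borel] by simp
    show ?thesis using e by (subst lborel_integral_scale(1)[of _ e]) auto
  qed
  also have "\<dots> = (LINT u|lborel. complex_of_real (gauss_mass TYPE('d)) * (complex_of_real (gauss u) * (LINT x|lborel. f x * cnj (f (x - e *\<^sub>R u)))))"
  proof -
    have "\<Gamma> (e *\<^sub>R u) = complex_of_real (gauss_mass TYPE('d)) / e ^ CARD('d) * gauss u" for u
      using e by (simp add: \<Gamma>_def)
    thus ?thesis unfolding integral_scaleR_right[symmetric] using e
      by (intro Bochner_Integration.integral_cong) (auto simp: scaleR_conv_of_real)
  qed
  also have "\<dots> = complex_of_real (gauss_mass TYPE('d)) * (LINT u|lborel. complex_of_real (gauss u) * (LINT x|lborel. f x * cnj (f (x - e *\<^sub>R u))))"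
    by (rule integral_mult_right_zero)
  finally show "complex_of_real (LINT \<xi>|lborel. (norm (fourier f \<xi>))\<^sup>2 * gauss (e *\<^sub>R \<xi>))
      = complex_of_real (gauss_mass TYPE('d)) * (LINT u|lborel. complex_of_real (gauss u) * (LINT x|lborel. f x * cnj (f (x - e *\<^sub>R u))))" .
qed

text \<open>One factor is bounded by B, so the difference is at most B times the L^1 distance
  between f and its translate.\<close>

lemma autocorrelation_tendsto:
  fixes f :: "real ^ 'd \<Rightarrow> complex"
  assumes f: "integrable lborel f" and b: "\<And>x. norm (f x) \<le> B" and h: "h \<longlonglongrightarrow> 0"
  shows "(\<lambda>n. LINT x|lborel. f x * cnj (f (x - h n))) \<longlonglongrightarrow> (LINT x|lborel. f x * cnj (f x))"
proof (rule LIM_zero_cancel, rule Lim_null_comparison)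
  note [measurable] = borel_measurable_integrable[OF f, simplified]
  have h': "(\<lambda>n. - h n) \<longlonglongrightarrow> 0" using tendsto_minus[OF h] by simp
  show "(\<lambda>n. B * (LINT x|lborel. norm (f (x + - h n) - f x))) \<longlonglongrightarrow> 0"
    using tendsto_mult_left[OF L1_shift_continuous[OF f h'], of B] by simp
  show "\<forall>\<^sub>F n in sequentially. norm ((LINT x|lborel. f x * cnj (f (x - h n))) - (LINT x|lborel. f x * cnj (f x)))
     \<le> B * (LINT x|lborel. norm (f (x + - h n) - f x))"
  proof (intro always_eventually allI)
    fix n
    note i1 = autocorrelation_integrable(1)[OF f b, of "h n"] autocorrelation_integrable(1)[OF f b, of 0]
    have "(LINT x|lborel. f x * cnj (f (x - h n))) - (LINT x|lborel. f x * cnj (f x)) = (LINT x|lborel. f x * cnj (f (x - h n)) - f x * cnj (f x))"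
      using i1 by simp
    also have "norm \<dots> \<le> (LINT x|lborel. norm (f x * cnj (f (x - h n)) - f x * cnj (f x)))" by (rule integral_norm_bound)
    also have "\<dots> \<le> (LINT x|lborel. B * norm (f (x + - h n) - f x))"
    proof (rule integral_mono)
      show "integrable lborel (\<lambda>x. norm (f x * cnj (f (x - h n)) - f x * cnj (f x)))" using i1 by simp
      show "integrable lborel (\<lambda>x. B * norm (f (x + - h n) - f x))"
        using f lborel_integrable_shift[OF f, of "- h n"] by simp
      fix x
      have "f x * cnj (f (x - h n)) - f x * cnj (f x) = f x * cnj (f (x + - h n) - f x)" by (simp add: algebra_simps)
      thus "norm (f x * cnj (f (x - h n)) - f x * cnj (f x)) \<le> B * norm (f (x + - h n) - f x)"
        using b[of x] by (simp add: norm_mult mult_right_mono del: complex_cnj_diff)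
    qed
    finally show "norm ((LINT x|lborel. f x * cnj (f (x - h n))) - (LINT x|lborel. f x * cnj (f x)))
     \<le> B * (LINT x|lborel. norm (f (x + - h n) - f x))" by simp
  qed
qed

text \<open>As e decreases to 0 the weights increase to 1, and monotone convergence identifies the
  limit on the frequency side. On the other side the autocorrelations tend to the one at 0, the
  squared norm of f, with a majorant that requires f to be bounded.\<close>

lemma plancherel_bounded:
  fixes f :: "real ^ 'd \<Rightarrow> complex"
  assumes f: "integrable lborel f" and b: "\<And>x. norm (f x) \<le> B"
  shows "fourier f \<in> Lp 2" "Lp_norm 2 (fourier f) = gauss_mass TYPE('d) * Lp_norm 2 f"
proof -
  let ?K = "gauss_mass TYPE('d)"
  note fm [measurable] = borel_measurable_integrable[OF f, simplified]
  note Fm [measurable] = fourier_measurable[OF fm]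
  define e where "e n = 1 / real (Suc n)" for n
  have e: "e n > 0" for n by (simp add: e_def)
  have e0: "e \<longlonglongrightarrow> 0" unfolding e_def by (rule LIMSEQ_Suc[OF lim_1_over_n])
  note PG = plancherel_gaussian_regularized[OF f b e]
  define R where "R u = (LINT x|lborel. f x * cnj (f (x - u)))" for u
  have [measurable]: "R \<in> borel_measurable borel"
    unfolding R_def using lborel.borel_measurable_lebesgue_integral[of "\<lambda>u x. f x * cnj (f (x - u))" borel] by simp
  have "(\<lambda>n. LINT u|lborel. complex_of_real (gauss u) * R (e n *\<^sub>R u)) \<longlonglongrightarrow> (LINT u|lborel. complex_of_real (gauss (u::real^'d)) * R 0)"
  proof (rule integral_dominated_convergence)
    show "integrable lborel (\<lambda>u::real^'d. gauss u * (B * (LINT x|lborel. norm (f x))))"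
      using gauss_integral(1)[where 'd='d] by simp
    show "AE u in lborel. (\<lambda>n. complex_of_real (gauss u) * R (e n *\<^sub>R u)) \<longlonglongrightarrow> complex_of_real (gauss u) * R 0"
    proof (intro AE_I2 tendsto_mult_left)
      fix u :: "real ^ 'd"
      have "(\<lambda>n. e n *\<^sub>R u) \<longlonglongrightarrow> 0 *\<^sub>R u" by (intro tendsto_intros e0)
      from autocorrelation_tendsto[OF f b, of "\<lambda>n. e n *\<^sub>R u"] this
      show "(\<lambda>n. R (e n *\<^sub>R u)) \<longlonglongrightarrow> R 0" by (simp add: R_def)
    qed
    show "AE u in lborel. norm (complex_of_real (gauss u) * R (e n *\<^sub>R u)) \<le> gauss u * (B * (LINT x|lborel. norm (f x)))" for n
    proof (intro AE_I2)
      fix u :: "real ^ 'd"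
      show "norm (complex_of_real (gauss u) * R (e n *\<^sub>R u)) \<le> gauss u * (B * (LINT x|lborel. norm (f x)))"
        using autocorrelation_integrable(2)[OF f b, of "e n *\<^sub>R u"] gauss_pos[of u]
        by (simp add: norm_mult R_def mult_left_mono)
    qed
  qed measurable
  hence "(\<lambda>n. complex_of_real ?K * (LINT u|lborel. complex_of_real (gauss u) * R (e n *\<^sub>R u))) \<longlonglongrightarrow> complex_of_real ?K * (complex_of_real ?K * R 0)"
    using gauss_integral(2)[where 'd='d] by (intro tendsto_mult_left) simp
  hence lim: "(\<lambda>n. complex_of_real (LINT \<xi>|lborel. (norm (fourier f \<xi>))\<^sup>2 * gauss (e n *\<^sub>R \<xi>))) \<longlonglongrightarrow> complex_of_real ?K * (complex_of_real ?K * R 0)"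
    unfolding PG(2) R_def .
  have R0: "R 0 = complex_of_real (LINT x|lborel. (norm (f x))\<^sup>2)"
  proof -
    have "R 0 = (LINT x|lborel. complex_of_real ((norm (f x))\<^sup>2))"
      unfolding R_def complex_norm_square by simp
    thus ?thesis by (simp only: integral_complex_of_real)
  qed
  have "(LINT x|lborel. (norm (f x))\<^sup>2) = (Lp_norm 2 f)\<^sup>2"
    by (simp add: Lp_norm_def powr_powr[symmetric] powr_half_sqrt integral_nonneg_AE)
  hence "(\<lambda>n. LINT \<xi>|lborel. (norm (fourier f \<xi>))\<^sup>2 * gauss (e n *\<^sub>R \<xi>)) \<longlonglongrightarrow> ?K * (?K * (Lp_norm 2 f)\<^sup>2)"
    using lim unfolding R0 by (simp only: of_real_mult[symmetric] tendsto_of_real_iff)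
  hence lim': "(\<lambda>n. LINT \<xi>|lborel. (norm (fourier f \<xi>))\<^sup>2 * gauss (e n *\<^sub>R \<xi>)) \<longlonglongrightarrow> (?K * Lp_norm 2 f)\<^sup>2"
    by (simp add: power2_eq_square mult_ac)
  have mono: "gauss (e m *\<^sub>R \<xi>) \<le> gauss (e n *\<^sub>R \<xi>)" if "m \<le> n" for m n \<xi>
  proof -
    have "(e n)\<^sup>2 \<le> (e m)\<^sup>2" using that by (intro power_mono) (auto simp: e_def frac_le)
    thus ?thesis by (simp add: gauss_def power_mult_distrib mult_right_mono)
  qed
  have "(\<integral>\<^sup>+\<xi>. ennreal ((norm (fourier f \<xi>))\<^sup>2) \<partial>lborel) = (\<integral>\<^sup>+\<xi>. (SUP n. ennreal ((norm (fourier f \<xi>))\<^sup>2 * gauss (e n *\<^sub>R \<xi>))) \<partial>lborel)"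
  proof (rule nn_integral_cong)
    fix \<xi> :: "real ^ 'd"
    have *: "(\<lambda>n. e n *\<^sub>R \<xi>) \<longlonglongrightarrow> 0 *\<^sub>R \<xi>" by (intro tendsto_intros e0)
    have "(\<lambda>n. (norm (fourier f \<xi>))\<^sup>2 * gauss (e n *\<^sub>R \<xi>)) \<longlonglongrightarrow> (norm (fourier f \<xi>))\<^sup>2 * exp (- (norm (0 *\<^sub>R \<xi>))\<^sup>2 / 2)"
      unfolding gauss_def
      by (intro tendsto_mult tendsto_const tendsto_exp tendsto_divide tendsto_minus tendsto_power tendsto_norm *) auto
    hence "(\<lambda>n. ennreal ((norm (fourier f \<xi>))\<^sup>2 * gauss (e n *\<^sub>R \<xi>))) \<longlonglongrightarrow> ennreal ((norm (fourier f \<xi>))\<^sup>2)"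
      by (intro tendsto_ennrealI) simp
    moreover have "incseq (\<lambda>n. ennreal ((norm (fourier f \<xi>))\<^sup>2 * gauss (e n *\<^sub>R \<xi>)))"
      by (intro monoI ennreal_leI mult_left_mono mono) auto
    ultimately show "ennreal ((norm (fourier f \<xi>))\<^sup>2) = (SUP n. ennreal ((norm (fourier f \<xi>))\<^sup>2 * gauss (e n *\<^sub>R \<xi>)))"
      using LIMSEQ_SUP LIMSEQ_unique by blast
  qed
  also have "\<dots> = (SUP n. \<integral>\<^sup>+\<xi>. ennreal ((norm (fourier f \<xi>))\<^sup>2 * gauss (e n *\<^sub>R \<xi>)) \<partial>lborel)"
    by (rule nn_integral_monotone_convergence_SUP) (auto intro!: incseq_SucI le_funI ennreal_leI mult_left_mono mono)
  also have "\<dots> = (SUP n. ennreal (LINT \<xi>|lborel. (norm (fourier f \<xi>))\<^sup>2 * gauss (e n *\<^sub>R \<xi>)))"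
    using PG(1) by (subst nn_integral_eq_integral) (auto intro!: mult_nonneg_nonneg less_imp_le[OF gauss_pos])
  also have "\<dots> = ennreal ((?K * Lp_norm 2 f)\<^sup>2)"
  proof -
    have "incseq (\<lambda>n. ennreal (LINT \<xi>|lborel. (norm (fourier f \<xi>))\<^sup>2 * gauss (e n *\<^sub>R \<xi>)))"
      by (intro monoI ennreal_leI integral_mono PG(1) mult_left_mono mono) auto
    from LIMSEQ_SUP[OF this] tendsto_ennrealI[OF lim'] show ?thesis by (rule LIMSEQ_unique)
  qed
  finally have main: "(\<integral>\<^sup>+\<xi>. ennreal (norm (fourier f \<xi>) powr 2) \<partial>lborel) = ennreal ((?K * Lp_norm 2 f)\<^sup>2)" by simp
  show L: "fourier f \<in> Lp 2" unfolding Lp_iff_nn_integral using main Fm by simp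
  have "ennreal ((Lp_norm 2 (fourier f))\<^sup>2) = ennreal ((?K * Lp_norm 2 f)\<^sup>2)"
    using Lp_nn_integral[OF L] main by simp
  thus "Lp_norm 2 (fourier f) = ?K * Lp_norm 2 f"
    using gauss_mass_pos[where 'd='d] by (simp add: power2_eq_iff_nonneg less_imp_le)
qed

text \<open>Truncation and Fatou's lemma give \<open>\<le>\<close> for every f in both spaces.
  Applied to u n - f, this makes the transforms of the truncations converge in L^2, so the equality
  known for them passes to f.\<close>

lemma plancherel:
  fixes f :: "real ^ 'd \<Rightarrow> complex"
  assumes f: "f \<in> Lp 1" and f2: "f \<in> Lp 2"
  shows "fourier f \<in> Lp 2" "Lp_norm 2 (fourier f) = gauss_mass TYPE('d) * Lp_norm 2 f"
proof -
  let ?K = "gauss_mass TYPE('d)"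
  have K0: "0 \<le> ?K" using gauss_mass_pos[where 'd='d] by simp
  have key: "\<exists>u. (\<forall>n. u n \<in> Lp 1 \<and> u n \<in> Lp 2 \<and> fourier (u n) \<in> Lp 2 \<and> Lp_norm 2 (fourier (u n)) = ?K * Lp_norm 2 (u n))
      \<and> Lp_tendsto 2 u f \<and> fourier f \<in> Lp 2 \<and> Lp_norm 2 (fourier f) \<le> ?K * Lp_norm 2 f" if f: "f \<in> Lp 1" "f \<in> Lp 2" for f :: "real ^ 'd \<Rightarrow> complex"
  proof -
    obtain u where u: "\<And>n. u n \<in> borel_measurable borel" "\<And>n q. 1 \<le> q \<Longrightarrow> u n \<in> Lp q"
      "\<And>n x. norm (u n x) \<le> norm (f x)" "\<And>n x. norm (u n x) \<le> real n" "\<And>x. (\<lambda>n. u n x) \<longlonglongrightarrow> f x"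
      using Lp_truncations[of 2 f] f by auto
    note fm [measurable] = Lp_measurable[OF f(1)] and [measurable] = u(1)
    have P: "fourier (u n) \<in> Lp 2" "Lp_norm 2 (fourier (u n)) = ?K * Lp_norm 2 (u n)" for n
      using plancherel_bounded[of "u n" "real n"] u(2)[of 1 n] u(2)[of 2 n] u(4)[of n] by (auto simp: Lp_1_iff)
    have T: "Lp_tendsto 2 u f"
      by (rule Lp_dominated_convergence[OF _ u(1) fm f(2)]) (use u in auto)
    have le: "Lp_norm 2 (u n) \<le> Lp_norm 2 f" for n
      using Lp_bound(2)[OF u(1) f(2), of n 1] u(3) by simp
    have pt: "(\<lambda>n. fourier (u n) \<xi>) \<longlonglongrightarrow> fourier f \<xi>" for \<xi>
      unfolding fourier_def
    proof (rule integral_dominated_convergence[where w="\<lambda>x. norm (f x)"])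
      show "AE x in lborel. (\<lambda>n. exp (\<i> * complex_of_real (\<xi> \<bullet> x)) * u n x) \<longlonglongrightarrow> exp (\<i> * complex_of_real (\<xi> \<bullet> x)) * f x"
        by (intro AE_I2 tendsto_mult_left u)
    qed (use f u(3) in \<open>auto simp: norm_mult Lp_1_iff\<close>)
    have "fourier f \<in> Lp 2 \<and> Lp_norm 2 (fourier f) \<le> ?K * Lp_norm 2 f"
      using Lp_Fatou[of "\<lambda>n. fourier (u n)" 2 "?K * Lp_norm 2 f" "fourier f"] P pt le K0 fourier_measurable[OF fm]
      by (auto simp: mult_left_mono)
    thus ?thesis using u(2) P T by (intro exI[of _ u]) auto
  qed
  obtain u where u: "\<And>n. u n \<in> Lp 1" "\<And>n. u n \<in> Lp 2" "\<And>n. fourier (u n) \<in> Lp 2" "\<And>n. Lp_norm 2 (fourier (u n)) = ?K * Lp_norm 2 (u n)"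
      "Lp_tendsto 2 u f" and F: "fourier f \<in> Lp 2"
    using key[OF f f2] by metis
  show "fourier f \<in> Lp 2" by (rule F)
  have le: "Lp_norm 2 (\<lambda>\<xi>. fourier (u n) \<xi> - fourier f \<xi>) \<le> ?K * Lp_norm 2 (\<lambda>x. u n x - f x)" for n
  proof -
    have "fourier (\<lambda>x. u n x - f x) = (\<lambda>\<xi>. fourier (u n) \<xi> - fourier f \<xi>)"
      using fourier_add[of "u n" f 1 "-1"] u(1)[of n] f by (simp add: Lp_1_iff fun_eq_iff)
    moreover have "Lp_norm 2 (fourier (\<lambda>x. u n x - f x)) \<le> ?K * Lp_norm 2 (\<lambda>x. u n x - f x)"
      using key[OF Lp_diff[OF _ u(1) f] Lp_diff[OF _ u(2) f2]] by auto
    ultimately show ?thesis by simp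
  qed
  have "Lp_tendsto 2 (\<lambda>n. fourier (u n)) (fourier f)"
  proof (rule Lp_tendstoI[OF u(3) F], rule Lim_null_comparison)
    show "(\<lambda>n. ?K * Lp_norm 2 (\<lambda>x. u n x - f x)) \<longlonglongrightarrow> 0"
      using tendsto_mult_left[OF Lp_tendstoD(3)[OF u(5)], of ?K] by simp
  qed (use le in simp)
  from Lp_tendsto_norm[OF _ this] have "(\<lambda>n. ?K * Lp_norm 2 (u n)) \<longlonglongrightarrow> Lp_norm 2 (fourier f)" by (simp add: u(4))
  moreover have "(\<lambda>n. ?K * Lp_norm 2 (u n)) \<longlonglongrightarrow> ?K * Lp_norm 2 f"
    by (intro tendsto_mult_left Lp_tendsto_norm u) simp
  ultimately show "Lp_norm 2 (fourier f) = ?K * Lp_norm 2 f" by (rule LIMSEQ_unique)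
qed

section \<open>Extension of the Fourier transform to L^2\<close>

lemma fourier_diff:
  fixes f g :: "real ^ 'd \<Rightarrow> complex"
  assumes "f \<in> Lp 1" "g \<in> Lp 1"
  shows "fourier (\<lambda>x. f x - g x) = (\<lambda>\<xi>. fourier f \<xi> - fourier g \<xi>)"
  using fourier_add[of f g 1 "-1"] assms by (simp add: Lp_1_iff fun_eq_iff)

text \<open>Needed for the \<open>SOME\<close> in \<open>fourier_L2\<close> to have a witness.
  Plancherel's identity applied to differences makes the transform Lipschitz on the intersection of
  L^1 and L^2.\<close>

lemma fourier_L2_exists:
  fixes f :: "real ^ 'd \<Rightarrow> complex"
  assumes f: "f \<in> Lp 2"
  shows "\<exists>h. h \<in> Lp 2 \<and> (\<forall>u. (\<forall>n. u n \<in> Lp 1) \<and> Lp_tendsto 2 u f \<longrightarrow> Lp_tendsto 2 (\<lambda>n. fourier (u n)) h)"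
proof -
  obtain u where u: "\<And>n q. 1 \<le> q \<Longrightarrow> u n \<in> Lp q" "Lp_tendsto 2 u f"
    by (rule Lp_approx[OF one_le_numeral f]) blast
  have "Lp_norm 2 (\<lambda>\<xi>. fourier v \<xi> - fourier w \<xi>) \<le> gauss_mass TYPE('d) * Lp_norm 2 (\<lambda>x. v x - w x)"
    if "v \<in> Lp 1 \<inter> Lp 2" "w \<in> Lp 1 \<inter> Lp 2" for v w :: "real ^ 'd \<Rightarrow> complex"
    using plancherel(2)[of "\<lambda>x. v x - w x"] fourier_diff[of v w] that by (simp add: Lp_diff)
  hence "\<exists>h. h \<in> Lp 2 \<and> (\<forall>v. (\<forall>n. v n \<in> Lp 1 \<inter> Lp 2) \<and> Lp_tendsto 2 v f \<longrightarrow> Lp_tendsto 2 (\<lambda>n. fourier (v n)) h)"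
    using u plancherel(1) gauss_mass_pos[where 'd='d]
    by (intro Lp_limit_extension[of 2 "Lp 1 \<inter> Lp 2" fourier "gauss_mass TYPE('d)" u f]) auto
  thus ?thesis using Lp_tendstoD(1) by blast
qed

lemma fourier_L2:
  fixes f :: "real ^ 'd \<Rightarrow> complex"
  assumes "f \<in> Lp 2"
  shows "fourier_L2 f \<in> Lp 2"
    and "\<And>u. (\<And>n. u n \<in> Lp 1) \<Longrightarrow> Lp_tendsto 2 u f \<Longrightarrow> Lp_tendsto 2 (\<lambda>n. fourier (u n)) (fourier_L2 f)"
  using someI_ex[OF fourier_L2_exists[OF assms], folded fourier_L2_def] by auto

lemma L1_L2_approx:
  fixes f :: "real ^ 'd \<Rightarrow> complex"
  assumes f: "f \<in> Lp 2"
  obtains u where "\<And>n. u n \<in> Lp 1" "Lp_tendsto 2 u f" "Lp_tendsto 2 (\<lambda>n. fourier (u n)) (fourier_L2 f)"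
proof -
  obtain u where u: "\<And>n q. 1 \<le> q \<Longrightarrow> u n \<in> Lp q" "Lp_tendsto 2 u f"
    by (rule Lp_approx[OF one_le_numeral f]) blast
  have u1: "u n \<in> Lp 1" for n by (simp add: u(1))
  show ?thesis by (rule that[OF u1 u(2) fourier_L2(2)[OF f u1 u(2)]])
qed

lemma fourier_L2_norm:
  fixes f :: "real ^ 'd \<Rightarrow> complex"
  assumes f: "f \<in> Lp 2"
  shows "Lp_norm 2 (fourier_L2 f) = gauss_mass TYPE('d) * Lp_norm 2 f"
proof -
  obtain u where u: "\<And>n. u n \<in> Lp 1" "Lp_tendsto 2 u f" "Lp_tendsto 2 (\<lambda>n. fourier (u n)) (fourier_L2 f)"
    by (rule L1_L2_approx[OF f]) blast
  have "(\<lambda>n. gauss_mass TYPE('d) * Lp_norm 2 (u n)) \<longlonglongrightarrow> Lp_norm 2 (fourier_L2 f)"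
    using Lp_tendsto_norm[OF _ u(3)] plancherel(2)[OF u(1) Lp_tendstoD(1)[OF u(2)]] by simp
  moreover have "(\<lambda>n. gauss_mass TYPE('d) * Lp_norm 2 (u n)) \<longlonglongrightarrow> gauss_mass TYPE('d) * Lp_norm 2 f"
    by (intro tendsto_mult_left Lp_tendsto_norm u) simp
  ultimately show ?thesis by (rule LIMSEQ_unique)
qed

lemma fourier_L2_lin:
  fixes f g :: "real ^ 'd \<Rightarrow> complex"
  assumes f: "f \<in> Lp 2" and g: "g \<in> Lp 2"
  shows "AE \<xi> in lborel. fourier_L2 (\<lambda>x. a * f x + b * g x) \<xi> = a * fourier_L2 f \<xi> + b * fourier_L2 g \<xi>"
proof -
  obtain u where u: "\<And>n. u n \<in> Lp 1" "Lp_tendsto 2 u f" "Lp_tendsto 2 (\<lambda>n. fourier (u n)) (fourier_L2 f)"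
    by (rule L1_L2_approx[OF f]) blast
  obtain v where v: "\<And>n. v n \<in> Lp 1" "Lp_tendsto 2 v g" "Lp_tendsto 2 (\<lambda>n. fourier (v n)) (fourier_L2 g)"
    by (rule L1_L2_approx[OF g]) blast
  have 2: "(1::real) \<le> 2" by simp
  have "Lp_tendsto 2 (\<lambda>n. fourier (\<lambda>x. a * u n x + b * v n x)) (fourier_L2 (\<lambda>x. a * f x + b * g x))"
    by (intro fourier_L2(2) Lp_add Lp_scale f g u v Lp_tendsto_lin 2) auto
  moreover have "fourier (\<lambda>x. a * u n x + b * v n x) = (\<lambda>\<xi>. a * fourier (u n) \<xi> + b * fourier (v n) \<xi>)" for n
    using u(1)[of n] v(1)[of n] fourier_add by (force simp: Lp_1_iff)
  ultimately show ?thesis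
    using Lp_tendsto_unique[OF 2 _ Lp_tendsto_lin[OF 2 u(3) v(3), of a b]] by simp
qed

lemma fourier_L2_shift:
  fixes f :: "real ^ 'd \<Rightarrow> complex"
  assumes f: "f \<in> Lp 2"
  shows "AE \<xi> in lborel. fourier_L2 (\<lambda>x. f (x + z)) \<xi> = exp (- \<i> * complex_of_real (\<xi> \<bullet> z)) * fourier_L2 f \<xi>"
proof -
  obtain u where u: "\<And>n. u n \<in> Lp 1" "Lp_tendsto 2 u f" "Lp_tendsto 2 (\<lambda>n. fourier (u n)) (fourier_L2 f)"
    by (rule L1_L2_approx[OF f]) blast
  note hL = Lp_tendstoD[OF u(3)]
  note [measurable] = Lp_measurable[OF hL(1)] Lp_measurable[OF hL(2)]
  let ?c = "\<lambda>\<xi>. exp (- \<i> * complex_of_real (\<xi> \<bullet> z))"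
  have "Lp_tendsto 2 (\<lambda>n. fourier (\<lambda>x. u n (x + z))) (fourier_L2 (\<lambda>x. f (x + z)))"
    by (intro fourier_L2(2) Lp_shift f u Lp_tendsto_shift)
  hence 1: "Lp_tendsto 2 (\<lambda>n \<xi>. ?c \<xi> * fourier (u n) \<xi>) (fourier_L2 (\<lambda>x. f (x + z)))"
    unfolding fourier_shift[OF Lp_measurable[OF u(1)], abs_def] .
  have 2: "Lp_tendsto 2 (\<lambda>n \<xi>. ?c \<xi> * fourier (u n) \<xi>) (\<lambda>\<xi>. ?c \<xi> * fourier_L2 f \<xi>)"
  proof (rule Lp_tendstoI)
    show "(\<lambda>\<xi>. ?c \<xi> * fourier (u n) \<xi>) \<in> Lp 2" for n
      by (rule Lp_bound(1)[OF _ hL(1)[of n], of _ 1]) (auto simp: norm_mult)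
    show "(\<lambda>\<xi>. ?c \<xi> * fourier_L2 f \<xi>) \<in> Lp 2"
      by (rule Lp_bound(1)[OF _ hL(2), of _ 1]) (auto simp: norm_mult)
    have "Lp_norm 2 (\<lambda>\<xi>. ?c \<xi> * fourier (u n) \<xi> - ?c \<xi> * fourier_L2 f \<xi>) = Lp_norm 2 (\<lambda>\<xi>. fourier (u n) \<xi> - fourier_L2 f \<xi>)" for n
      unfolding right_diff_distrib[symmetric] Lp_norm_def by (simp add: norm_mult)
    thus "(\<lambda>n. Lp_norm 2 (\<lambda>\<xi>. ?c \<xi> * fourier (u n) \<xi> - ?c \<xi> * fourier_L2 f \<xi>)) \<longlonglongrightarrow> 0" using hL(3) by simp
  qed
  show ?thesis by (rule Lp_tendsto_unique[OF _ 1 2]) simp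
qed

lemma fourier_L2_diff_norm:
  fixes f g :: "real ^ 'd \<Rightarrow> complex"
  assumes f: "f \<in> Lp 2" and g: "g \<in> Lp 2"
  shows "Lp_norm 2 (\<lambda>\<xi>. fourier_L2 f \<xi> - fourier_L2 g \<xi>) = gauss_mass TYPE('d) * Lp_norm 2 (\<lambda>x. f x - g x)"
proof -
  have d: "(\<lambda>x. f x - g x) \<in> Lp 2" by (rule Lp_diff) (use f g in auto)
  note [measurable] = Lp_measurable[OF fourier_L2(1)[OF f]] Lp_measurable[OF fourier_L2(1)[OF g]] Lp_measurable[OF fourier_L2(1)[OF d]]
  have "AE \<xi> in lborel. fourier_L2 (\<lambda>x. f x - g x) \<xi> = fourier_L2 f \<xi> - fourier_L2 g \<xi>"
    using fourier_L2_lin[OF f g, of 1 "-1"] by simp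
  hence "Lp_norm 2 (fourier_L2 (\<lambda>x. f x - g x)) = Lp_norm 2 (\<lambda>\<xi>. fourier_L2 f \<xi> - fourier_L2 g \<xi>)"
    by (intro Lp_cong_AE) auto
  thus ?thesis using fourier_L2_norm[OF d] by simp
qed

text \<open>Plancherel's identity gives the difference norm 0. This is what ties a function chosen
  through its transform to any other function with the same transform.\<close>

lemma fourier_L2_inj_AE:
  fixes f g :: "real ^ 'd \<Rightarrow> complex"
  assumes f: "f \<in> Lp 2" and g: "g \<in> Lp 2" and eq: "AE \<xi> in lborel. fourier_L2 f \<xi> = fourier_L2 g \<xi>"
  shows "AE x in lborel. f x = g x"
proof -
  note [measurable] = Lp_measurable[OF fourier_L2(1)[OF f]] Lp_measurable[OF fourier_L2(1)[OF g]]
  have "Lp_norm 2 (\<lambda>\<xi>. fourier_L2 f \<xi> - fourier_L2 g \<xi>) = Lp_norm 2 (\<lambda>_::real^'d. 0)"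
    using eq by (intro Lp_cong_AE) auto
  hence "Lp_norm 2 (\<lambda>x. f x - g x) = 0"
    using fourier_L2_diff_norm[OF f g] gauss_mass_pos[where 'd='d] by (simp add: Lp_zero(2))
  hence "AE x in lborel. f x - g x = 0" by (intro Lp_norm_eq_0D[of _ 2]) (use f g in \<open>auto intro: Lp_diff\<close>)
  thus ?thesis by simp
qed

section \<open>Martingale transforms along random walks\<close>

text \<open>
  In a step \<open>(c, z, w)\<close> the walk jumps by \<open>z\<close> with probability \<open>c\<close> and stays with probability \<open>1 - c\<close>,
  while \<open>w\<close> multiplies the martingale increment; the head of a list is the first step.
  \<open>walk_mean L f x\<close> and \<open>walk_moment p L f x\<close> are the expectations of \<open>f\<close> and \<open>|f|\<^sup>p\<close> at the final position of
  a walk started at \<open>x\<close>, and \<open>transform_moment p L f x y\<close> is the \<open>p\<close>-th moment of the final value of the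
  transformed martingale with initial value \<open>y\<close>. \<open>projected_transform L f y\<close> conditions that final value
  on the final position, the initial position being distributed according to Lebesgue measure.
\<close>

type_synonym 'v transform_step = "real \<times> 'v \<times> complex"

fun walk_mean :: "'v::ab_group_add transform_step list \<Rightarrow> ('v \<Rightarrow> complex) \<Rightarrow> 'v \<Rightarrow> complex" where
  "walk_mean [] f x = f x"
| "walk_mean ((c, z, w) # L) f x = (1 - of_real c) * walk_mean L f x + of_real c * walk_mean L f (x + z)"

fun walk_moment :: "real \<Rightarrow> 'v::ab_group_add transform_step list \<Rightarrow> ('v \<Rightarrow> complex) \<Rightarrow> 'v \<Rightarrow> real" where
  "walk_moment p [] f x = norm (f x) powr p"
| "walk_moment p ((c, z, w) # L) f x = (1 - c) * walk_moment p L f x + c * walk_moment p L f (x + z)"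

fun transform_moment :: "real \<Rightarrow> 'v::ab_group_add transform_step list \<Rightarrow> ('v \<Rightarrow> complex) \<Rightarrow> 'v \<Rightarrow> complex \<Rightarrow> real" where
  "transform_moment p [] f x y = norm y powr p"
| "transform_moment p ((c, z, w) # L) f x y =
     (1 - c) * transform_moment p L f x (y + w * (walk_mean L f x - walk_mean ((c, z, w) # L) f x)) +
     c * transform_moment p L f (x + z) (y + w * (walk_mean L f (x + z) - walk_mean ((c, z, w) # L) f x))"

fun projected_transform :: "'v::ab_group_add transform_step list \<Rightarrow> ('v \<Rightarrow> complex) \<Rightarrow> ('v \<Rightarrow> complex) \<Rightarrow> 'v \<Rightarrow> complex" where
  "projected_transform [] f y = y"
| "projected_transform ((c, z, w) # L) f y = projected_transform L f
     (\<lambda>x. (1 - of_real c) * (y x + w * (walk_mean L f x - walk_mean ((c, z, w) # L) f x)) +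
          of_real c * (y (x - z) + w * (walk_mean L f x - walk_mean ((c, z, w) # L) f (x - z))))"

definition admissible :: "'v transform_step \<Rightarrow> bool" where
  "admissible s \<longleftrightarrow> (case s of (c, z, w) \<Rightarrow> 0 \<le> c \<and> c \<le> 1 \<and> norm w \<le> 1)"

lemma transform_moment_nonneg: "\<forall>s\<in>set L. admissible s \<Longrightarrow> 0 \<le> transform_moment p L f x y"
  by (induction p L f x y rule: transform_moment.induct) (auto simp: admissible_def)

lemma walk_moment_nonneg: "\<forall>s\<in>set L. admissible s \<Longrightarrow> 0 \<le> walk_moment p L f x"
  by (induction p L f x rule: walk_moment.induct) (auto simp: admissible_def)

text \<open>Induction peels off the first step. The branches move the pair (mean, transform) by
  increments of the form (h, w h), so their difference is a direction of concavity, and the branches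
  average to the pair before the step. The term with \<open>walk_moment\<close> averages
  exactly.\<close>

lemma transform_moment_le_burk:
  assumes p: "1 < p" and \<alpha>: "0 < \<alpha>"
    and maj: "\<And>x y. norm y powr p - pstar_minus_1 p powr p * norm x powr p \<le> \<alpha> * burk p x y"
    and L: "\<forall>s\<in>set L. admissible s"
  shows "transform_moment p L f x y \<le> pstar_minus_1 p powr p * walk_moment p L f x + \<alpha> * burk p (walk_mean L f x) y"
  using L
proof (induction L arbitrary: x y)
  case Nil
  show ?case using maj[of y "f x"] by simp
next
  case (Cons s L)
  obtain c z w where s: "s = (c, z, w)" by (cases s)
  have adm: "0 \<le> c" "c \<le> 1" "norm w \<le> 1" using Cons.prems by (auto simp: s admissible_def)
  have IH: "transform_moment p L f x y \<le> pstar_minus_1 p powr p * walk_moment p L f x + \<alpha> * burk p (walk_mean L f x) y" for x y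
    using Cons by auto
  let ?a1 = "walk_mean L f x" and ?a2 = "walk_mean L f (x + z)" and ?m = "walk_mean (s # L) f x"
  let ?b1 = "y + w * (?a1 - ?m)" and ?b2 = "y + w * (?a2 - ?m)"
  have m: "?m = (1 - of_real c) * ?a1 + of_real c * ?a2" by (simp add: s)
  have d: "?b2 - ?b1 = w * (?a2 - ?a1)" by (simp add: algebra_simps)
  have "norm (?b2 - ?b1) \<le> norm (?a2 - ?a1)"
    unfolding d norm_mult using adm(3) by (simp add: mult_left_le_one_le)
  from burk_concave[OF p this adm(1,2)]
  have conc: "(1 - c) * burk p ?a1 ?b1 + c * burk p ?a2 ?b2 \<le> burk p ?m ((1 - of_real c) * ?b1 + of_real c * ?b2)"
    unfolding m .
  have "(1 - of_real c) * ?b1 + of_real c * ?b2 = y" unfolding m by (simp add: algebra_simps)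
  hence conc: "(1 - c) * burk p ?a1 ?b1 + c * burk p ?a2 ?b2 \<le> burk p ?m y" using conc by simp
  have "transform_moment p (s # L) f x y = (1 - c) * transform_moment p L f x ?b1 + c * transform_moment p L f (x + z) ?b2"
    by (simp add: s)
  also have "\<dots> \<le> (1 - c) * (pstar_minus_1 p powr p * walk_moment p L f x + \<alpha> * burk p ?a1 ?b1)
      + c * (pstar_minus_1 p powr p * walk_moment p L f (x + z) + \<alpha> * burk p ?a2 ?b2)"
    using adm by (intro add_mono mult_left_mono IH) auto
  also have "\<dots> = pstar_minus_1 p powr p * walk_moment p (s # L) f x + \<alpha> * ((1 - c) * burk p ?a1 ?b1 + c * burk p ?a2 ?b2)"
    by (simp add: s algebra_simps)
  also have "\<dots> \<le> pstar_minus_1 p powr p * walk_moment p (s # L) f x + \<alpha> * burk p ?m y"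
    using conc \<alpha> by simp
  finally show ?case .
qed

text \<open>The initial value is merely added to increments that do not depend on it, so the final
  value is affine in it and the p-th power of the modulus is convex. This is the form of Jensen's
  inequality that the projection uses.\<close>

lemma transform_moment_convex:
  assumes p: "1 \<le> p" and L: "\<forall>s\<in>set L. admissible s" and c: "0 \<le> c" "c \<le> 1"
  shows "transform_moment p L f x ((1 - of_real c) * y1 + of_real c * y2)
    \<le> (1 - c) * transform_moment p L f x y1 + c * transform_moment p L f x y2"
  using L
proof (induction L arbitrary: x y1 y2)
  case Nil
  have "norm ((1 - of_real c) * y1 + of_real c * y2) \<le> (1 - c) * norm y1 + c * norm y2"
  proof -
    have "norm ((1 - of_real c) * y1 + of_real c * y2) \<le> norm ((1 - of_real c) * y1) + norm (of_real c * y2)"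
      by (rule norm_triangle_ineq)
    also have "\<dots> = (1 - c) * norm y1 + c * norm y2"
      using c norm_of_real[of "1 - c", where 'a=complex] by (simp add: norm_mult)
    finally show ?thesis .
  qed
  hence "norm ((1 - of_real c) * y1 + of_real c * y2) powr p \<le> ((1 - c) * norm y1 + c * norm y2) powr p"
    using p by (intro powr_mono2) auto
  also have "\<dots> \<le> (1 - c) * norm y1 powr p + c * norm y2 powr p"
    using p c by (intro powr_convex_combination) auto
  finally show ?case by simp
next
  case (Cons s L)
  obtain d z w where s: "s = (d, z, w)" by (cases s)
  have adm: "0 \<le> d" "d \<le> 1" using Cons.prems by (auto simp: s admissible_def)
  have IH: "transform_moment p L f x ((1 - of_real c) * y1 + of_real c * y2)
    \<le> (1 - c) * transform_moment p L f x y1 + c * transform_moment p L f x y2" for x y1 y2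
    using Cons by auto
  let ?h1 = "w * (walk_mean L f x - walk_mean (s # L) f x)" and ?h2 = "w * (walk_mean L f (x + z) - walk_mean (s # L) f x)"
  have e: "((1 - of_real c) * y1 + of_real c * y2) + h = (1 - of_real c) * (y1 + h) + of_real c * (y2 + h)" for h
    by (simp add: algebra_simps)
  have "transform_moment p (s # L) f x ((1 - of_real c) * y1 + of_real c * y2)
    = (1 - d) * transform_moment p L f x ((1 - of_real c) * (y1 + ?h1) + of_real c * (y2 + ?h1))
      + d * transform_moment p L f (x + z) ((1 - of_real c) * (y1 + ?h2) + of_real c * (y2 + ?h2))"
    unfolding s transform_moment.simps e ..
  also have "\<dots> \<le> (1 - d) * ((1 - c) * transform_moment p L f x (y1 + ?h1) + c * transform_moment p L f x (y2 + ?h1))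
      + d * ((1 - c) * transform_moment p L f (x + z) (y1 + ?h2) + c * transform_moment p L f (x + z) (y2 + ?h2))"
    using adm by (intro add_mono mult_left_mono IH) auto
  also have "\<dots> = (1 - c) * transform_moment p (s # L) f x y1 + c * transform_moment p (s # L) f x y2"
    unfolding s transform_moment.simps by (simp add: algebra_simps del: walk_mean.simps)
  finally show ?case .
qed

lemma walk_mean_measurable:
  fixes f :: "real ^ 'd \<Rightarrow> complex"
  assumes [measurable]: "f \<in> borel_measurable borel"
  shows "walk_mean L f \<in> borel_measurable borel"
proof (induction L)
  case (Cons s L)
  obtain c z w where s: "s = (c, z, w)" by (cases s)
  note [measurable] = Cons
  have "walk_mean (s # L) f = (\<lambda>x. (1 - of_real c) * walk_mean L f x + of_real c * walk_mean L f (x + z))"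
    by (auto simp: s)
  thus ?case by simp
qed (simp add: assms ext[of "walk_mean [] f" f])

lemma walk_moment_measurable:
  fixes f :: "real ^ 'd \<Rightarrow> complex"
  assumes [measurable]: "f \<in> borel_measurable borel"
  shows "walk_moment p L f \<in> borel_measurable borel"
proof (induction L)
  case Nil
  have "walk_moment p [] f = (\<lambda>x. norm (f x) powr p)" by auto
  thus ?case by simp
next
  case (Cons s L)
  obtain c z w where s: "s = (c, z, w)" by (cases s)
  note [measurable] = Cons
  have "walk_moment p (s # L) f = (\<lambda>x. (1 - c) * walk_moment p L f x + c * walk_moment p L f (x + z))"
    by (auto simp: s)
  thus ?case by simp
qed

lemma transform_moment_measurable:
  fixes f y :: "real ^ 'd \<Rightarrow> complex"
  assumes f [measurable]: "f \<in> borel_measurable borel" and "y \<in> borel_measurable borel"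
  shows "(\<lambda>x. transform_moment p L f x (y x)) \<in> borel_measurable borel"
  using assms(2)
proof (induction L arbitrary: y)
  case Nil
  note [measurable] = Nil
  show ?case by simp
next
  case (Cons s L)
  obtain c z w where s: "s = (c, z, w)" by (cases s)
  note [measurable] = Cons.prems walk_mean_measurable[OF f]
  have 1 [measurable]: "(\<lambda>x. transform_moment p L f x (y x + w * (walk_mean L f x - walk_mean ((c, z, w) # L) f x))) \<in> borel_measurable borel"
    by (rule Cons.IH) measurable
  \<comment> \<open>The induction hypothesis evaluates at the starting point itself, so the branch
    at x + z is first written as a function of the new position and then composed with the
    translation.\<close>
  have "(\<lambda>x. transform_moment p L f x (y (x - z) + w * (walk_mean L f x - walk_mean ((c, z, w) # L) f (x - z)))) \<in> borel_measurable borel"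
    by (rule Cons.IH) measurable
  from measurable_compose[of "\<lambda>x. x + z", OF _ this]
  have 2 [measurable]: "(\<lambda>x. transform_moment p L f (x + z) (y x + w * (walk_mean L f (x + z) - walk_mean ((c, z, w) # L) f x))) \<in> borel_measurable borel"
    by simp
  show ?case unfolding s transform_moment.simps by measurable
qed

text \<open>Lebesgue measure is invariant under every step, so the final position is distributed
  like the initial one.\<close>

lemma walk_moment_integral:
  fixes f :: "real ^ 'd \<Rightarrow> complex"
  assumes f [measurable]: "f \<in> borel_measurable borel" and L: "\<forall>s\<in>set L. admissible s"
  shows "(\<integral>\<^sup>+x. ennreal (walk_moment p L f x) \<partial>lborel) = (\<integral>\<^sup>+x. ennreal (norm (f x) powr p) \<partial>lborel)"
  using L
proof (induction L)
  case (Cons s L)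
  obtain c z w where s: "s = (c, z, w)" by (cases s)
  have c: "0 \<le> c" "c \<le> 1" using Cons.prems by (auto simp: s admissible_def)
  note [measurable] = walk_moment_measurable[OF f]
  have "(\<integral>\<^sup>+x. ennreal (walk_moment p (s # L) f x) \<partial>lborel)
    = (\<integral>\<^sup>+x. ennreal (1 - c) * ennreal (walk_moment p L f x) + ennreal c * ennreal (walk_moment p L f (x + z)) \<partial>lborel)"
    using c Cons.prems walk_moment_nonneg[of L p f]
    by (intro nn_integral_cong) (simp add: s ennreal_mult'[symmetric] ennreal_plus[symmetric] del: ennreal_plus)
  also have "\<dots> = ennreal (1 - c) * (\<integral>\<^sup>+x. ennreal (walk_moment p L f x) \<partial>lborel) + ennreal c * (\<integral>\<^sup>+x. ennreal (walk_moment p L f (x + z)) \<partial>lborel)"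
    by (subst nn_integral_add) (auto simp: nn_integral_cmult)
  also have "(\<integral>\<^sup>+x. ennreal (walk_moment p L f (x + z)) \<partial>lborel) = (\<integral>\<^sup>+x. ennreal (walk_moment p L f x) \<partial>lborel)"
    by (rule nn_integral_lborel_shift) simp
  also have "ennreal (1 - c) * (\<integral>\<^sup>+x. ennreal (walk_moment p L f x) \<partial>lborel) + ennreal c * (\<integral>\<^sup>+x. ennreal (walk_moment p L f x) \<partial>lborel)
    = ennreal (1 - c + c) * (\<integral>\<^sup>+x. ennreal (walk_moment p L f x) \<partial>lborel)"
    using c by (subst ennreal_plus) (auto simp: distrib_right)
  finally show ?case using Cons by simp
qed simp

text \<open>Under Lebesgue measure the mass arriving at x comes from x with weight 1 - c and from x
  - z with weight c. Replacing the two values carried along by their average lowers every later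
  moment, by convexity in the initial value; a change of variable restores the moment of the full
  list.\<close>

lemma projected_transform_integral_le:
  fixes f y :: "real ^ 'd \<Rightarrow> complex"
  assumes p: "1 \<le> p" and f [measurable]: "f \<in> borel_measurable borel" and "y \<in> borel_measurable borel" and L: "\<forall>s\<in>set L. admissible s"
  shows "projected_transform L f y \<in> borel_measurable borel \<and>
    (\<integral>\<^sup>+x. ennreal (norm (projected_transform L f y x) powr p) \<partial>lborel) \<le> (\<integral>\<^sup>+x. ennreal (transform_moment p L f x (y x)) \<partial>lborel)"
  using L assms(3)
proof (induction L arbitrary: y)
  case (Cons s L)
  obtain c z w where s: "s = (c, z, w)" by (cases s)
  have c: "0 \<le> c" "c \<le> 1" and adm: "\<forall>s\<in>set L. admissible s" using Cons.prems by (auto simp: s admissible_def)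
  note ym [measurable] = Cons.prems(2)
  note [measurable] = walk_mean_measurable[OF f]
  define a where "a x = y x + w * (walk_mean L f x - walk_mean ((c, z, w) # L) f x)" for x
  define b where "b x = y x + w * (walk_mean L f (x + z) - walk_mean ((c, z, w) # L) f x)" for x
  have [measurable]: "a \<in> borel_measurable borel" "b \<in> borel_measurable borel"
    unfolding a_def b_def by measurable
  define y1 where "y1 x = (1 - of_real c) * a x + of_real c * b (x - z)" for x
  have y1m [measurable]: "y1 \<in> borel_measurable borel" unfolding y1_def by measurable
  have eq: "projected_transform (s # L) f y = projected_transform L f y1"
    by (simp add: s y1_def[abs_def] a_def b_def del: walk_mean.simps)
  have "(\<lambda>x. transform_moment p L f (x + z) (b ((x + z) - z))) \<in> borel_measurable borel"
    by (rule measurable_compose[of "\<lambda>x. x + z" _ borel "\<lambda>x. transform_moment p L f x (b (x - z))"])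
       (auto intro!: transform_moment_measurable)
  hence [measurable]: "(\<lambda>x. transform_moment p L f (x + z) (b x)) \<in> borel_measurable borel" by simp
  have tm [measurable]: "u \<in> borel_measurable borel \<Longrightarrow> (\<lambda>x. transform_moment p L f x (u x)) \<in> borel_measurable borel" for u
    by (rule transform_moment_measurable[OF f])
  have "(\<integral>\<^sup>+x. ennreal (norm (projected_transform (s # L) f y x) powr p) \<partial>lborel) \<le> (\<integral>\<^sup>+x. ennreal (transform_moment p L f x (y1 x)) \<partial>lborel)"
    unfolding eq using Cons.IH[OF adm y1m] by blast
  also have "\<dots> \<le> (\<integral>\<^sup>+x. ennreal (1 - c) * ennreal (transform_moment p L f x (a x)) + ennreal c * ennreal (transform_moment p L f x (b (x - z))) \<partial>lborel)"
  proof (intro nn_integral_mono)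
    fix x
    show "ennreal (transform_moment p L f x (y1 x)) \<le> ennreal (1 - c) * ennreal (transform_moment p L f x (a x)) + ennreal c * ennreal (transform_moment p L f x (b (x - z)))"
      using transform_moment_convex[OF p adm c, of f x "a x" "b (x - z)"] c transform_moment_nonneg[OF adm, of p f]
      by (simp add: y1_def ennreal_mult'[symmetric] ennreal_plus[symmetric] del: ennreal_plus)
  qed
  also have "\<dots> = ennreal (1 - c) * (\<integral>\<^sup>+x. ennreal (transform_moment p L f x (a x)) \<partial>lborel) + ennreal c * (\<integral>\<^sup>+x. ennreal (transform_moment p L f x (b (x - z))) \<partial>lborel)"
    by (subst nn_integral_add) (auto simp: nn_integral_cmult)
  also have "(\<integral>\<^sup>+x. ennreal (transform_moment p L f x (b (x - z))) \<partial>lborel) = (\<integral>\<^sup>+x. ennreal (transform_moment p L f (x + z) (b x)) \<partial>lborel)"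
    by (subst nn_integral_lborel_shift[of _ z, symmetric]) auto
  also have "ennreal (1 - c) * (\<integral>\<^sup>+x. ennreal (transform_moment p L f x (a x)) \<partial>lborel) + ennreal c * (\<integral>\<^sup>+x. ennreal (transform_moment p L f (x + z) (b x)) \<partial>lborel)
    = (\<integral>\<^sup>+x. ennreal (1 - c) * ennreal (transform_moment p L f x (a x)) + ennreal c * ennreal (transform_moment p L f (x + z) (b x)) \<partial>lborel)"
    by (subst nn_integral_add) (auto simp: nn_integral_cmult)
  also have "\<dots> = (\<integral>\<^sup>+x. ennreal (transform_moment p (s # L) f x (y x)) \<partial>lborel)"
    using c transform_moment_nonneg[OF adm, of p f]
    by (intro nn_integral_cong) (simp add: s a_def b_def ennreal_mult'[symmetric] ennreal_plus[symmetric] del: ennreal_plus walk_mean.simps)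
  finally show ?case using Cons.IH[OF adm y1m] eq by simp
qed auto

lemma projected_transform_Lp:
  fixes f :: "real ^ 'd \<Rightarrow> complex"
  assumes p: "1 < p" and f: "f \<in> Lp p" and L: "\<forall>s\<in>set L. admissible s"
  shows "projected_transform L f (\<lambda>x. 0) \<in> Lp p" "Lp_norm p (projected_transform L f (\<lambda>x. 0)) \<le> pstar_minus_1 p * Lp_norm p f"
proof -
  let ?C = "pstar_minus_1 p" and ?g = "projected_transform L f (\<lambda>x. 0)"
  note fm = Lp_measurable[OF f]
  have C: "0 < ?C" using pstar_pos[OF p] .
  have gm: "?g \<in> borel_measurable borel"
    and le: "(\<integral>\<^sup>+x. ennreal (norm (?g x) powr p) \<partial>lborel) \<le> (\<integral>\<^sup>+x. ennreal (transform_moment p L f x 0) \<partial>lborel)"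
    using projected_transform_integral_le[OF _ fm _ L, of p "\<lambda>x. 0"] p by auto
  obtain \<alpha> where \<alpha>: "0 < \<alpha>" "\<And>x y. norm y powr p - ?C powr p * norm x powr p \<le> \<alpha> * burk p x y"
    using burk_majorizes[OF p] by metis
  have pt: "transform_moment p L f x 0 \<le> ?C powr p * walk_moment p L f x" for x
    using transform_moment_le_burk[OF p \<alpha> L, of f x 0] burk_zero_le[OF p, of "walk_mean L f x"] \<alpha>(1)
      mult_nonneg_nonpos[of \<alpha> "burk p (walk_mean L f x) 0"] by simp
  have "(\<integral>\<^sup>+x. ennreal (norm (?g x) powr p) \<partial>lborel) \<le> (\<integral>\<^sup>+x. ennreal (?C powr p) * ennreal (walk_moment p L f x) \<partial>lborel)"
    by (rule order_trans[OF le], intro nn_integral_mono) (simp add: ennreal_mult'[symmetric] pt ennreal_leI)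
  also have "\<dots> = ennreal (?C powr p) * (\<integral>\<^sup>+x. ennreal (norm (f x) powr p) \<partial>lborel)"
    using walk_moment_measurable[OF fm] by (subst nn_integral_cmult) (auto simp: walk_moment_integral[OF fm L])
  also have "\<dots> = ennreal ((?C * Lp_norm p f) powr p)"
    using p C by (simp add: Lp_nn_integral[OF f] ennreal_mult'[symmetric] powr_mult)
  finally have "(\<integral>\<^sup>+x. ennreal (norm (?g x) powr p) \<partial>lborel) \<le> ennreal ((?C * Lp_norm p f) powr p)" .
  from LpI_bound[OF gm _ _ this] show "?g \<in> Lp p" "Lp_norm p ?g \<le> ?C * Lp_norm p f" using p C by auto
qed

section \<open>Fourier symbols of the walk and of its transforms\<close>

fun walk_symbol :: "(real ^ 'd) transform_step list \<Rightarrow> real ^ 'd \<Rightarrow> complex" where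
  "walk_symbol [] \<xi> = 1"
| "walk_symbol ((c, z, w) # L) \<xi> = ((1 - of_real c) + of_real c * exp (- \<i> * complex_of_real (\<xi> \<bullet> z))) * walk_symbol L \<xi>"

text \<open>The squared modulus of \<open>walk_symbol\<close>, written so that the loss of energy in
  each step is visible.\<close>

fun walk_energy :: "(real ^ 'd) transform_step list \<Rightarrow> real ^ 'd \<Rightarrow> real" where
  "walk_energy [] \<xi> = 1"
| "walk_energy ((c, z, w) # L) \<xi> = (1 - 2 * c * (1 - c) * (1 - cos (\<xi> \<bullet> z))) * walk_energy L \<xi>"

text \<open>The multiplier from f to its projected transform with initial value 0. The factor
  \<open>walk_energy L\<close> comes from the steps after the head: the increment is built from
  means over these steps and is afterwards projected along them, once with their symbol and once
  with its conjugate.\<close>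

fun transform_symbol :: "(real ^ 'd) transform_step list \<Rightarrow> real ^ 'd \<Rightarrow> complex" where
  "transform_symbol [] \<xi> = 0"
| "transform_symbol ((c, z, w) # L) \<xi> = transform_symbol L \<xi>
     + w * of_real (2 * c * (1 - c) * (1 - cos (\<xi> \<bullet> z))) * of_real (walk_energy L \<xi>)"

lemma step_symbol_norm:
  fixes c t :: real
  defines "q \<equiv> (1 - of_real c) + of_real c * exp (- \<i> * complex_of_real t)"
  shows "q * cnj q = of_real (1 - 2 * c * (1 - c) * (1 - cos t))"
proof -
  have q: "q = Complex (1 - c + c * cos t) (- c * sin t)"
    by (simp add: q_def complex_eq_iff exp_eq_polar Re_exp Im_exp)
  have "(1 - c + c * cos t)\<^sup>2 + (c * sin t)\<^sup>2 = 1 - 2 * c * (1 - c) * (1 - cos t)"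
    using sin_cos_squared_add[of t] by algebra
  thus ?thesis unfolding complex_mult_cnj q by simp
qed

lemma walk_energy_symbol: "of_real (walk_energy L \<xi>) = cnj (walk_symbol L \<xi>) * walk_symbol L \<xi>"
proof (induction L)
  case (Cons s L)
  obtain c z w where s: "s = (c, z, w)" by (cases s)
  show ?case
    unfolding s walk_energy.simps walk_symbol.simps of_real_mult Cons step_symbol_norm[symmetric] complex_cnj_mult
    by (simp only: mult_ac)
qed simp

lemma walk_mean_Lp:
  fixes f :: "real ^ 'd \<Rightarrow> complex"
  assumes p: "1 \<le> p" and f: "f \<in> Lp p"
  shows "walk_mean L f \<in> Lp p"
proof (induction L)
  case Nil
  have "walk_mean [] f = f" by auto
  thus ?case using f by simp
next
  case (Cons s L)
  obtain c z w where s: "s = (c, z, w)" by (cases s)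
  have "walk_mean (s # L) f = (\<lambda>x. (1 - of_real c) * walk_mean L f x + of_real c * walk_mean L f (x + z))"
    by (auto simp: s)
  thus ?case using p Cons by (simp add: Lp_add Lp_scale Lp_shift)
qed

lemma walk_mean_fourier:
  fixes f :: "real ^ 'd \<Rightarrow> complex"
  assumes f: "f \<in> Lp 2"
  shows "AE \<xi> in lborel. fourier_L2 (walk_mean L f) \<xi> = walk_symbol L \<xi> * fourier_L2 f \<xi>"
proof (induction L)
  case Nil
  have "walk_mean [] f = f" by auto
  thus ?case by simp
next
  case (Cons s L)
  obtain c z w where s: "s = (c, z, w)" by (cases s)
  have e: "walk_mean (s # L) f = (\<lambda>x. (1 - of_real c) * walk_mean L f x + of_real c * walk_mean L f (x + z))"
    by (auto simp: s)
  have m: "walk_mean L f \<in> Lp 2" by (rule walk_mean_Lp[OF _ f]) simp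
  show ?case unfolding e
    using fourier_L2_lin[OF m Lp_shift(1)[OF m, of z], of "1 - of_real c" "of_real c"] fourier_L2_shift[OF m, of z] Cons
    by eventually_elim (simp add: s algebra_simps)
qed

lemma projected_transform_fourier:
  fixes f y :: "real ^ 'd \<Rightarrow> complex"
  assumes f: "f \<in> Lp 2" and "y \<in> Lp 2"
  shows "projected_transform L f y \<in> Lp 2 \<and> (AE \<xi> in lborel. fourier_L2 (projected_transform L f y) \<xi> =
     transform_symbol L \<xi> * fourier_L2 f \<xi> + cnj (walk_symbol L \<xi>) * fourier_L2 y \<xi>)"
  using assms(2)
proof (induction L arbitrary: y)
  case (Cons s L)
  obtain c z w where s: "s = (c, z, w)" by (cases s)
  have 2: "(1::real) \<le> 2" "(0::real) < 2" by auto
  note y = Cons.prems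
  define m0 where "m0 = walk_mean L f"
  define m1 where "m1 = walk_mean ((c, z, w) # L) f"
  have m0: "m0 \<in> Lp 2" and m1: "m1 \<in> Lp 2" unfolding m0_def m1_def by (intro walk_mean_Lp 2 f)+
  \<comment> \<open>The terms with \<open>m0\<close> have total weight 1, so the step sends
    \<open>y\<close> to the backward average of y - w m1, plus w m0.\<close>
  define u where "u x = 1 * y x + (- w) * m1 x" for x
  have u: "u \<in> Lp 2" unfolding u_def by (intro Lp_add Lp_scale 2 y m1)
  define v where "v x = (1 - of_real c) * u x + of_real c * u (x + - z)" for x
  have us: "(\<lambda>x. u (x + - z)) \<in> Lp 2" by (rule Lp_shift[OF u])
  have v: "v \<in> Lp 2" unfolding v_def by (intro Lp_add Lp_scale 2 u us)
  define y1 where "y1 x = 1 * v x + w * m0 x" for x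
  have y1: "y1 \<in> Lp 2" unfolding y1_def by (intro Lp_add Lp_scale 2 v m0)
  have eq: "projected_transform (s # L) f y = projected_transform L f y1"
    unfolding s projected_transform.simps m0_def[symmetric] m1_def[symmetric]
    by (rule arg_cong[of _ _ "projected_transform L f"]) (auto simp: y1_def v_def u_def algebra_simps)
  let ?q = "\<lambda>\<xi>. (1 - of_real c) + of_real c * exp (- \<i> * complex_of_real (\<xi> \<bullet> z))"
  have cq: "cnj (?q \<xi>) = (1 - of_real c) + of_real c * exp (- \<i> * complex_of_real (\<xi> \<bullet> (- z)))" for \<xi>
    by (simp add: exp_cnj)
  have "AE \<xi> in lborel. fourier_L2 y1 \<xi> = cnj (?q \<xi>) * fourier_L2 y \<xi> + w * of_real (2 * c * (1 - c) * (1 - cos (\<xi> \<bullet> z))) * walk_symbol L \<xi> * fourier_L2 f \<xi>"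
    using fourier_L2_lin[OF v m0, of 1 w, folded y1_def] fourier_L2_lin[OF u us, of "1 - of_real c" "of_real c", folded v_def]
      fourier_L2_shift[OF u, of "- z"] fourier_L2_lin[OF y m1, of 1 "- w", folded u_def]
      walk_mean_fourier[OF f, of L, folded m0_def] walk_mean_fourier[OF f, of "(c, z, w) # L", folded m1_def]
  proof eventually_elim
    case (elim \<xi>)
    have "fourier_L2 y1 \<xi> = cnj (?q \<xi>) * (fourier_L2 y \<xi> - w * (?q \<xi> * walk_symbol L \<xi> * fourier_L2 f \<xi>)) + w * (walk_symbol L \<xi> * fourier_L2 f \<xi>)"
      unfolding cq elim(1) elim(2) elim(3) elim(4) elim(5) elim(6) walk_symbol.simps by algebra
    \<comment> \<open>The forward factor \<open>?q\<close> inside \<open>m1\<close> meets the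
      conjugate factor of the backward average; together with the term from \<open>m0\<close> this
      leaves 1 - |q|^2, the energy of the step.\<close>
    also have "\<dots> = cnj (?q \<xi>) * fourier_L2 y \<xi> + w * (1 - ?q \<xi> * cnj (?q \<xi>)) * walk_symbol L \<xi> * fourier_L2 f \<xi>"
      by algebra
    also have "1 - ?q \<xi> * cnj (?q \<xi>) = of_real (2 * c * (1 - c) * (1 - cos (\<xi> \<bullet> z)))"
      unfolding step_symbol_norm by simp
    finally show ?case .
  qed
  moreover have "AE \<xi> in lborel. fourier_L2 (projected_transform L f y1) \<xi> = transform_symbol L \<xi> * fourier_L2 f \<xi> + cnj (walk_symbol L \<xi>) * fourier_L2 y1 \<xi>"
    using Cons.IH[OF y1] by blast
  ultimately have "AE \<xi> in lborel. fourier_L2 (projected_transform (s # L) f y) \<xi> =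
     transform_symbol (s # L) \<xi> * fourier_L2 f \<xi> + cnj (walk_symbol (s # L) \<xi>) * fourier_L2 y \<xi>"
  proof eventually_elim
    case (elim \<xi>)
    have "fourier_L2 (projected_transform (s # L) f y) \<xi> = transform_symbol L \<xi> * fourier_L2 f \<xi> +
       cnj (walk_symbol L \<xi>) * (cnj (?q \<xi>) * fourier_L2 y \<xi> + w * of_real (2 * c * (1 - c) * (1 - cos (\<xi> \<bullet> z))) * walk_symbol L \<xi> * fourier_L2 f \<xi>)"
      unfolding eq elim(2) elim(1) ..
    also have "\<dots> = transform_symbol (s # L) \<xi> * fourier_L2 f \<xi> + cnj (walk_symbol (s # L) \<xi>) * fourier_L2 y \<xi>"
      unfolding s transform_symbol.simps walk_symbol.simps walk_energy_symbol complex_cnj_mult by algebra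
    finally show ?case .
  qed
  thus ?case using Cons.IH[OF y1] eq by simp
qed auto

section \<open>Multipliers obtained as limits of martingale transforms\<close>

text \<open>The existence of some h, in place of a value of \<open>multiplier_op\<close>, keeps
  choices of representatives out of the limit arguments. The bound by 1 provides the domination in
  them.\<close>

definition Lp_multiplier :: "real \<Rightarrow> (real ^ 'd \<Rightarrow> complex) \<Rightarrow> bool" where
  "Lp_multiplier p m \<longleftrightarrow> (AE \<xi> in lborel. norm (m \<xi>) \<le> 1) \<and>
     (\<forall>f \<in> Lp 2 \<inter> Lp p. \<exists>h \<in> Lp 2 \<inter> Lp p.
        (AE \<xi> in lborel. fourier_L2 h \<xi> = m \<xi> * fourier_L2 f \<xi>) \<and>
        Lp_norm p h \<le> pstar_minus_1 p * Lp_norm p f)"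

text \<open>The transforms converge in L^2, dominated by that of f, and Plancherel's identity
  carries the convergence back to the functions h n. A subsequence converges almost everywhere,
  where Fatou's lemma keeps the L^p bound.\<close>

lemma Lp_multiplier_limit:
  fixes m :: "nat \<Rightarrow> real ^ 'd \<Rightarrow> complex"
  assumes p: "1 < p" and good: "\<And>n. Lp_multiplier p (m n)" and lim: "AE \<xi> in lborel. (\<lambda>n. m n \<xi>) \<longlonglongrightarrow> M \<xi>"
  shows "Lp_multiplier p M"
  unfolding Lp_multiplier_def
proof (intro conjI ballI)
  have p1: "1 \<le> p" "0 < p" using p by auto
  have two: "(1::real) \<le> 2" "(0::real) < 2" by auto
  have bd: "AE \<xi> in lborel. \<forall>n. norm (m n \<xi>) \<le> 1" using good by (simp add: Lp_multiplier_def AE_all_countable)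
  with lim show "AE \<xi> in lborel. norm (M \<xi>) \<le> 1"
    by eventually_elim (rule LIMSEQ_le_const2[OF tendsto_norm], auto)
  fix f :: "real ^ 'd \<Rightarrow> complex" assume "f \<in> Lp 2 \<inter> Lp p"
  hence f: "f \<in> Lp 2" "f \<in> Lp p" by auto
  have "\<exists>h. h \<in> Lp 2 \<and> h \<in> Lp p \<and> (AE \<xi> in lborel. fourier_L2 h \<xi> = m n \<xi> * fourier_L2 f \<xi>) \<and>
        Lp_norm p h \<le> pstar_minus_1 p * Lp_norm p f" for n
    using good[of n] f unfolding Lp_multiplier_def by blast
  then obtain h where h: "\<And>n. h n \<in> Lp 2" "\<And>n. h n \<in> Lp p" 
    "\<And>n. AE \<xi> in lborel. fourier_L2 (h n) \<xi> = m n \<xi> * fourier_L2 f \<xi>" "\<And>n. Lp_norm p (h n) \<le> pstar_minus_1 p * Lp_norm p f"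
    by metis
  note Fh = fourier_L2(1)[OF h(1)] and Ff = fourier_L2(1)[OF f(1)]
  note [measurable] = Lp_measurable[OF Fh] Lp_measurable[OF Ff]
  \<comment> \<open>A pointwise limit of measurable functions is a measurable representative of the
    product of \<open>M\<close> with the transform of f.\<close>
  define G where "G \<xi> = lim (\<lambda>n. fourier_L2 (h n) \<xi>)" for \<xi>
  have Gm [measurable]: "G \<in> borel_measurable borel" unfolding G_def by measurable
  have hm: "AE \<xi> in lborel. \<forall>n. fourier_L2 (h n) \<xi> = m n \<xi> * fourier_L2 f \<xi>" using h(3) by (simp add: AE_all_countable)
  have conv: "AE \<xi> in lborel. (\<lambda>n. fourier_L2 (h n) \<xi>) \<longlonglongrightarrow> M \<xi> * fourier_L2 f \<xi>"
    using hm lim by eventually_elim (auto intro!: tendsto_intros)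
  have GM: "AE \<xi> in lborel. G \<xi> = M \<xi> * fourier_L2 f \<xi>"
    using conv by eventually_elim (simp add: G_def limI)
  have T: "Lp_tendsto 2 (\<lambda>n. fourier_L2 (h n)) G"
  proof (rule Lp_dominated_convergence[OF two(1) _ Gm Ff])
    show "AE \<xi> in lborel. norm (fourier_L2 (h n) \<xi>) \<le> norm (fourier_L2 f \<xi>)" for n
      using hm bd by eventually_elim (auto simp: norm_mult mult_left_le_one_le)
    show "AE \<xi> in lborel. (\<lambda>n. fourier_L2 (h n) \<xi>) \<longlonglongrightarrow> G \<xi>"
      using conv GM by eventually_elim simp
  qed simp
  let ?K = "gauss_mass TYPE('d)"
  have K: "?K > 0" by (rule gauss_mass_pos)
  have "Lp_Cauchy 2 h"
    unfolding Lp_Cauchy_def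
  proof (intro allI impI)
    fix e :: real assume "e > 0"
    hence "?K * e > 0" using K by simp
    then obtain N where "\<And>i j. i \<ge> N \<Longrightarrow> j \<ge> N \<Longrightarrow> Lp_norm 2 (\<lambda>\<xi>. fourier_L2 (h i) \<xi> - fourier_L2 (h j) \<xi>) < ?K * e"
      using Lp_tendsto_Cauchy[OF two(1) T] unfolding Lp_Cauchy_def by blast
    thus "\<exists>N. \<forall>i\<ge>N. \<forall>j\<ge>N. Lp_norm 2 (\<lambda>x. h i x - h j x) < e"
      using K unfolding fourier_L2_diff_norm[OF h(1) h(1)] by (intro exI[of _ N]) auto
  qed
  then obtain H where H: "Lp_tendsto 2 h H" using Lp_complete[OF two(1), of h] h(1) by blast
  note HL = Lp_tendstoD[OF H]
  have "Lp_tendsto 2 (\<lambda>n. fourier_L2 (h n)) (fourier_L2 H)"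
  proof (rule Lp_tendstoI[OF Fh fourier_L2(1)[OF HL(2)]])
    show "(\<lambda>n. Lp_norm 2 (\<lambda>x. fourier_L2 (h n) x - fourier_L2 H x)) \<longlonglongrightarrow> 0"
      unfolding fourier_L2_diff_norm[OF h(1) HL(2)] using tendsto_mult_left[OF HL(3), of ?K] by simp
  qed
  from Lp_tendsto_unique[OF two(1) this T] GM
  have FH: "AE \<xi> in lborel. fourier_L2 H \<xi> = M \<xi> * fourier_L2 f \<xi>" by eventually_elim simp
  obtain r where r: "strict_mono r" "AE x in lborel. (\<lambda>n. h (r n) x) \<longlonglongrightarrow> H x"
    by (rule Lp_tendsto_AE_subseq[OF two(2) H]) blast
  have "H \<in> Lp p" "Lp_norm p H \<le> pstar_minus_1 p * Lp_norm p f"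
    using Lp_Fatou[of "\<lambda>n. h (r n)" p "pstar_minus_1 p * Lp_norm p f" H] h(2,4) p1 r(2) Lp_measurable[OF HL(2)] pstar_pos[OF p]
    by auto
  thus "\<exists>h\<in>Lp 2 \<inter> Lp p. (AE \<xi> in lborel. fourier_L2 h \<xi> = M \<xi> * fourier_L2 f \<xi>) \<and> Lp_norm p h \<le> pstar_minus_1 p * Lp_norm p f"
    using FH HL(2) by blast
qed

text \<open>The energies lost in the steps telescope to 1 minus the energy of the whole list, and
  coefficients of modulus at most 1 cannot enlarge their sum.\<close>

lemma walk_energy_bounds: "\<forall>s\<in>set L. admissible s \<Longrightarrow> 0 \<le> walk_energy L \<xi> \<and> walk_energy L \<xi> \<le> 1 \<and> norm (transform_symbol L \<xi>) \<le> 1 - walk_energy L \<xi>"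
proof (induction L)
  case (Cons s L)
  obtain c z w where s: "s = (c, z, w)" by (cases s)
  have adm: "0 \<le> c" "c \<le> 1" "norm w \<le> 1" using Cons.prems by (auto simp: s admissible_def)
  define b where "b = 2 * c * (1 - c) * (1 - cos (\<xi> \<bullet> z))"
  define E where "E = walk_energy L \<xi>"
  have IH: "0 \<le> E" "E \<le> 1" "norm (transform_symbol L \<xi>) \<le> 1 - E" using Cons by (auto simp: E_def)
  have b0: "0 \<le> b" using adm by (simp add: b_def)
  \<comment> \<open>From 4 c (1 - c) <= 1 and 1 - cos <= 2 a single step loses at most the whole
    energy.\<close>
  have "4 * (c * (1 - c)) \<le> 1" using sum_squares_ge_zero[of "2 * c - 1" 0] by (simp add: algebra_simps)
  hence "(2 * c * (1 - c)) * (1 - cos (\<xi> \<bullet> z)) \<le> (1/2) * 2" using adm cos_ge_minus_one[of "\<xi> \<bullet> z"] by (intro mult_mono) auto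
  hence b1: "b \<le> 1" by (simp add: b_def)
  have e: "walk_energy (s # L) \<xi> = (1 - b) * E" "transform_symbol (s # L) \<xi> = transform_symbol L \<xi> + w * of_real b * of_real E"
    by (simp_all add: s b_def E_def)
  have "norm (w * of_real b * of_real E) \<le> 1 * b * E"
    using mult_right_mono[OF mult_right_mono[OF adm(3) b0] IH(1)] b0 IH(1) by (simp add: norm_mult)
  hence "norm (transform_symbol (s # L) \<xi>) \<le> (1 - E) + b * E"
    unfolding e using IH(3) norm_triangle_ineq[of "transform_symbol L \<xi>" "w * of_real b * of_real E"] by simp
  moreover have "(1 - b) * E \<le> 1 * 1" using b0 b1 IH by (intro mult_mono) auto
  moreover have "0 \<le> (1 - b) * E" using b1 IH by simp
  ultimately show ?case unfolding e using b0 b1 IH by (simp add: algebra_simps)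
qed simp

lemma Lp_multiplier_transform:
  fixes L :: "(real ^ 'd) transform_step list"
  assumes p: "1 < p" and L: "\<forall>s\<in>set L. admissible s"
  shows "Lp_multiplier p (transform_symbol L)"
  unfolding Lp_multiplier_def
proof (intro conjI ballI)
  show "AE \<xi> in lborel. norm (transform_symbol L \<xi>) \<le> 1"
    using walk_energy_bounds[OF L] by (intro AE_I2) (smt (verit))
  fix f :: "real ^ 'd \<Rightarrow> complex" assume "f \<in> Lp 2 \<inter> Lp p"
  hence f: "f \<in> Lp 2" "f \<in> Lp p" by auto
  have z: "(\<lambda>x::real^'d. 0) \<in> Lp 2" by (rule Lp_zero) simp
  have "AE \<xi> in lborel. fourier_L2 (\<lambda>x::real^'d. 0) \<xi> = 0" using fourier_L2_lin[OF z z, of 0 0] by simp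
  moreover have "AE \<xi> in lborel. fourier_L2 (projected_transform L f (\<lambda>x. 0)) \<xi> = transform_symbol L \<xi> * fourier_L2 f \<xi> + cnj (walk_symbol L \<xi>) * fourier_L2 (\<lambda>x. 0) \<xi>"
    using projected_transform_fourier[OF f(1) z] by blast
  ultimately have "AE \<xi> in lborel. fourier_L2 (projected_transform L f (\<lambda>x. 0)) \<xi> = transform_symbol L \<xi> * fourier_L2 f \<xi>"
    by eventually_elim simp
  thus "\<exists>h\<in>Lp 2 \<inter> Lp p. (AE \<xi> in lborel. fourier_L2 h \<xi> = transform_symbol L \<xi> * fourier_L2 f \<xi>) \<and> Lp_norm p h \<le> pstar_minus_1 p * Lp_norm p f"
    using projected_transform_fourier[OF f(1) z, of L] projected_transform_Lp[OF p f(2) L] by blast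
qed

section \<open>Cyclic repetition and measures with finitely many atoms\<close>

lemma walk_energy_append: "walk_energy (L1 @ L2) \<xi> = walk_energy L1 \<xi> * walk_energy L2 \<xi>"
  by (induction L1 \<xi> rule: walk_energy.induct) auto

text \<open>The second list is walked later, so its energy discounts the contribution of the first;
  iterating this is what creates the geometric series.\<close>

lemma transform_symbol_append:
  "transform_symbol (L1 @ L2) \<xi> = transform_symbol L2 \<xi> + of_real (walk_energy L2 \<xi>) * transform_symbol L1 \<xi>"
  by (induction L1 \<xi> rule: transform_symbol.induct) (auto simp: walk_energy_append algebra_simps)

lemma transform_symbol_replicate:
  "transform_symbol (concat (replicate n L)) \<xi> = transform_symbol L \<xi> * (\<Sum>k<n. of_real (walk_energy L \<xi>) ^ k)"
proof -
  have "walk_energy (concat (replicate n L)) \<xi> = walk_energy L \<xi> ^ n" for n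
    by (induction n) (auto simp: walk_energy_append)
  thus ?thesis by (induction n) (auto simp: transform_symbol_append algebra_simps)
qed

lemma Lp_multiplier_geometric:
  fixes L :: "(real ^ 'd) transform_step list"
  assumes p: "1 < p" and L: "\<forall>s\<in>set L. admissible s"
  shows "Lp_multiplier p (\<lambda>\<xi>. transform_symbol L \<xi> / of_real (1 - walk_energy L \<xi>))"
proof (rule Lp_multiplier_limit[OF p])
  show "Lp_multiplier p (transform_symbol (concat (replicate n L)))" for n
    by (rule Lp_multiplier_transform[OF p]) (use L in auto)
  show "AE \<xi> in lborel. (\<lambda>n. transform_symbol (concat (replicate n L)) \<xi>) \<longlonglongrightarrow> transform_symbol L \<xi> / of_real (1 - walk_energy L \<xi>)"
  proof (intro AE_I2)
    fix \<xi> :: "real ^ 'd"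
    note b = walk_energy_bounds[OF L, of \<xi>]
    show "(\<lambda>n. transform_symbol (concat (replicate n L)) \<xi>) \<longlonglongrightarrow> transform_symbol L \<xi> / of_real (1 - walk_energy L \<xi>)"
    proof (cases "walk_energy L \<xi> = 1")
      \<comment> \<open>Energy 1 forces the symbol of the cycle to be 0, so the limit agrees with
        the convention that a quotient by 0 is 0.\<close>
      case True
      hence "transform_symbol L \<xi> = 0" using b by simp
      thus ?thesis by (simp add: transform_symbol_replicate)
    next
      case False
      hence "norm (complex_of_real (walk_energy L \<xi>)) < 1" using b by simp
      from geometric_sums[OF this] have "(\<lambda>n. \<Sum>k<n. complex_of_real (walk_energy L \<xi>) ^ k) \<longlonglongrightarrow> 1 / (1 - of_real (walk_energy L \<xi>))"
        by (simp add: sums_def)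
      from tendsto_mult_left[OF this, of "transform_symbol L \<xi>"] show ?thesis by (simp add: transform_symbol_replicate)
    qed
  qed
qed

text \<open>The triples of a walk are reused with another meaning: a is the mass of an atom at z,
  which may exceed 1, and w is the value of the coefficient function at that atom.\<close>

definition atom_num :: "(real ^ 'd) transform_step list \<Rightarrow> real ^ 'd \<Rightarrow> complex" where
  "atom_num L \<xi> = (\<Sum>(a, z, w)\<leftarrow>L. of_real (a * (1 - cos (\<xi> \<bullet> z))) * w)"

definition atom_den :: "(real ^ 'd) transform_step list \<Rightarrow> real ^ 'd \<Rightarrow> real" where
  "atom_den L \<xi> = (\<Sum>(a, z, w)\<leftarrow>L. a * (1 - cos (\<xi> \<bullet> z)))"

text \<open>The jump probability \<open>c \<le> 1/2\<close> of a small step solves \<open>2c(1 - c) = ae\<close>.\<close>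

definition small_step :: "real \<Rightarrow> 'v transform_step \<Rightarrow> 'v transform_step" where
  "small_step e = (\<lambda>(a, z, w). ((1 - sqrt (1 - 2 * a * e)) / 2, z, w))"

text \<open>The choice 2c(1 - c) = a e makes the energy loss of a step exactly e a (1 - cos), so no
  expansion of c itself is required. The last part covers frequencies where the denominator vanishes
  and first-order limits do not determine the quotient.\<close>

lemma small_step_expansions:
  fixes L :: "(real ^ 'd) transform_step list"
  assumes e: "\<And>n. e n > 0" "e \<longlonglongrightarrow> 0" and ae: "\<And>n a z w. (a, z, w) \<in> set L \<Longrightarrow> 2 * a * e n \<le> 1"
  shows "(\<lambda>n. walk_energy (map (small_step (e n)) L) \<xi>) \<longlonglongrightarrow> 1 \<and>
    (\<lambda>n. (1 - walk_energy (map (small_step (e n)) L) \<xi>) / e n) \<longlonglongrightarrow> atom_den L \<xi> \<and>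
    (\<lambda>n. transform_symbol (map (small_step (e n)) L) \<xi> / of_real (e n)) \<longlonglongrightarrow> atom_num L \<xi> \<and>
    ((\<forall>(a, z, w)\<in>set L. a * (1 - cos (\<xi> \<bullet> z)) = 0) \<longrightarrow> (\<forall>n. transform_symbol (map (small_step (e n)) L) \<xi> = 0))"
  using ae
proof (induction L)
  case Nil
  show ?case by (simp add: atom_den_def atom_num_def)
next
  case (Cons s L)
  obtain a z w where s: "s = (a, z, w)" by (cases s)
  define b where "b = a * (1 - cos (\<xi> \<bullet> z))"
  define E where "E n = walk_energy (map (small_step (e n)) L) \<xi>" for n
  define t where "t n = transform_symbol (map (small_step (e n)) L) \<xi>" for n
  have ae': "2 * a * e n \<le> 1" if "(a, z, w) \<in> set L" for a z w n using Cons.prems[of a z w n] that by simp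
  have IH: "E \<longlonglongrightarrow> 1" "(\<lambda>n. (1 - E n) / e n) \<longlonglongrightarrow> atom_den L \<xi>" "(\<lambda>n. t n / of_real (e n)) \<longlonglongrightarrow> atom_num L \<xi>"
    "(\<forall>(a, z, w)\<in>set L. a * (1 - cos (\<xi> \<bullet> z)) = 0) \<Longrightarrow> t n = 0" for n
    using Cons.IH[OF ae'] unfolding E_def t_def by auto
  have sq: "2 * ((1 - sqrt (1 - 2 * a * e n)) / 2) * (1 - (1 - sqrt (1 - 2 * a * e n)) / 2) * (1 - cos (\<xi> \<bullet> z)) = e n * b" for n
  proof -
    have "(sqrt (1 - 2 * a * e n))\<^sup>2 = 1 - 2 * a * e n" using Cons.prems[of a z w n] by (simp add: s)
    thus ?thesis unfolding b_def by (simp add: field_simps power2_eq_square)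
  qed
  have rE: "walk_energy (map (small_step (e n)) (s # L)) \<xi> = (1 - e n * b) * E n" for n
    using sq[of n] by (simp add: s small_step_def E_def)
  have rt: "transform_symbol (map (small_step (e n)) (s # L)) \<xi> = t n + w * of_real (e n * b) * of_real (E n)" for n
    unfolding sq[of n, symmetric] by (simp add: s small_step_def E_def t_def)
  have "(\<lambda>n. (1 - e n * b) * E n) \<longlonglongrightarrow> (1 - 0 * b) * 1" by (intro tendsto_intros e IH)
  moreover have "(\<lambda>n. (1 - E n) / e n + b * E n) \<longlonglongrightarrow> atom_den L \<xi> + b * 1" by (intro tendsto_intros IH)
  moreover have "(\<lambda>n. t n / of_real (e n) + w * of_real b * of_real (E n)) \<longlonglongrightarrow> atom_num L \<xi> + w * of_real b * of_real 1"
    by (intro tendsto_intros IH)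
  moreover have "(1 - E n) / e n + b * E n = (1 - (1 - e n * b) * E n) / e n" for n
    using e(1)[of n] by (simp add: field_simps)
  moreover have "t n / of_real (e n) + w * of_real b * of_real (E n) = (t n + w * of_real (e n * b) * of_real (E n)) / of_real (e n)" for n
    using e(1)[of n] by (simp add: field_simps)
  ultimately show ?case
    unfolding rE rt using IH(4)
    by (auto simp: atom_den_def atom_num_def s b_def add.commute mult.commute)
qed

lemma Lp_multiplier_atomic:
  fixes L :: "(real ^ 'd) transform_step list"
  assumes p: "1 < p" and L: "\<And>a z w. (a, z, w) \<in> set L \<Longrightarrow> 0 \<le> a \<and> norm w \<le> 1"
  shows "Lp_multiplier p (\<lambda>\<xi>. atom_num L \<xi> / of_real (atom_den L \<xi>))"
proof -
  define A where "A = sum_list (map fst L)"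
  have aA: "a \<le> A" "0 \<le> a" if "(a, z, w) \<in> set L" for a z w
  proof -
    show "0 \<le> a" using L that by blast
    have "fst (a, z, w) \<in> set (map fst L)" using that by force
    thus "a \<le> A" unfolding A_def by (intro member_le_sum_list) (use L in auto)
  qed
  have A0: "0 \<le> A" unfolding A_def by (rule sum_list_nonneg) (use L in auto)
  \<comment> \<open>The total mass A bounds every single mass, so 2 a e <= 1 holds for all n and the
    square roots have nonnegative arguments.\<close>
  define e where "e n = 1 / (2 * A + real (Suc n))" for n
  have e: "e n > 0" for n using A0 by (simp add: e_def add_nonneg_pos)
  have e0: "e \<longlonglongrightarrow> 0"
    unfolding e_def by (intro tendsto_divide_0[OF tendsto_const] filterlim_at_top_imp_at_infinity
      filterlim_tendsto_add_at_top[OF tendsto_const] filterlim_compose[OF filterlim_real_sequentially filterlim_Suc])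
  have ae: "2 * a * e n \<le> 1" if "(a, z, w) \<in> set L" for a z w n
    using aA[OF that] A0 by (simp add: e_def divide_simps)
  note ex = small_step_expansions[of e L, OF e e0 ae]
  have adm: "\<forall>s\<in>set (map (small_step (e n)) L). admissible s" for n
  proof
    fix s assume "s \<in> set (map (small_step (e n)) L)"
    then obtain a z w where s: "s = small_step (e n) (a, z, w)" "(a, z, w) \<in> set L" by auto
    have "0 \<le> 2 * a * e n" using aA(2)[OF s(2)] e[of n] by simp
    hence "0 \<le> sqrt (1 - 2 * a * e n)" "sqrt (1 - 2 * a * e n) \<le> 1" using ae[OF s(2), of n] by auto
    moreover have "- 1 \<le> sqrt (1 - 2 * a * e n)" using calculation by linarith
    ultimately show "admissible s" using L[OF s(2)] by (simp add: s(1) small_step_def admissible_def)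
  qed
  show ?thesis
  proof (rule Lp_multiplier_limit[OF p Lp_multiplier_geometric[OF p adm]], intro AE_I2)
    fix \<xi> :: "real ^ 'd"
    note x = ex[where \<xi> = \<xi>]
    show "(\<lambda>n. transform_symbol (map (small_step (e n)) L) \<xi> / of_real (1 - walk_energy (map (small_step (e n)) L) \<xi>))
      \<longlonglongrightarrow> atom_num L \<xi> / of_real (atom_den L \<xi>)"
    proof (cases "atom_den L \<xi> = 0")
      case True
      \<comment> \<open>A vanishing sum of nonnegative terms makes every atom contribute 0; the
        symbols are then identically 0, as is the quotient by 0 on the right.\<close>
      have "\<forall>x\<in>set (map (\<lambda>(a, z, w). a * (1 - cos (\<xi> \<bullet> z))) L). x = 0"
        using True L unfolding atom_den_def by (subst (asm) sum_list_nonneg_eq_0_iff) auto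
      hence "\<forall>(a, z, w)\<in>set L. a * (1 - cos (\<xi> \<bullet> z)) = 0" by auto
      thus ?thesis using x True by simp
    next
      case False
      have "(\<lambda>n. (transform_symbol (map (small_step (e n)) L) \<xi> / of_real (e n)) / of_real ((1 - walk_energy (map (small_step (e n)) L) \<xi>) / e n))
        \<longlonglongrightarrow> atom_num L \<xi> / of_real (atom_den L \<xi>)"
        using x False by (intro tendsto_divide tendsto_of_real) auto
      moreover have "(a / of_real (e n)) / of_real (b / e n) = a / complex_of_real b" for a b n
        using e[of n] by simp
      ultimately show ?thesis by (simp only:)
    qed
  qed
qed

section \<open>Levy multipliers\<close>

lemma atom_den_append: "atom_den (L1 @ L2) \<xi> = atom_den L1 \<xi> + atom_den L2 \<xi>"
  and atom_num_append: "atom_num (L1 @ L2) \<xi> = atom_num L1 \<xi> + atom_num L2 \<xi>"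
  by (simp_all add: atom_den_def atom_num_def)

lemma one_minus_cos_bounds:
  fixes u :: real
  shows "0 \<le> 1 - cos u" "1 - cos u \<le> 2" "1 - cos u \<le> u\<^sup>2 / 2"
proof -
  have "1 - cos u = 2 * (sin (u/2))\<^sup>2" using cos_double_sin[of "u/2"] by simp
  moreover have "(sin (u/2))\<^sup>2 \<le> (u/2)\<^sup>2" using iffD1[OF abs_le_square_iff abs_sin_x_le_abs_x[of "u/2"]] .
  ultimately show "1 - cos u \<le> u\<^sup>2 / 2" by (simp add: power_divide)
  show "0 \<le> 1 - cos u" by simp
  show "1 - cos u \<le> 2" using cos_ge_minus_one[of u] by linarith
qed

text \<open>By 1 - cos u = 2 sin(u/2)^2 this is continuity of \<open>sinc\<close> at 0. The argument
  t n varies with n because the directions are themselves replaced by simple functions.\<close>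

lemma scaled_one_minus_cos_tendsto:
  fixes t :: "nat \<Rightarrow> real"
  assumes "t \<longlonglongrightarrow> T"
  shows "(\<lambda>n. (real (Suc n))\<^sup>2 * (1 - cos (t n / real (Suc n)))) \<longlonglongrightarrow> T\<^sup>2 / 2"
proof -
  have 0: "(\<lambda>n. t n * (1/2 * (1 / real (Suc n)))) \<longlonglongrightarrow> T * (1/2 * 0)"
    by (intro tendsto_intros assms LIMSEQ_Suc[OF lim_1_over_n])
  have "isCont sinc 0" by (rule isCont_sinc)
  hence "(\<lambda>n. sinc (t n * (1/2 * (1 / real (Suc n))))) \<longlonglongrightarrow> sinc 0"
    using 0 by (intro isCont_tendsto_compose[of 0 sinc]) auto
  hence "(\<lambda>n. (t n)\<^sup>2 / 2 * (sinc (t n * (1/2 * (1 / real (Suc n)))))\<^sup>2) \<longlonglongrightarrow> T\<^sup>2 / 2 * (sinc 0)\<^sup>2"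
    by (intro tendsto_intros assms) auto
  moreover have "(t n)\<^sup>2 / 2 * (sinc (t n * (1/2 * (1 / real (Suc n)))))\<^sup>2 = (real (Suc n))\<^sup>2 * (1 - cos (t n / real (Suc n)))" for n
  proof -
    define N where "N = real (Suc n)"
    have N: "N > 0" by (simp add: N_def)
    define u where "u = t n * (1/2 * (1 / N))"
    have tu: "t n = 2 * N * u" using N by (simp add: u_def)
    have c: "1 - cos (t n / N) = 2 * (sin u)\<^sup>2" using cos_double_sin[of u] N by (simp add: tu mult.commute)
    have s: "(sin u)\<^sup>2 = u\<^sup>2 * (sinc u)\<^sup>2" by (cases "u = 0") (simp_all add: power_divide)
    have g: "N\<^sup>2 * (2 * (u\<^sup>2 * S)) = (2 * N * u)\<^sup>2 / 2 * S" for S :: real by (simp add: power_mult_distrib)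
    have "N\<^sup>2 * (1 - cos (t n / N)) = (t n)\<^sup>2 / 2 * (sinc u)\<^sup>2"
      unfolding c s using g[of "(sinc u)\<^sup>2"] by (simp only: tu)
    thus ?thesis unfolding u_def N_def by simp
  qed
  ultimately show ?thesis by simp
qed

text \<open>The atoms are those of the image of the measure under s, scaled by r; the coefficient at
  v is the mean of k over the level set, hence of modulus at most 1. The value 0 is left out, since
  1 - cos vanishes there and its level set may have infinite measure.\<close>

lemma atoms_of_simple_function:
  fixes s :: "'a \<Rightarrow> real ^ 'd" and k :: "'a \<Rightarrow> complex"
  assumes s: "simple_function M s" and fin: "emeasure M {x \<in> space M. s x \<noteq> 0} < \<infinity>"
    and k: "k \<in> borel_measurable M" and kb: "\<And>x. x \<in> space M \<Longrightarrow> norm (k x) \<le> 1" and r: "0 \<le> r"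
  obtains L where "\<And>a z w. (a, z, w) \<in> set L \<Longrightarrow> 0 \<le> a \<and> norm w \<le> 1"
    "\<And>\<xi>. atom_den L \<xi> = r * (LINT x|M. 1 - cos (\<xi> \<bullet> s x))"
    "\<And>\<xi>. atom_num L \<xi> = of_real r * (LINT x|M. of_real (1 - cos (\<xi> \<bullet> s x)) * k x)"
proof -
  note [measurable] = k
  define R where "R = s ` space M - {0}"
  have fR: "finite R" using s by (auto simp: R_def simple_function_def)
  define A where "A v = s -` {v} \<inter> space M" for v
  have Am [measurable]: "A v \<in> sets M" for v using s by (auto simp: A_def intro: simple_functionD)
  have S: "{x \<in> space M. s x \<noteq> 0} \<in> sets M"
  proof -
    have "{x \<in> space M. s x \<noteq> 0} = (\<Union>v\<in>R. A v)" by (auto simp: R_def A_def)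
    thus ?thesis using fR by auto
  qed
  have Af: "emeasure M (A v) < \<infinity>" if "v \<in> R" for v
  proof -
    have "emeasure M (A v) \<le> emeasure M {x \<in> space M. s x \<noteq> 0}"
      using that by (intro emeasure_mono S) (auto simp: A_def R_def)
    thus ?thesis using fin by (rule order_le_less_trans)
  qed
  define a where "a v = measure M (A v)" for v
  define J where "J v = (LINT x|M. indicat_real (A v) x *\<^sub>R k x)" for v
  have ki: "integrable M (\<lambda>x. indicat_real (A v) x *\<^sub>R k x)" if "v \<in> R" for v
    by (rule Bochner_Integration.integrable_bound[OF integrable_real_indicator[OF Am Af[OF that]]])
       (use kb in \<open>auto simp: indicator_def intro!: AE_I2\<close>)
  have Jb: "norm (J v) \<le> a v" if "v \<in> R" for v
  proof -
    have "norm (J v) \<le> (LINT x|M. norm (indicat_real (A v) x *\<^sub>R k x))" unfolding J_def by (rule integral_norm_bound)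
    also have "\<dots> \<le> (LINT x|M. indicat_real (A v) x)"
      by (rule integral_mono[OF integrable_norm[OF ki[OF that]] integrable_real_indicator[OF Am Af[OF that]]])
         (use kb in \<open>auto simp: indicator_def\<close>)
    finally show ?thesis by (simp add: a_def)
  qed
  obtain vs where vs: "set vs = R" "distinct vs" using finite_distinct_list[OF fR] by blast
  define L where "L = map (\<lambda>v. (r * a v, v, J v / of_real (a v))) vs"
  have dec: "1 - cos (\<xi> \<bullet> s x) = (\<Sum>v\<in>R. (1 - cos (\<xi> \<bullet> v)) * indicat_real (A v) x)" if "x \<in> space M" for \<xi> x
  proof (cases "s x = 0")
    case True
    have "(\<Sum>v\<in>R. (1 - cos (\<xi> \<bullet> v)) * indicat_real (A v) x) = 0"
      by (rule sum.neutral) (use True in \<open>auto simp: A_def R_def\<close>)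
    thus ?thesis using True by simp
  next
    case False
    hence sx: "s x \<in> R" using that by (auto simp: R_def)
    have "(\<Sum>v\<in>R. (1 - cos (\<xi> \<bullet> v)) * indicat_real (A v) x) = (\<Sum>v\<in>R. if v = s x then 1 - cos (\<xi> \<bullet> v) else 0)"
      using that by (intro sum.cong) (auto simp: A_def indicator_def)
    thus ?thesis using sx fR by simp
  qed
  show ?thesis
  proof (rule that[of L])
    show "0 \<le> b \<and> norm w \<le> 1" if bzw: "(b, z, w) \<in> set L" for b z w
    proof -
      obtain v where v: "v \<in> R" "b = r * a v" "w = J v / of_real (a v)" using bzw by (auto simp: L_def vs)
      have "0 \<le> a v" by (simp add: a_def)
      thus ?thesis using r Jb[OF v(1)] by (cases "a v = 0") (auto simp: v norm_divide divide_le_eq_1)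
    qed
    fix \<xi> :: "real ^ 'd"
    have "(LINT x|M. 1 - cos (\<xi> \<bullet> s x)) = (LINT x|M. (\<Sum>v\<in>R. (1 - cos (\<xi> \<bullet> v)) * indicat_real (A v) x))"
      using dec by (intro Bochner_Integration.integral_cong) auto
    also have "\<dots> = (\<Sum>v\<in>R. (LINT x|M. (1 - cos (\<xi> \<bullet> v)) * indicat_real (A v) x))"
      using Af by (intro Bochner_Integration.integral_sum integrable_mult_right integrable_real_indicator) auto
    also have "\<dots> = (\<Sum>v\<in>R. a v * (1 - cos (\<xi> \<bullet> v)))" by (simp add: a_def mult.commute)
    finally have 1: "(LINT x|M. 1 - cos (\<xi> \<bullet> s x)) = (\<Sum>v\<in>R. a v * (1 - cos (\<xi> \<bullet> v)))" .
    show "atom_den L \<xi> = r * (LINT x|M. 1 - cos (\<xi> \<bullet> s x))"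
      unfolding 1 by (simp add: atom_den_def L_def comp_def sum_list_distinct_conv_sum_set vs sum_distrib_left mult.assoc)
    have "(LINT x|M. of_real (1 - cos (\<xi> \<bullet> s x)) * k x) = (LINT x|M. (\<Sum>v\<in>R. of_real (1 - cos (\<xi> \<bullet> v)) * (indicat_real (A v) x *\<^sub>R k x)))"
      using dec by (intro Bochner_Integration.integral_cong) (auto simp: sum_distrib_right scaleR_conv_of_real mult.assoc simp del: of_real_diff)
    also have "\<dots> = (\<Sum>v\<in>R. (LINT x|M. of_real (1 - cos (\<xi> \<bullet> v)) * (indicat_real (A v) x *\<^sub>R k x)))"
      using ki by (intro Bochner_Integration.integral_sum integrable_mult_right) auto
    also have "\<dots> = (\<Sum>v\<in>R. of_real (a v * (1 - cos (\<xi> \<bullet> v))) * (J v / of_real (a v)))"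
    proof (rule sum.cong)
      fix v assume v: "v \<in> R"
      \<comment> \<open>On a level set of measure 0 the integral \<open>J v\<close> vanishes too, so
        the division by \<open>a v\<close> loses nothing.\<close>
      have "J v = of_real (a v) * (J v / of_real (a v))" using Jb[OF v] by (cases "a v = 0") auto
      thus "(LINT x|M. of_real (1 - cos (\<xi> \<bullet> v)) * (indicat_real (A v) x *\<^sub>R k x)) = of_real (a v * (1 - cos (\<xi> \<bullet> v))) * (J v / of_real (a v))"
        unfolding integral_mult_right_zero J_def[symmetric] of_real_mult by (metis (no_types, lifting) mult.assoc mult.commute)
    qed simp
    finally have 2: "(LINT x|M. of_real (1 - cos (\<xi> \<bullet> s x)) * k x) = (\<Sum>v\<in>R. of_real (a v * (1 - cos (\<xi> \<bullet> v))) * (J v / of_real (a v)))" .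
    show "atom_num L \<xi> = of_real r * (LINT x|M. of_real (1 - cos (\<xi> \<bullet> s x)) * k x)"
      unfolding 2 by (simp add: atom_num_def L_def comp_def sum_list_distinct_conv_sum_set vs sum_distrib_left mult.assoc)
  qed
qed

text \<open>Common form of the two approximations: r n = 1 for V and r n = (n+1)^2 for the spherical
  measure, each with its majorant W. The last inequality later makes the numerator vanish together
  with the denominator.\<close>

lemma atoms_approximate:
  fixes s :: "nat \<Rightarrow> 'a \<Rightarrow> real ^ 'd" and k :: "'a \<Rightarrow> complex"
  assumes s: "\<And>n. simple_function M (s n)" and fin: "\<And>n. emeasure M {x \<in> space M. s n x \<noteq> 0} < \<infinity>"
    and k [measurable]: "k \<in> borel_measurable M" and kb: "\<And>x. x \<in> space M \<Longrightarrow> norm (k x) \<le> 1"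
    and r: "\<And>n. 0 \<le> r n" and q [measurable]: "\<And>\<xi>. q \<xi> \<in> borel_measurable M"
    and lim: "\<And>\<xi> x. x \<in> space M \<Longrightarrow> (\<lambda>n. r n * (1 - cos (\<xi> \<bullet> s n x))) \<longlonglongrightarrow> q \<xi> x"
    and dom: "\<And>n \<xi> x. x \<in> space M \<Longrightarrow> r n * (1 - cos (\<xi> \<bullet> s n x)) \<le> W \<xi> x"
    and W: "\<And>\<xi>. integrable M (W \<xi>)"
  obtains L where "\<And>n a z w. (a, z, w) \<in> set (L n) \<Longrightarrow> 0 \<le> a \<and> norm w \<le> 1"
    "\<And>\<xi>. (\<lambda>n. atom_den (L n) \<xi>) \<longlonglongrightarrow> (LINT x|M. q \<xi> x)"
    "\<And>\<xi>. (\<lambda>n. atom_num (L n) \<xi>) \<longlonglongrightarrow> (LINT x|M. of_real (q \<xi> x) * k x)"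
    "\<And>\<xi>. norm (LINT x|M. of_real (q \<xi> x) * k x) \<le> (LINT x|M. q \<xi> x)"
proof -
  note [measurable] = borel_measurable_simple_function[OF s]
  define c where "c n \<xi> x = r n * (1 - cos (\<xi> \<bullet> s n x))" for n \<xi> x
  have [measurable]: "c n \<xi> \<in> borel_measurable M" for n \<xi> unfolding c_def by measurable
  have c0: "0 \<le> c n \<xi> x" for n \<xi> x using r by (simp add: c_def)
  have c: "(\<lambda>n. c n \<xi> x) \<longlonglongrightarrow> q \<xi> x" "c n \<xi> x \<le> W \<xi> x" if "x \<in> space M" for n \<xi> x
    using lim[OF that] dom[OF that] by (auto simp: c_def)
  have q0: "0 \<le> q \<xi> x" and qW: "q \<xi> x \<le> W \<xi> x" if "x \<in> space M" for \<xi> x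
    using LIMSEQ_le_const[OF c(1)[OF that]] LIMSEQ_le_const2[OF c(1)[OF that]] c0 c(2)[OF that] by blast+
  have "\<exists>L. \<forall>n. (\<forall>a z w. (a, z, w) \<in> set (L n) \<longrightarrow> 0 \<le> a \<and> norm w \<le> 1) \<and>
    (\<forall>\<xi>. atom_den (L n) \<xi> = r n * (LINT x|M. 1 - cos (\<xi> \<bullet> s n x))) \<and>
    (\<forall>\<xi>. atom_num (L n) \<xi> = of_real (r n) * (LINT x|M. of_real (1 - cos (\<xi> \<bullet> s n x)) * k x))"
    (is "\<exists>L. \<forall>n. ?P n (L n)")
  proof (rule choice, rule allI)
    fix n
    show "\<exists>L. ?P n L"
      by (rule atoms_of_simple_function[OF s[of n] fin[of n] k kb r[of n]]) (assumption, blast)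
  qed
  then obtain L where L: "\<And>n a z w. (a, z, w) \<in> set (L n) \<Longrightarrow> 0 \<le> a \<and> norm w \<le> 1"
    "\<And>n \<xi>. atom_den (L n) \<xi> = r n * (LINT x|M. 1 - cos (\<xi> \<bullet> s n x))"
    "\<And>n \<xi>. atom_num (L n) \<xi> = of_real (r n) * (LINT x|M. of_real (1 - cos (\<xi> \<bullet> s n x)) * k x)" by metis
  have den: "atom_den (L n) \<xi> = (LINT x|M. c n \<xi> x)" for n \<xi> unfolding L(2) c_def by simp
  have num: "atom_num (L n) \<xi> = (LINT x|M. of_real (c n \<xi> x) * k x)" for n \<xi>
    unfolding L(3) c_def integral_mult_right_zero[symmetric] of_real_mult by (simp only: mult.assoc)
  have nb: "norm (complex_of_real t * k x) \<le> t" if "x \<in> space M" "0 \<le> t" for t x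
    using mult_left_mono[OF kb[OF that(1)] that(2)] that(2) by (simp add: norm_mult)
  show ?thesis
  proof (rule that[OF L(1)])
    fix \<xi> :: "real ^ 'd"
    show "(\<lambda>n. atom_den (L n) \<xi>) \<longlonglongrightarrow> (LINT x|M. q \<xi> x)"
      unfolding den
      by (rule integral_dominated_convergence[OF _ _ W[of \<xi>]]) (use c c0 in \<open>auto intro!: AE_I2\<close>)
    show "(\<lambda>n. atom_num (L n) \<xi>) \<longlonglongrightarrow> (LINT x|M. of_real (q \<xi> x) * k x)"
      unfolding num
    proof (rule integral_dominated_convergence[OF _ _ W[of \<xi>]])
      show "AE x in M. (\<lambda>n. of_real (c n \<xi> x) * k x) \<longlonglongrightarrow> of_real (q \<xi> x) * k x"
        by (intro AE_I2 tendsto_mult tendsto_of_real c(1) tendsto_const)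
      show "AE x in M. norm (of_real (c n \<xi> x) * k x) \<le> W \<xi> x" for n
        using nb c0 c(2) order_trans by (intro AE_I2) blast
    qed simp_all
    have "norm (q \<xi> x) \<le> norm (W \<xi> x)" if "x \<in> space M" for x
      using q0[OF that, of \<xi>] qW[OF that, of \<xi>] by simp
    hence iq: "integrable M (q \<xi>)"
      by (intro Bochner_Integration.integrable_bound[OF W[of \<xi>]] AE_I2) auto
    have "norm (LINT x|M. of_real (q \<xi> x) * k x) \<le> (LINT x|M. norm (of_real (q \<xi> x) * k x))"
      by (rule integral_norm_bound)
    also have "\<dots> \<le> (LINT x|M. q \<xi> x)"
    proof (rule integral_mono[OF _ iq])
      show "integrable M (\<lambda>x. norm (of_real (q \<xi> x) * k x))"
        by (rule Bochner_Integration.integrable_bound[OF iq])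
           (use nb q0 order_trans[OF _ abs_ge_self] in \<open>auto intro!: AE_I2\<close>)
    qed (rule nb, auto simp: q0)
    finally show "norm (LINT x|M. of_real (q \<xi> x) * k x) \<le> (LINT x|M. q \<xi> x)" .
  qed
qed

lemma inner_square_le:
  fixes x y :: "'a::real_inner"
  assumes "norm y \<le> B"
  shows "(x \<bullet> y)\<^sup>2 \<le> (norm x * B)\<^sup>2"
proof -
  have "\<bar>x \<bullet> y\<bar> \<le> norm x * B"
    using Cauchy_Schwarz_ineq2[of x y] mult_left_mono[OF assms, of "norm x"] by simp
  thus ?thesis by (metis abs_ge_zero power2_abs power_mono)
qed

lemma levy_measure_atoms:
  fixes V :: "(real ^ 'd) measure" and \<phi> :: "real ^ 'd \<Rightarrow> complex"
  assumes V: "sets V = sets borel"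
    and levy: "(\<integral>\<^sup>+ z. ennreal (min ((norm z)\<^sup>2) 1) \<partial>V) < \<infinity>"
    and \<phi>: "\<phi> \<in> borel_measurable borel" and \<phi>b: "\<And>z. norm (\<phi> z) \<le> 1"
  obtains L where "\<And>n a z w. (a, z, w) \<in> set (L n) \<Longrightarrow> 0 \<le> a \<and> norm w \<le> 1"
    "\<And>\<xi>. (\<lambda>n. atom_den (L n) \<xi>) \<longlonglongrightarrow> (LINT z|V. 1 - cos (\<xi> \<bullet> z))"
    "\<And>\<xi>. (\<lambda>n. atom_num (L n) \<xi>) \<longlonglongrightarrow> (LINT z|V. of_real (1 - cos (\<xi> \<bullet> z)) * \<phi> z)"
    "\<And>\<xi>. norm (LINT z|V. of_real (1 - cos (\<xi> \<bullet> z)) * \<phi> z) \<le> (LINT z|V. 1 - cos (\<xi> \<bullet> z))"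
proof -
  note [measurable_cong] = V and [measurable] = \<phi>
  have "(\<lambda>z. z) \<in> borel_measurable V" by measurable
  from borel_measurable_implies_sequence_metric[OF this, of 0]
  obtain F where F: "\<And>i. simple_function V (F i)" "\<And>z. (\<lambda>i. F i z) \<longlonglongrightarrow> z" "\<And>i z. norm (F i z) \<le> 2 * norm z"
    using sets_eq_imp_space_eq[OF V] by auto
  \<comment> \<open>The approximants are set to 0 near the origin, where V may have infinite mass.
    Elsewhere min(|z|^2, 1) is at least 1/(n+1)^2, so the remaining mass is finite.\<close>
  define s where "s n z = (if norm z \<ge> 1 / real (Suc n) then F n z else 0)" for n z
  have ss: "simple_function V (s n)" for n
    unfolding s_def by (intro simple_function_If F simple_function_const) (auto simp: V)
  have sb: "norm (s n z) \<le> 2 * norm z" for n z using F(3) by (auto simp: s_def)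
  have sl: "(\<lambda>n. s n z) \<longlonglongrightarrow> z" for z
  proof (cases "z = 0")
    case True
    have "s n 0 = 0" for n using sb[of n 0] by simp
    thus ?thesis using True by simp
  next
    case False
    have "(\<lambda>n. 1 / real (Suc n)) \<longlonglongrightarrow> 0" by (rule LIMSEQ_Suc[OF lim_1_over_n])
    hence "\<forall>\<^sub>F n in sequentially. 1 / real (Suc n) < norm z" using False by (intro order_tendstoD) auto
    hence "\<forall>\<^sub>F n in sequentially. s n z = F n z" by eventually_elim (simp add: s_def)
    thus ?thesis using F(2)[of z] by (simp add: tendsto_cong)
  qed
  have fin: "emeasure V {x \<in> space V. s n x \<noteq> 0} < \<infinity>" for n
  proof -
    let ?B = "{z::real^'d. norm z \<ge> 1 / real (Suc n)}"
    have "emeasure V {x \<in> space V. s n x \<noteq> 0} \<le> emeasure V ?B"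
      by (intro emeasure_mono) (auto simp: s_def V split: if_splits)
    also have "\<dots> = (\<integral>\<^sup>+ z. indicator ?B z \<partial>V)" by (simp add: V)
    also have "\<dots> \<le> (\<integral>\<^sup>+ z. ennreal ((real (Suc n))\<^sup>2) * ennreal (min ((norm z)\<^sup>2) 1) \<partial>V)"
    proof (intro nn_integral_mono)
      fix z :: "real ^ 'd"
      show "indicator ?B z \<le> ennreal ((real (Suc n))\<^sup>2) * ennreal (min ((norm z)\<^sup>2) 1)"
      proof (cases "z \<in> ?B")
        case True
        hence "1 \<le> real (Suc n) * norm z" by (simp add: field_simps)
        hence "1 \<le> (real (Suc n) * norm z)\<^sup>2" by (rule one_le_power)
        hence "1 \<le> (real (Suc n))\<^sup>2 * min ((norm z)\<^sup>2) 1"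
          by (auto simp: min_def power_mult_distrib intro: one_le_power)
        thus ?thesis using True by (simp add: ennreal_mult'[symmetric] flip: ennreal_1)
      qed auto
    qed
    also have "\<dots> = ennreal ((real (Suc n))\<^sup>2) * (\<integral>\<^sup>+ z. ennreal (min ((norm z)\<^sup>2) 1) \<partial>V)"
      by (rule nn_integral_cmult) measurable
    also have "\<dots> < \<infinity>" using levy by (simp add: ennreal_mult_less_top)
    finally show ?thesis .
  qed
  \<comment> \<open>For |z| <= 1 the bound 1 - cos u <= u^2/2 is used with |s n z| <= 2 |z|, for
    larger z the bound 2; the constant is the sum of both.\<close>
  have dom: "1 * (1 - cos (\<xi> \<bullet> s n z)) \<le> (2 + 2 * (norm \<xi>)\<^sup>2) * min ((norm z)\<^sup>2) 1" for n \<xi> z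
  proof -
    let ?u = "\<xi> \<bullet> s n z"
    have "1 - cos ?u \<le> 2 * (norm \<xi>)\<^sup>2 * (norm z)\<^sup>2"
      using one_minus_cos_bounds(3)[of ?u] inner_square_le[OF sb, of \<xi> n z] by (simp add: power_mult_distrib)
    note bounds = this one_minus_cos_bounds(2)[of ?u]
    show ?thesis
    proof (cases "(norm z)\<^sup>2 \<le> 1")
      case True
      hence "min ((norm z)\<^sup>2) 1 = (norm z)\<^sup>2" by simp
      moreover have "0 \<le> 2 * (norm z)\<^sup>2" by simp
      ultimately show ?thesis using bounds unfolding distrib_right mult_1 by linarith
    next
      case False
      hence "min ((norm z)\<^sup>2) 1 = 1" by simp
      moreover have "0 \<le> 2 * (norm \<xi>)\<^sup>2" by simp
      ultimately show ?thesis using bounds unfolding distrib_right mult_1 by linarith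
    qed
  qed
  have "integrable V (\<lambda>z. min ((norm z)\<^sup>2) 1)"
    using levy by (intro integrableI_nonneg) (auto intro!: AE_I2)
  hence W: "integrable V (\<lambda>z. (2 + 2 * (norm \<xi>)\<^sup>2) * min ((norm z)\<^sup>2) 1)" for \<xi> :: "real ^ 'd" by simp
  have lim: "(\<lambda>n. 1 * (1 - cos (\<xi> \<bullet> s n z))) \<longlonglongrightarrow> 1 - cos (\<xi> \<bullet> z)" for \<xi> z
    unfolding mult_1 by (intro tendsto_intros sl)
  show ?thesis
    by (rule atoms_approximate[where s = s and k = \<phi> and r = "\<lambda>_. 1" and q = "\<lambda>\<xi> z. 1 - cos (\<xi> \<bullet> z)",
          OF ss fin _ \<phi>b zero_le_one _ lim dom W]; (rule that; assumption)?) measurable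
qed

text \<open>The limit t^2/2 of (n+1)^2 (1 - cos(t/(n+1))) accounts for the factor 1/2 before the
  spherical integrals. Finiteness of \<mu> makes the constant majorant 2 |\<xi>|^2
  integrable.\<close>

lemma spherical_measure_atoms:
  fixes \<mu> :: "(real ^ 'd) measure" and \<psi> :: "real ^ 'd \<Rightarrow> complex"
  assumes \<mu>: "sets \<mu> = sets (restrict_space borel (sphere 0 1))" and fm: "finite_measure \<mu>"
    and \<psi>: "\<psi> \<in> borel_measurable (restrict_space borel (sphere 0 1))" and \<psi>b: "\<And>\<theta>. \<theta> \<in> sphere 0 1 \<Longrightarrow> norm (\<psi> \<theta>) \<le> 1"
  obtains L where "\<And>n a z w. (a, z, w) \<in> set (L n) \<Longrightarrow> 0 \<le> a \<and> norm w \<le> 1"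
    "\<And>\<xi>. (\<lambda>n. atom_den (L n) \<xi>) \<longlonglongrightarrow> (LINT \<theta>|\<mu>. (\<xi> \<bullet> \<theta>)\<^sup>2 / 2)"
    "\<And>\<xi>. (\<lambda>n. atom_num (L n) \<xi>) \<longlonglongrightarrow> (LINT \<theta>|\<mu>. of_real ((\<xi> \<bullet> \<theta>)\<^sup>2 / 2) * \<psi> \<theta>)"
    "\<And>\<xi>. norm (LINT \<theta>|\<mu>. of_real ((\<xi> \<bullet> \<theta>)\<^sup>2 / 2) * \<psi> \<theta>) \<le> (LINT \<theta>|\<mu>. (\<xi> \<bullet> \<theta>)\<^sup>2 / 2)"
proof -
  interpret finite_measure \<mu> by (rule fm)
  have sp: "space \<mu> = sphere 0 1" using sets_eq_imp_space_eq[OF \<mu>] by (simp add: space_restrict_space)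
  have \<psi>m: "\<psi> \<in> borel_measurable \<mu>" unfolding measurable_cong_sets[OF \<mu> refl] by (rule \<psi>)
  have \<psi>b': "\<theta> \<in> space \<mu> \<Longrightarrow> norm (\<psi> \<theta>) \<le> 1" for \<theta> using \<psi>b sp by auto
  have idm [measurable]: "(\<lambda>z. z) \<in> borel_measurable \<mu>"
    unfolding measurable_cong_sets[OF \<mu> refl] by (rule measurable_restrict_space1) simp
  from borel_measurable_implies_sequence_metric[OF idm, of 0]
  obtain F where F': "\<forall>i. simple_function \<mu> (F i)" "\<forall>z\<in>space \<mu>. (\<lambda>i. F i z) \<longlonglongrightarrow> z"
    "\<forall>i. \<forall>z\<in>space \<mu>. dist (F i z) 0 \<le> 2 * dist z 0"
    by blast
  have F: "simple_function \<mu> (F i)" "\<And>z. z \<in> space \<mu> \<Longrightarrow> (\<lambda>i. F i z) \<longlonglongrightarrow> z"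
    "\<And>z. z \<in> space \<mu> \<Longrightarrow> norm (F i z) \<le> 2" for i
    using F' by (auto simp: sp)
  define s where "s n z = (1 / real (Suc n)) *\<^sub>R F n z" for n z
  have ss: "simple_function \<mu> (s n)" for n
    unfolding s_def by (rule simple_function_compose1[OF F(1)])
  have fin: "emeasure \<mu> {x \<in> space \<mu>. s n x \<noteq> 0} < \<infinity>" for n
    unfolding infinity_ennreal_def less_top[symmetric] by (rule emeasure_finite)
  have dom: "(real (Suc n))\<^sup>2 * (1 - cos (\<xi> \<bullet> s n x)) \<le> 2 * (norm \<xi>)\<^sup>2" if "x \<in> space \<mu>" for n \<xi> x
  proof -
    have "(real (Suc n))\<^sup>2 * (1 - cos (\<xi> \<bullet> s n x)) \<le> (real (Suc n))\<^sup>2 * ((\<xi> \<bullet> s n x)\<^sup>2 / 2)"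
      by (intro mult_left_mono one_minus_cos_bounds) auto
    also have "\<dots> = (\<xi> \<bullet> F n x)\<^sup>2 / 2" by (simp add: s_def power_divide)
    finally show ?thesis using inner_square_le[OF F(3)[OF that, of n], of \<xi>] by (simp add: power_mult_distrib)
  qed
  have lim: "(\<lambda>n. (real (Suc n))\<^sup>2 * (1 - cos (\<xi> \<bullet> s n x))) \<longlonglongrightarrow> (\<xi> \<bullet> x)\<^sup>2 / 2" if "x \<in> space \<mu>" for \<xi> x
    using scaled_one_minus_cos_tendsto[OF tendsto_inner[OF tendsto_const F(2)[OF that], of \<xi>]]
    by (simp add: s_def)
  have W: "integrable \<mu> (\<lambda>x. 2 * (norm \<xi>)\<^sup>2)" for \<xi> :: "real ^ 'd" by simp
  show ?thesis
    by (rule atoms_approximate[OF ss fin \<psi>m \<psi>b' zero_le_power2 _ lim dom W]) (measurable, rule that)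
qed

text \<open>
  Adding \<open>e|\<xi>|\<^sup>2\<close> to the denominator only makes it positive off the origin; the zeros of the original
  denominator then cause no trouble when \<open>V\<close> and \<open>\<mu>\<close> are replaced by atoms.
\<close>

lemma isotropic_atoms:
  fixes e :: real
  assumes e: "0 \<le> e"
  obtains L :: "nat \<Rightarrow> (real ^ 'd) transform_step list" where "\<And>n a z w. (a, z, w) \<in> set (L n) \<Longrightarrow> 0 \<le> a \<and> norm w \<le> 1"
    "\<And>\<xi>. (\<lambda>n. atom_den (L n) \<xi>) \<longlonglongrightarrow> e * (norm \<xi>)\<^sup>2" "\<And>n \<xi>. atom_num (L n) \<xi> = 0"
proof -
  obtain bs :: "(real ^ 'd) list" where bs: "set bs = Basis" "distinct bs" using finite_distinct_list[OF finite_Basis] by blast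
  \<comment> \<open>The factor 2 offsets the 1/2 in the limit, and the coefficient 0 keeps these
    atoms out of the numerator.\<close>
  define L where "L n = map (\<lambda>b. (2 * e * (real (Suc n))\<^sup>2, (1 / real (Suc n)) *\<^sub>R b, 0 :: complex)) bs" for n
  show ?thesis
  proof (rule that[of L])
    show "0 \<le> a \<and> norm w \<le> 1" if "(a, z, w) \<in> set (L n)" for n a z w using that e by (auto simp: L_def)
    show "atom_num (L n) \<xi> = 0" for n \<xi> by (simp add: L_def atom_num_def comp_def)
    fix \<xi> :: "real ^ 'd"
    have "(\<lambda>n. \<Sum>b\<in>Basis. 2 * e * ((real (Suc n))\<^sup>2 * (1 - cos ((\<xi> \<bullet> b) / real (Suc n))))) \<longlonglongrightarrow> (\<Sum>b\<in>Basis. 2 * e * ((\<xi> \<bullet> b)\<^sup>2 / 2))"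
      by (intro tendsto_sum tendsto_mult_left scaled_one_minus_cos_tendsto tendsto_const)
    moreover have "(\<Sum>b\<in>Basis. 2 * e * ((\<xi> \<bullet> b)\<^sup>2 / 2)) = e * (norm \<xi>)\<^sup>2"
      unfolding power2_norm_eq_inner euclidean_inner[of \<xi> \<xi>] by (simp add: sum_distrib_left power2_eq_square)
    ultimately show "(\<lambda>n. atom_den (L n) \<xi>) \<longlonglongrightarrow> e * (norm \<xi>)\<^sup>2"
      by (simp add: atom_den_def L_def comp_def sum_list_distinct_conv_sum_set bs mult.assoc)
  qed
qed

lemma Lp_multiplier_levy:
  fixes V \<mu> :: "(real ^ 'd) measure" and \<phi> \<psi> :: "real ^ 'd \<Rightarrow> complex"
  assumes V: "sets V = sets borel" and levy: "(\<integral>\<^sup>+ z. ennreal (min ((norm z)\<^sup>2) 1) \<partial>V) < \<infinity>"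
    and \<mu>: "sets \<mu> = sets (restrict_space borel (sphere 0 1))" "finite_measure \<mu>"
    and \<phi>: "\<phi> \<in> borel_measurable borel" "\<And>z. norm (\<phi> z) \<le> 1"
    and \<psi>: "\<psi> \<in> borel_measurable (restrict_space borel (sphere 0 1))" "\<And>\<theta>. \<theta> \<in> sphere 0 1 \<Longrightarrow> norm (\<psi> \<theta>) \<le> 1"
    and p: "1 < p"
  shows "Lp_multiplier p (levy_multiplier V \<mu> \<phi> \<psi>)"
proof -
  obtain A where A: "\<And>n a z w. (a, z, w) \<in> set (A n) \<Longrightarrow> 0 \<le> a \<and> norm w \<le> 1"
    "\<And>\<xi>. (\<lambda>n. atom_den (A n) \<xi>) \<longlonglongrightarrow> (LINT z|V. 1 - cos (\<xi> \<bullet> z))"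
    "\<And>\<xi>. (\<lambda>n. atom_num (A n) \<xi>) \<longlonglongrightarrow> (LINT z|V. of_real (1 - cos (\<xi> \<bullet> z)) * \<phi> z)"
    and Ab: "\<And>\<xi>. norm (LINT z|V. of_real (1 - cos (\<xi> \<bullet> z)) * \<phi> z) \<le> (LINT z|V. 1 - cos (\<xi> \<bullet> z))"
    by (rule levy_measure_atoms[OF V levy \<phi>]) blast
  obtain B where B: "\<And>n a z w. (a, z, w) \<in> set (B n) \<Longrightarrow> 0 \<le> a \<and> norm w \<le> 1"
    "\<And>\<xi>. (\<lambda>n. atom_den (B n) \<xi>) \<longlonglongrightarrow> (LINT \<theta>|\<mu>. (\<xi> \<bullet> \<theta>)\<^sup>2 / 2)"
    "\<And>\<xi>. (\<lambda>n. atom_num (B n) \<xi>) \<longlonglongrightarrow> (LINT \<theta>|\<mu>. of_real ((\<xi> \<bullet> \<theta>)\<^sup>2 / 2) * \<psi> \<theta>)"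
    and Bb: "\<And>\<xi>. norm (LINT \<theta>|\<mu>. of_real ((\<xi> \<bullet> \<theta>)\<^sup>2 / 2) * \<psi> \<theta>) \<le> (LINT \<theta>|\<mu>. (\<xi> \<bullet> \<theta>)\<^sup>2 / 2)"
    by (rule spherical_measure_atoms[OF \<mu> \<psi>]; (rule that; assumption)?)
  define num where "num \<xi> = (LINT z|V. of_real (1 - cos (\<xi> \<bullet> z)) * \<phi> z) + (LINT \<theta>|\<mu>. of_real ((\<xi> \<bullet> \<theta>)\<^sup>2 / 2) * \<psi> \<theta>)" for \<xi>
  define den where "den \<xi> = (LINT z|V. 1 - cos (\<xi> \<bullet> z)) + (LINT \<theta>|\<mu>. (\<xi> \<bullet> \<theta>)\<^sup>2 / 2)" for \<xi>
  have M: "levy_multiplier V \<mu> \<phi> \<psi> \<xi> = (if den \<xi> = 0 then 0 else num \<xi> / of_real (den \<xi>))" for \<xi>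
    by (simp add: levy_multiplier_def num_def den_def Let_def)
  have den0: "0 \<le> den \<xi>" for \<xi>
    unfolding den_def by (intro add_nonneg_nonneg integral_nonneg_AE) auto
  have numden: "norm (num \<xi>) \<le> den \<xi>" for \<xi>
    unfolding num_def den_def by (intro norm_triangle_le add_mono Ab Bb)
  have reg: "Lp_multiplier p (\<lambda>\<xi>. num \<xi> / of_real (den \<xi> + e * (norm \<xi>)\<^sup>2))" if e: "0 < e" for e
  proof -
    obtain I :: "nat \<Rightarrow> (real ^ 'd) transform_step list" where I: "\<And>n a z w. (a, z, w) \<in> set (I n) \<Longrightarrow> 0 \<le> a \<and> norm w \<le> 1"
      "\<And>\<xi>. (\<lambda>n. atom_den (I n) \<xi>) \<longlonglongrightarrow> e * (norm \<xi>)\<^sup>2" "\<And>n \<xi>. atom_num (I n) \<xi> = 0"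
      by (rule isotropic_atoms[of e]) (use e in auto)
    define L where "L n = A n @ B n @ I n" for n
    have at: "Lp_multiplier p (\<lambda>\<xi>. atom_num (L n) \<xi> / of_real (atom_den (L n) \<xi>))" for n
      by (rule Lp_multiplier_atomic[OF p]) (use A(1) B(1) I(1) in \<open>auto simp: L_def\<close>)
    show ?thesis
    proof (rule Lp_multiplier_limit[OF p at])
      \<comment> \<open>The only zero of the regularized denominator is the origin, a null
        set.\<close>
      have "AE \<xi>::real^'d in lborel. \<xi> \<noteq> 0" by (rule AE_lborel_singleton)
      thus "AE \<xi> in lborel. (\<lambda>n. atom_num (L n) \<xi> / of_real (atom_den (L n) \<xi>)) \<longlonglongrightarrow> num \<xi> / of_real (den \<xi> + e * (norm \<xi>)\<^sup>2)"
      proof eventually_elim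
        case (elim \<xi>)
        have "den \<xi> + e * (norm \<xi>)\<^sup>2 > 0" using den0[of \<xi>] elim e by (intro add_nonneg_pos) auto
        moreover have "(\<lambda>n. atom_num (L n) \<xi>) \<longlonglongrightarrow> num \<xi>"
          unfolding L_def atom_num_append I(3) num_def add_0_right by (intro tendsto_add A B)
        moreover have "(\<lambda>n. atom_den (L n) \<xi>) \<longlonglongrightarrow> den \<xi> + e * (norm \<xi>)\<^sup>2"
          unfolding L_def atom_den_append den_def add.assoc by (intro tendsto_add A B I)
        ultimately show ?case by (intro tendsto_divide tendsto_of_real) (auto simp only: of_real_eq_0_iff)
      qed
    qed
  qed
  show ?thesis
  proof (rule Lp_multiplier_limit[OF p reg[of "1 / real (Suc n)" for n]], simp, intro AE_I2)
    fix \<xi> :: "real ^ 'd"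
    show "(\<lambda>n. num \<xi> / of_real (den \<xi> + 1 / real (Suc n) * (norm \<xi>)\<^sup>2)) \<longlonglongrightarrow> levy_multiplier V \<mu> \<phi> \<psi> \<xi>"
    proof (cases "den \<xi> = 0")
      case True
      \<comment> \<open>By \<open>numden\<close> the numerator vanishes too, so each regularized
        quotient already has the prescribed value 0.\<close>
      hence "num \<xi> = 0" using numden[of \<xi>] by simp
      thus ?thesis using True by (simp add: M)
    next
      case False
      have "(\<lambda>n. den \<xi> + 1 / real (Suc n) * (norm \<xi>)\<^sup>2) \<longlonglongrightarrow> den \<xi> + 0 * (norm \<xi>)\<^sup>2"
        by (intro tendsto_intros LIMSEQ_Suc[OF lim_1_over_n])
      hence "(\<lambda>n. num \<xi> / of_real (den \<xi> + 1 / real (Suc n) * (norm \<xi>)\<^sup>2)) \<longlonglongrightarrow> num \<xi> / of_real (den \<xi>)"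
        using False by (intro tendsto_divide tendsto_const tendsto_of_real) auto
      thus ?thesis using False by (simp add: M)
    qed
  qed
qed

section \<open>The multiplier operator on L^2 and its extension to L^p\<close>

lemma multiplier_op_Lp:
  fixes f :: "real ^ 'd \<Rightarrow> complex"
  assumes M: "Lp_multiplier p M" and f: "f \<in> Lp 2 \<inter> Lp p"
  shows "multiplier_op M f \<in> Lp 2 \<inter> Lp p" "AE \<xi> in lborel. fourier_L2 (multiplier_op M f) \<xi> = M \<xi> * fourier_L2 f \<xi>"
    "Lp_norm p (multiplier_op M f) \<le> pstar_minus_1 p * Lp_norm p f"
proof -
  obtain h where h: "h \<in> Lp 2" "h \<in> Lp p" "AE \<xi> in lborel. fourier_L2 h \<xi> = M \<xi> * fourier_L2 f \<xi>"
    "Lp_norm p h \<le> pstar_minus_1 p * Lp_norm p f"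
    using M f unfolding Lp_multiplier_def by blast
  have "\<exists>h. h \<in> Lp 2 \<and> (AE \<xi> in lborel. fourier_L2 h \<xi> = M \<xi> * fourier_L2 f \<xi>)" using h by blast
  from someI_ex[OF this, folded multiplier_op_def]
  have g: "multiplier_op M f \<in> Lp 2" "AE \<xi> in lborel. fourier_L2 (multiplier_op M f) \<xi> = M \<xi> * fourier_L2 f \<xi>" by auto
  \<comment> \<open>\<open>SOME\<close> chooses within L^2 only; injectivity of the transform
    identifies its choice with h almost everywhere, and the L^p bound is inherited from h.\<close>
  have "AE \<xi> in lborel. fourier_L2 (multiplier_op M f) \<xi> = fourier_L2 h \<xi>" using g(2) h(3) by eventually_elim simp
  hence eq: "AE x in lborel. multiplier_op M f x = h x" by (rule fourier_L2_inj_AE[OF g(1) h(1)])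
  note c = Lp_cong_AE[OF Lp_measurable[OF g(1)] Lp_measurable[OF h(1)] eq]
  show "multiplier_op M f \<in> Lp 2 \<inter> Lp p" using c(1)[of p] h(2) g(1) by blast
  show "AE \<xi> in lborel. fourier_L2 (multiplier_op M f) \<xi> = M \<xi> * fourier_L2 f \<xi>" by (rule g(2))
  show "Lp_norm p (multiplier_op M f) \<le> pstar_minus_1 p * Lp_norm p f" using c(2)[of p] h(4) by simp
qed

text \<open>Each value of the operator is a separate choice, so linearity holds up to null sets; it
  is read off on the Fourier side.\<close>

lemma multiplier_op_lin:
  fixes f g :: "real ^ 'd \<Rightarrow> complex"
  assumes M: "Lp_multiplier p M" and p: "1 \<le> p" and f: "f \<in> Lp 2 \<inter> Lp p" and g: "g \<in> Lp 2 \<inter> Lp p"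
  shows "AE x in lborel. multiplier_op M (\<lambda>y. a * f y + b * g y) x = a * multiplier_op M f x + b * multiplier_op M g x"
proof (rule fourier_L2_inj_AE)
  have c: "(\<lambda>y. a * f y + b * g y) \<in> Lp 2 \<inter> Lp p" using f g p by (auto intro!: Lp_add Lp_scale)
  note Mf = multiplier_op_Lp[OF M f] and Mg = multiplier_op_Lp[OF M g] and Mc = multiplier_op_Lp[OF M c]
  show "multiplier_op M (\<lambda>y. a * f y + b * g y) \<in> Lp 2" using Mc(1) by blast
  show "(\<lambda>x. a * multiplier_op M f x + b * multiplier_op M g x) \<in> Lp 2" using Mf(1) Mg(1) by (auto intro!: Lp_add Lp_scale)
  have "f \<in> Lp 2" "g \<in> Lp 2" "multiplier_op M f \<in> Lp 2" "multiplier_op M g \<in> Lp 2" using f g Mf(1) Mg(1) by auto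
  note lin = fourier_L2_lin[OF this(1,2), of a b] fourier_L2_lin[OF this(3,4), of a b]
  show "AE \<xi> in lborel. fourier_L2 (multiplier_op M (\<lambda>y. a * f y + b * g y)) \<xi> = fourier_L2 (\<lambda>x. a * multiplier_op M f x + b * multiplier_op M g x) \<xi>"
    using lin Mc(2) Mf(2) Mg(2) by eventually_elim (simp add: algebra_simps)
qed

text \<open>Truncations make the intersection of L^2 and L^p dense in L^p, which yields existence
  and uniqueness. Boundedness and linearity up to null sets together make S Lipschitz, as the limit
  construction requires.\<close>

lemma Lp_extension:
  fixes S :: "(real ^ 'd \<Rightarrow> complex) \<Rightarrow> real ^ 'd \<Rightarrow> complex"
  assumes p: "1 \<le> p" and C: "0 \<le> C" and S: "\<And>f. f \<in> Lp 2 \<inter> Lp p \<Longrightarrow> S f \<in> Lp p"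
    and bound: "\<And>f. f \<in> Lp 2 \<inter> Lp p \<Longrightarrow> Lp_norm p (S f) \<le> C * Lp_norm p f"
    and lin: "\<And>f g a b. f \<in> Lp 2 \<inter> Lp p \<Longrightarrow> g \<in> Lp 2 \<inter> Lp p \<Longrightarrow>
        AE x in lborel. S (\<lambda>y. a * f y + b * g y) x = a * S f x + b * S g x"
  shows "\<exists>T. bounded_linear_Lp p T \<and> (\<forall>g \<in> Lp 2 \<inter> Lp p. AE x in lborel. T g x = S g x) \<and>
         (\<forall>g \<in> Lp p. Lp_norm p (T g) \<le> C * Lp_norm p g) \<and>
         (\<forall>T'. bounded_linear_Lp p T' \<and> (\<forall>g \<in> Lp 2 \<inter> Lp p. AE x in lborel. T' g x = S g x) \<longrightarrow>
               (\<forall>g \<in> Lp p. AE x in lborel. T' g x = T g x))"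
proof -
  let ?D = "Lp 2 \<inter> Lp p :: (real ^ 'd \<Rightarrow> complex) set"
  have p0: "0 < p" using p by simp
  have lip: "Lp_norm p (\<lambda>x. S v x - S w x) \<le> C * Lp_norm p (\<lambda>x. v x - w x)" if v: "v \<in> ?D" and w: "w \<in> ?D" for v w
  proof -
    have d: "(\<lambda>x. v x - w x) \<in> ?D" using v w p by (auto intro!: Lp_diff)
    have "AE x in lborel. S (\<lambda>x. v x - w x) x = S v x - S w x" using lin[OF v w, of 1 "-1"] by simp
    hence "Lp_norm p (\<lambda>x. S v x - S w x) = Lp_norm p (S (\<lambda>x. v x - w x))"
      using Lp_measurable[OF S[OF v]] Lp_measurable[OF S[OF w]] Lp_measurable[OF S[OF d]]
      by (intro Lp_cong_AE) auto
    thus ?thesis using bound[OF d] by simp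
  qed
  have approx: "\<exists>u. (\<forall>n. u n \<in> ?D) \<and> Lp_tendsto p u f" if f: "f \<in> Lp p" for f
  proof -
    obtain u where "\<And>n q. 1 \<le> q \<Longrightarrow> u n \<in> Lp q" "Lp_tendsto p u f"
      by (rule Lp_approx[OF p f]) blast
    thus ?thesis using p by (intro exI[of _ u]) auto
  qed
  define T where "T f = (SOME h. h \<in> Lp p \<and> (\<forall>v. (\<forall>n. v n \<in> ?D) \<and> Lp_tendsto p v f \<longrightarrow> Lp_tendsto p (\<lambda>n. S (v n)) h))" for f
  have T: "T f \<in> Lp p \<and> (\<forall>v. (\<forall>n. v n \<in> ?D) \<and> Lp_tendsto p v f \<longrightarrow> Lp_tendsto p (\<lambda>n. S (v n)) (T f))" if f: "f \<in> Lp p" for f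
  proof -
    obtain u where u: "\<And>n. u n \<in> ?D" "Lp_tendsto p u f" using approx[OF f] by blast
    have "\<exists>h. h \<in> Lp p \<and> (\<forall>v. (\<forall>n. v n \<in> ?D) \<and> Lp_tendsto p v f \<longrightarrow> Lp_tendsto p (\<lambda>n. S (v n)) h)"
      by (rule Lp_limit_extension[OF p _ S C lip u]) auto
    from someI_ex[OF this] show ?thesis unfolding T_def .
  qed
  have Tlim: "Lp_tendsto p (\<lambda>n. S (v n)) (T f)" if "\<And>n. v n \<in> ?D" "Lp_tendsto p v f" for v f
    using T[OF Lp_tendstoD(2)[OF that(2)]] that by blast
  have TS: "AE x in lborel. T g x = S g x" if g: "g \<in> ?D" for g
  proof -
    \<comment> \<open>The constant sequence is one of the admissible approximations, so T agrees
      with S where S is already defined.\<close>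
    have const: "Lp_tendsto p (\<lambda>_. h) h" if "h \<in> Lp p" for h :: "real ^ 'd \<Rightarrow> complex"
      using that p0 by (intro Lp_tendstoI) (auto simp: Lp_zero)
    show ?thesis
      by (rule Lp_tendsto_unique[OF p Tlim const[OF S[OF g]]]) (use g const in auto)
  qed
  have Tb: "Lp_norm p (T g) \<le> C * Lp_norm p g" if g: "g \<in> Lp p" for g
  proof -
    obtain u where u: "\<And>n. u n \<in> ?D" "Lp_tendsto p u g" using approx[OF g] by blast
    show ?thesis
      by (rule LIMSEQ_le[OF Lp_tendsto_norm[OF p Tlim[OF u]] tendsto_mult_left[OF Lp_tendsto_norm[OF p u(2)]]])
         (use bound u(1) in auto)
  qed
  have "bounded_linear_Lp p T"
    unfolding bounded_linear_Lp_def
  proof (intro conjI ballI allI)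
    show "T g \<in> Lp p" if "g \<in> Lp p" for g using T[OF that] by blast
    show "\<exists>C. \<forall>g\<in>Lp p. Lp_norm p (T g) \<le> C * Lp_norm p g" using Tb by blast
    fix f g :: "real ^ 'd \<Rightarrow> complex" and a b :: complex assume f: "f \<in> Lp p" and g: "g \<in> Lp p"
    obtain u where u: "\<And>n. u n \<in> ?D" "Lp_tendsto p u f" using approx[OF f] by blast
    obtain v where v: "\<And>n. v n \<in> ?D" "Lp_tendsto p v g" using approx[OF g] by blast
    have D: "(\<lambda>x. a * u n x + b * v n x) \<in> ?D" for n using u(1)[of n] v(1)[of n] p by (auto intro!: Lp_add Lp_scale)
    have 1: "Lp_tendsto p (\<lambda>n. S (\<lambda>x. a * u n x + b * v n x)) (T (\<lambda>x. a * f x + b * g x))"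
      by (rule Tlim[OF D Lp_tendsto_lin[OF p u(2) v(2)]])
    have 2: "Lp_tendsto p (\<lambda>n x. a * S (u n) x + b * S (v n) x) (\<lambda>x. a * T f x + b * T g x)"
      by (rule Lp_tendsto_lin[OF p Tlim[OF u] Tlim[OF v]])
    have "Lp_tendsto p (\<lambda>n x. a * S (u n) x + b * S (v n) x) (T (\<lambda>x. a * f x + b * g x))"
      by (rule Lp_tendsto_cong_AE[OF 1])
         (use lin[OF u(1) v(1)] Lp_measurable[OF Lp_tendstoD(1)[OF 2]] Lp_measurable[OF Lp_tendstoD(2)[OF 1]] in auto)
    from Lp_tendsto_unique[OF p this 2]
    show "AE x in lborel. T (\<lambda>y. a * f y + b * g y) x = a * T f x + b * T g x" .
  qed
  moreover have "AE x in lborel. T' g x = T g x"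
    if T': "bounded_linear_Lp p T'" "\<forall>g \<in> ?D. AE x in lborel. T' g x = S g x" and g: "g \<in> Lp p" for T' g
  proof -
    have T'L: "\<And>g. g \<in> Lp p \<Longrightarrow> T' g \<in> Lp p" using T'(1) by (auto simp: bounded_linear_Lp_def)
    have T'l: "AE x in lborel. T' (\<lambda>y. a * f y + b * g y) x = a * T' f x + b * T' g x" if "f \<in> Lp p" "g \<in> Lp p" for f g a b
      using T'(1) that by (auto simp: bounded_linear_Lp_def)
    obtain C' where C': "\<And>g. g \<in> Lp p \<Longrightarrow> Lp_norm p (T' g) \<le> C' * Lp_norm p g"
      using T'(1) unfolding bounded_linear_Lp_def by blast
    obtain u where u: "\<And>n. u n \<in> ?D" "Lp_tendsto p u g" using approx[OF g] by blast
    note uL = Lp_tendstoD[OF u(2)]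
    have "Lp_tendsto p (\<lambda>n. T' (u n)) (T' g)"
    proof (rule Lp_tendstoI[OF T'L[OF uL(1)] T'L[OF g]], rule Lim_null_comparison)
      show "(\<lambda>n. C' * Lp_norm p (\<lambda>x. u n x - g x)) \<longlonglongrightarrow> 0" using tendsto_mult_left[OF uL(3), of C'] by simp
      show "\<forall>\<^sub>F n in sequentially. norm (Lp_norm p (\<lambda>x. T' (u n) x - T' g x)) \<le> C' * Lp_norm p (\<lambda>x. u n x - g x)"
      proof (intro always_eventually allI)
        fix n
        have d: "(\<lambda>x. u n x - g x) \<in> Lp p" by (rule Lp_diff[OF p uL(1) g])
        have "AE x in lborel. T' (\<lambda>x. u n x - g x) x = T' (u n) x - T' g x" using T'l[OF uL(1) g, of 1 n "-1"] by simp
        hence "Lp_norm p (\<lambda>x. T' (u n) x - T' g x) = Lp_norm p (T' (\<lambda>x. u n x - g x))"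
          using Lp_measurable[OF T'L[OF uL(1)]] Lp_measurable[OF T'L[OF g]] Lp_measurable[OF T'L[OF d]]
          by (intro Lp_cong_AE) auto
        thus "norm (Lp_norm p (\<lambda>x. T' (u n) x - T' g x)) \<le> C' * Lp_norm p (\<lambda>x. u n x - g x)"
          using C'[OF d] by simp
      qed
    qed
    hence "Lp_tendsto p (\<lambda>n. S (u n)) (T' g)"
      by (rule Lp_tendsto_cong_AE) (use T'(2) u(1) Lp_measurable[OF S[OF u(1)]] Lp_measurable[OF T'L[OF g]] in auto)
    from Lp_tendsto_unique[OF p this Tlim[OF u]] show ?thesis .
  qed
  ultimately show ?thesis using TS Tb by (intro exI[of _ T]) blast
qed

theorem theorem1p1:
  fixes V \<mu> :: "(real ^ 'd) measure"
    and \<phi> \<psi> :: "real ^ 'd \<Rightarrow> complex"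
    and p :: real
  assumes V_borel: "sets V = sets borel"
    and V_zero: "emeasure V {0} = 0"
    and V_levy: "(\<integral>\<^sup>+ z. ennreal (min ((norm z)\<^sup>2) 1) \<partial>V) < \<infinity>"
    and \<mu>_borel: "sets \<mu> = sets (restrict_space borel (sphere 0 1))"
    and \<mu>_finite: "finite_measure \<mu>"
    and \<phi>_meas: "\<phi> \<in> borel_measurable borel"
    and \<phi>_bound: "\<And>z. norm (\<phi> z) \<le> 1"
    and \<psi>_meas: "\<psi> \<in> borel_measurable (restrict_space borel (sphere 0 1))"
    and \<psi>_bound: "\<And>\<theta>. \<theta> \<in> sphere 0 1 \<Longrightarrow> norm (\<psi> \<theta>) \<le> 1"
    and p: "1 < p"
  defines "\<M> \<equiv> multiplier_op (levy_multiplier V \<mu> \<phi> \<psi>)"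
  shows "(\<forall>g \<in> Lp 2 \<inter> Lp p. \<M> g \<in> Lp p \<and> Lp_norm p (\<M> g) \<le> pstar_minus_1 p * Lp_norm p g) \<and>
    (\<exists>T. bounded_linear_Lp p T \<and>
         (\<forall>g \<in> Lp 2 \<inter> Lp p. AE x in lborel. T g x = \<M> g x) \<and>
         (\<forall>g \<in> Lp p. Lp_norm p (T g) \<le> pstar_minus_1 p * Lp_norm p g) \<and>
         (\<forall>T'. bounded_linear_Lp p T' \<and>
               (\<forall>g \<in> Lp 2 \<inter> Lp p. AE x in lborel. T' g x = \<M> g x) \<longrightarrow>
               (\<forall>g \<in> Lp p. AE x in lborel. T' g x = T g x)))"
proof -
  have M: "Lp_multiplier p (levy_multiplier V \<mu> \<phi> \<psi>)"
    by (rule Lp_multiplier_levy[OF V_borel V_levy \<mu>_borel \<mu>_finite \<phi>_meas \<phi>_bound \<psi>_meas \<psi>_bound p])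
  have p1: "1 \<le> p" using p by simp
  have 1: "\<M> g \<in> Lp p" "Lp_norm p (\<M> g) \<le> pstar_minus_1 p * Lp_norm p g" if "g \<in> Lp 2 \<inter> Lp p" for g
    using multiplier_op_Lp[OF M that] unfolding \<M>_def by auto
  have 2: "AE x in lborel. \<M> (\<lambda>y. a * f y + b * g y) x = a * \<M> f x + b * \<M> g x"
    if "f \<in> Lp 2 \<inter> Lp p" "g \<in> Lp 2 \<inter> Lp p" for f g a b
    unfolding \<M>_def by (rule multiplier_op_lin[OF M p1 that])
  show ?thesis
    by (intro conjI ballI 1 Lp_extension[OF p1 less_imp_le[OF pstar_pos[OF p]] 1 2])
qed

end
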